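(* Let $W$ satisfy Assumption (W) (stated in the context) and let $A$ be the generalised Airy operator in $L^2(\mathbb{R})$ $$A = -\partial_x + W(x), \qquad \mathrm{Dom}(A) = W^{1,2}(\mathbb{R}) \cap \mathrm{Dom}(W).$$ Then $-A$ generates a $C_0$-semigroup of contractions $(S_t)_{t \ge 0}$ on $L^2(\mathbb{R})$. Moreover, for any $t \ge 0$ and any $f \in L^2(\mathbb{R})$, we have $$(S_t f)(x) = \exp (g_t(x))\, f(x+t), \qquad g_t(x) := -\int_{x}^{x+t} W(s)\, ds, \qquad x \in \mathbb{R},$$ and there exists $t_0 \ge 0$ such that $$\| S_t \| = \exp \left( -2 \int_{0}^{\frac{t}{2}} W(s)\, ds \right), \qquad t \ge t_0.$$
   Context: Assumption (W): $W:\mathbb{R}\to\mathbb{R}$ belongs to $L^\infty_{\mathrm{loc}}(\mathbb{R}) \cap C^2(\mathbb{R}\setminus[-x_0,x_0])$ for some $x_0>0$, $W\ge 0$ a.e., and: (i) $W$ is even: $W(-x)=W(x)$ for $x\in\mathbb{R}$; (ii) $\lim_{x\to+\infty}W(x)=+\infty$ and $W'(x)>0$ for $x>x_0$; (iii) there exist $\nu\in[-1,+\infty)$ and a constant $C>0$ such that $W'(x)\le C\,W(x)x^\nu$ and $|W''(x)|\le C\,W'(x)x^\nu$ for all $x>x_0$; (iv) with this $\nu$, $\Upsilon_1(x):=|x|^\nu|W'(x)|^{-1/2}\to 0$ as $|x|\to+\infty$. $\mathrm{Dom}(W)=\{u\in L^2(\mathbb{R}): Wu\in L^2(\mathbb{R})\}$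 and $W^{1,2}(\mathbb{R})$ is the Sobolev space. The norm $\|S_t\|$ is the operator norm on $L^2(\mathbb{R})$. *)

theory Defs
  imports "HOL-Analysis.Analysis"
begin

section \<open>The complex Hilbert space of square-integrable functions on the real line\<close>

definition sq_int :: "(real \<Rightarrow> complex) \<Rightarrow> bool" where
  "sq_int f \<longleftrightarrow> f \<in> borel_measurable lebesgue \<and> integrable lebesgue (\<lambda>x. (cmod (f x))\<^sup>2)"

definition l2_eq :: "(real \<Rightarrow> complex) \<Rightarrow> (real \<Rightarrow> complex) \<Rightarrow> bool" where
  "l2_eq f g \<longleftrightarrow> sq_int f \<and> sq_int g \<and> (AE x in lebesgue. f x = g x)"

lemma sq_int_zero: "sq_int (\<lambda>x. 0)"
  by (simp add: sq_int_def)

lemma sq_int_cmult: "sq_int f \<Longrightarrow> sq_int (\<lambda>x. c * f x)"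
  by (auto simp: sq_int_def norm_mult power_mult_distrib)

lemma sq_int_add:
  assumes "sq_int f" "sq_int g"
  shows "sq_int (\<lambda>x. f x + g x)"
proof -
  have m [measurable]: "f \<in> borel_measurable lebesgue" "g \<in> borel_measurable lebesgue"
    using assms by (auto simp: sq_int_def)
  have "integrable lebesgue (\<lambda>x. (cmod (f x + g x))\<^sup>2)"
  proof (rule Bochner_Integration.integrable_bound)
    show "integrable lebesgue (\<lambda>x. 2 * (cmod (f x))\<^sup>2 + 2 * (cmod (g x))\<^sup>2)"
      using assms by (auto simp: sq_int_def)
    have "(cmod (a + b))\<^sup>2 \<le> 2 * (cmod a)\<^sup>2 + 2 * (cmod b)\<^sup>2" for a b
    proof -
      have "(cmod (a + b))\<^sup>2 \<le> (cmod a + cmod b)\<^sup>2"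
        by (simp add: norm_triangle_ineq power_mono)
      also have "\<dots> \<le> 2 * (cmod a)\<^sup>2 + 2 * (cmod b)\<^sup>2"
        using sum_squares_ge_zero[of "cmod a - cmod b" 0]
        by (simp add: power2_eq_square algebra_simps)
      finally show ?thesis .
    qed
    then show "AE x in lebesgue. norm ((cmod (f x + g x))\<^sup>2)
        \<le> norm (2 * (cmod (f x))\<^sup>2 + 2 * (cmod (g x))\<^sup>2)"
      by (auto intro!: AE_I2)
  qed measurable
  then show ?thesis by (auto simp: sq_int_def)
qed

lemma integrable_inner_sq_int:
  assumes "sq_int f" "sq_int g"
  shows "integrable lebesgue (\<lambda>x. f x \<bullet> g x)"
proof -
  have m [measurable]: "f \<in> borel_measurable lebesgue" "g \<in> borel_measurable lebesgue"
    using assms by (auto simp: sq_int_def)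
  show ?thesis
  proof (rule Bochner_Integration.integrable_bound)
    show "integrable lebesgue (\<lambda>x. (cmod (f x))\<^sup>2 + (cmod (g x))\<^sup>2)"
      using assms by (auto simp: sq_int_def)
    have "\<bar>a \<bullet> b\<bar> \<le> (cmod a)\<^sup>2 + (cmod b)\<^sup>2" for a b
    proof -
      have "\<bar>a \<bullet> b\<bar> \<le> cmod a * cmod b" by (rule Cauchy_Schwarz_ineq2)
      also have "2 * (cmod a * cmod b) \<le> (cmod a)\<^sup>2 + (cmod b)\<^sup>2"
        using sum_squares_bound[of "cmod a" "cmod b"] by simp
      then have "cmod a * cmod b \<le> (cmod a)\<^sup>2 + (cmod b)\<^sup>2"
        using mult_nonneg_nonneg[OF norm_ge_zero norm_ge_zero, of a b] by linarith
      finally show ?thesis .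
    qed
    then show "AE x in lebesgue. norm (f x \<bullet> g x) \<le> norm ((cmod (f x))\<^sup>2 + (cmod (g x))\<^sup>2)"
      by (auto intro!: AE_I2)
  qed measurable
qed

quotient_type l2 = "real \<Rightarrow> complex" / partial: l2_eq
proof (rule part_equivpI)
  show "\<exists>f. l2_eq f f"
    by (rule exI[of _ "\<lambda>x. 0"]) (simp add: l2_eq_def sq_int_zero)
  show "symp l2_eq"
    by (auto simp: symp_def l2_eq_def elim: AE_mp)
  show "transp l2_eq"
    unfolding transp_def l2_eq_def by (auto elim: eventually_elim2)
qed

lift_definition cscale :: "complex \<Rightarrow> l2 \<Rightarrow> l2" is "\<lambda>c f x. c * f x"
  by (auto simp: l2_eq_def sq_int_cmult)

instantiation l2 :: real_inner
begin

lift_definition zero_l2 :: l2 is "\<lambda>x. 0"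
  by (simp add: l2_eq_def sq_int_zero)

lift_definition plus_l2 :: "l2 \<Rightarrow> l2 \<Rightarrow> l2" is "\<lambda>f g x. f x + g x"
  unfolding l2_eq_def by (auto intro: sq_int_add elim: eventually_elim2)

definition "scaleR_l2 r f = cscale (of_real r) f"

definition "uminus_l2 f = cscale (- 1) f"

definition "minus_l2 f g = f + - (g :: l2)"

lift_definition inner_l2 :: "l2 \<Rightarrow> l2 \<Rightarrow> real" is "\<lambda>f g. LINT x|lebesgue. f x \<bullet> g x"
proof -
  fix f f' g g' :: "real \<Rightarrow> complex"
  assume a: "l2_eq f f'" "l2_eq g g'"
  then have [measurable]: "f \<in> borel_measurable lebesgue" "g \<in> borel_measurable lebesgue"
      "f' \<in> borel_measurable lebesgue" "g' \<in> borel_measurable lebesgue"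
    by (auto simp: l2_eq_def sq_int_def)
  show "(LINT x|lebesgue. f x \<bullet> g x) = (LINT x|lebesgue. f' x \<bullet> g' x)"
    by (rule integral_cong_AE) (use a in \<open>auto simp: l2_eq_def elim: eventually_elim2\<close>)
qed

lift_definition norm_l2 :: "l2 \<Rightarrow> real" is "\<lambda>f. sqrt (LINT x|lebesgue. (cmod (f x))\<^sup>2)"
proof -
  fix f f' :: "real \<Rightarrow> complex"
  assume a: "l2_eq f f'"
  then have [measurable]: "f \<in> borel_measurable lebesgue" "f' \<in> borel_measurable lebesgue"
    by (auto simp: l2_eq_def sq_int_def)
  have "(LINT x|lebesgue. (cmod (f x))\<^sup>2) = (LINT x|lebesgue. (cmod (f' x))\<^sup>2)"
    by (rule integral_cong_AE) (use a in \<open>auto simp: l2_eq_def elim: eventually_mono\<close>)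
  then show "sqrt (LINT x|lebesgue. (cmod (f x))\<^sup>2) = sqrt (LINT x|lebesgue. (cmod (f' x))\<^sup>2)"
    by simp
qed

definition "sgn_l2 f = inverse (norm f) *\<^sub>R (f :: l2)"

definition "dist_l2 f g = norm (f - (g :: l2))"

definition [code del]:
  "(uniformity :: (l2 \<times> l2) filter) = (INF e\<in>{0 <..}. principal {(x, y). dist x y < e})"

definition [code del]:
  "open (U :: l2 set) \<longleftrightarrow> (\<forall>x\<in>U. \<forall>\<^sub>F (x', y) in uniformity. x' = x \<longrightarrow> y \<in> U)"

instance
proof
  fix f g h :: l2 and r s :: real
  show "f + g + h = f + (g + h)"
    by transfer (auto simp: l2_eq_def intro!: sq_int_add simp: algebra_simps)
  show "f + g = g + f"
    by transfer (auto simp: l2_eq_def intro!: sq_int_add simp: algebra_simps)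
  show "0 + f = f"
    by transfer (auto simp: l2_eq_def)
  show "- f + f = 0"
    unfolding uminus_l2_def
    by transfer (auto simp: l2_eq_def sq_int_zero)
  show "f - g = f + - g"
    by (rule minus_l2_def)
  show "r *\<^sub>R (f + g) = r *\<^sub>R f + r *\<^sub>R g"
    unfolding scaleR_l2_def
    by transfer (auto simp: l2_eq_def distrib_left intro!: sq_int_add sq_int_cmult)
  show "(r + s) *\<^sub>R f = r *\<^sub>R f + s *\<^sub>R f"
    unfolding scaleR_l2_def
    by transfer (auto simp: l2_eq_def distrib_right intro!: sq_int_add sq_int_cmult)
  show "r *\<^sub>R s *\<^sub>R f = (r * s) *\<^sub>R f"
    unfolding scaleR_l2_def
    by transfer (auto simp: l2_eq_def mult.assoc intro!: sq_int_cmult)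
  show "1 *\<^sub>R f = f"
    unfolding scaleR_l2_def
    by transfer (auto simp: l2_eq_def)
  show "sgn f = inverse (norm f) *\<^sub>R f"
    by (rule sgn_l2_def)
  show "dist f g = norm (f - g)"
    by (rule dist_l2_def)
  show "(uniformity :: (l2 \<times> l2) filter) = (INF e\<in>{0 <..}. principal {(x, y). dist x y < e})"
    by (rule uniformity_l2_def)
  show "open U \<longleftrightarrow> (\<forall>x\<in>U. \<forall>\<^sub>F (x', y) in uniformity. x' = x \<longrightarrow> y \<in> U)" for U :: "l2 set"
    by (rule open_l2_def)
  show "f \<bullet> g = g \<bullet> f"
    by transfer (simp add: inner_commute)
  show "(f + g) \<bullet> h = f \<bullet> h + g \<bullet> h"
    by transfer (simp add: l2_eq_def inner_add_left integrable_inner_sq_int)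
  show "(r *\<^sub>R f) \<bullet> g = r * (f \<bullet> g)"
    unfolding scaleR_l2_def
    by transfer (simp add: inner_complex_def algebra_simps
        flip: integral_mult_right_zero)
  show "0 \<le> f \<bullet> f"
    by transfer simp
  show "f \<bullet> f = 0 \<longleftrightarrow> f = 0"
  proof transfer
    fix f assume "l2_eq f f"
    then have f: "sq_int f" by (simp add: l2_eq_def)
    have "(LINT x|lebesgue. f x \<bullet> f x) = 0 \<longleftrightarrow> (AE x in lebesgue. f x \<bullet> f x = 0)"
      by (rule integral_nonneg_eq_0_iff_AE) (use f integrable_inner_sq_int in auto)
    then show "(LINT x|lebesgue. f x \<bullet> f x) = 0 \<longleftrightarrow> l2_eq f (\<lambda>x. 0)"
      by (auto simp: l2_eq_def f sq_int_zero)
  qed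
  show "norm f = sqrt (f \<bullet> f)"
    by transfer (simp add: power2_norm_eq_inner)
qed

end

section \<open>Semigroups on this space and their generators\<close>

text \<open>The type class only records the real vector space structure, so complex homogeneity is
  required separately. Only the values at times \<open>t \<ge> 0\<close> matter.\<close>

definition C0_semigroup :: "(real \<Rightarrow> l2 \<Rightarrow> l2) \<Rightarrow> bool" where
  "C0_semigroup S \<longleftrightarrow>
     (\<forall>t\<ge>0. bounded_linear (S t) \<and> (\<forall>c f. S t (cscale c f) = cscale c (S t f))) \<and>
     (\<forall>f. S 0 f = f) \<and>
     (\<forall>s\<ge>0. \<forall>t\<ge>0. \<forall>f. S (s + t) f = S s (S t f)) \<and>
     (\<forall>f. ((\<lambda>t. S t f) \<longlongrightarrow> f) (at_right 0))"

definition C0_contraction_semigroup :: "(real \<Rightarrow> l2 \<Rightarrow> l2) \<Rightarrow> bool" where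
  "C0_contraction_semigroup S \<longleftrightarrow> C0_semigroup S \<and> (\<forall>t\<ge>0. onorm (S t) \<le> 1)"

definition generator_dom :: "(real \<Rightarrow> l2 \<Rightarrow> l2) \<Rightarrow> l2 set" where
  "generator_dom S = {f. \<exists>g. ((\<lambda>t. (S t f - f) /\<^sub>R t) \<longlongrightarrow> g) (at_right 0)}"

definition generator :: "(real \<Rightarrow> l2 \<Rightarrow> l2) \<Rightarrow> l2 \<Rightarrow> l2" where
  "generator S f = Lim (at_right 0) (\<lambda>t. (S t f - f) /\<^sub>R t)"

text \<open>An unbounded operator is given by its domain \<open>D\<close> and a map \<open>B\<close> of which only the values
  on \<open>D\<close> matter.\<close>

definition generates :: "l2 set \<Rightarrow> (l2 \<Rightarrow> l2) \<Rightarrow> (real \<Rightarrow> l2 \<Rightarrow> l2) \<Rightarrow> bool" where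
  "generates D B S \<longleftrightarrow> generator_dom S = D \<and> (\<forall>f\<in>D. generator S f = B f)"

section \<open>The Sobolev space and multiplication operators\<close>

definition test_function :: "(real \<Rightarrow> real) \<Rightarrow> bool" where
  "test_function \<phi> \<longleftrightarrow>
     (\<forall>n x. (deriv ^^ n) \<phi> differentiable (at x)) \<and> compact (closure {x. \<phi> x \<noteq> 0})"

definition is_weak_deriv :: "l2 \<Rightarrow> l2 \<Rightarrow> bool" where
  "is_weak_deriv f g \<longleftrightarrow> (\<forall>\<phi>. test_function \<phi> \<longrightarrow>
     (LINT x|lebesgue. rep_l2 f x * of_real (deriv \<phi> x)) =
     - (LINT x|lebesgue. rep_l2 g x * of_real (\<phi> x)))"

definition W12 :: "l2 set" where
  "W12 = {f. \<exists>g. is_weak_deriv f g}"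

definition weak_deriv :: "l2 \<Rightarrow> l2" where
  "weak_deriv f = (THE g. is_weak_deriv f g)"

definition mult_dom :: "(real \<Rightarrow> real) \<Rightarrow> l2 set" where
  "mult_dom W = {u. sq_int (\<lambda>x. of_real (W x) * rep_l2 u x)}"

definition mult_op :: "(real \<Rightarrow> real) \<Rightarrow> l2 \<Rightarrow> l2" where
  "mult_op W u = abs_l2 (\<lambda>x. of_real (W x) * rep_l2 u x)"

section \<open>The generalised Airy operator\<close>

definition Linf_loc :: "(real \<Rightarrow> real) \<Rightarrow> bool" where
  "Linf_loc W \<longleftrightarrow> W \<in> borel_measurable lebesgue \<and>
     (\<forall>K. compact K \<longrightarrow> (\<exists>M. AE x in lebesgue. x \<in> K \<longrightarrow> \<bar>W x\<bar> \<le> M))"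

definition C2_on :: "real set \<Rightarrow> (real \<Rightarrow> real) \<Rightarrow> bool" where
  "C2_on U W \<longleftrightarrow>
     (\<forall>x\<in>U. W differentiable (at x) \<and> deriv W differentiable (at x)) \<and>
     continuous_on U (deriv (deriv W))"

definition assumption_W :: "(real \<Rightarrow> real) \<Rightarrow> bool" where
  "assumption_W W \<longleftrightarrow> Linf_loc W \<and> (AE x in lebesgue. 0 \<le> W x) \<and>
     (\<forall>x. W (- x) = W x) \<and>
     filterlim W at_top at_top \<and>
     (\<exists>x0>0. C2_on (- {-x0..x0}) W \<and>
        (\<forall>x>x0. deriv W x > 0) \<and>
        (\<exists>\<nu>\<ge>-1.
           (\<exists>C>0. \<forall>x>x0. deriv W x \<le> C * W x * x powr \<nu> \<and>
                     \<bar>deriv (deriv W) x\<bar> \<le> C * deriv W x * x powr \<nu>) \<and>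
           ((\<lambda>x. \<bar>x\<bar> powr \<nu> * \<bar>deriv W x\<bar> powr (-1/2)) \<longlongrightarrow> 0) at_infinity))"

definition airy_dom :: "(real \<Rightarrow> real) \<Rightarrow> l2 set" where
  "airy_dom W = W12 \<inter> mult_dom W"

definition airy :: "(real \<Rightarrow> real) \<Rightarrow> l2 \<Rightarrow> l2" where
  "airy W f = - weak_deriv f + mult_op W f"

text \<open>Lebesgue integrals are taken over \<open>lebesgue\<close> throughout (not \<open>lborel\<close>), because \<open>W\<close> is
  only assumed Lebesgue measurable.\<close>

definition airy_g :: "(real \<Rightarrow> real) \<Rightarrow> real \<Rightarrow> real \<Rightarrow> real" where
  "airy_g W t x = - (LINT s:{x..x+t}|lebesgue. W s)"

end

theory Submission
  imports Defs
begin

text \<open>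
  The formula for \<open>S\<^sub>t\<close> is a translation weighted by \<open>exp (E x - E (x + t))\<close>, where \<open>E\<close> is the primitive
  \<open>prim W\<close> of the potential. It visibly satisfies the semigroup law, and it is a contraction because
  \<open>E\<close> increases. Strong continuity (\<open>evol_continuous_0\<close>) reduces to the continuity in the mean of the
  plain translations, which holds for indicators by regularity of Lebesgue measure and in general by
  density of simple functions.

  The main point is that the generator \<open>B\<close> of \<open>S\<close> is exactly \<open>- A\<close>, domains included. Both operators
  are compared with the integral operator
  \<open>R h x = \<integral> exp (- \<integral>\<^bsub>[x,s]\<^esub> (W + 1)) h(s) ds\<close>, integrated over \<open>s \<ge> x\<close>, which solves \<open>u + A u = h\<close> formally.
  Since \<open>S\<^sub>t\<close> acts explicitly on \<open>R h\<close>, the latter lies in the domain of \<open>B\<close> and \<open>B (R h) = R h - h\<close>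
  (\<open>gen_limit_resolvent\<close>). Testing difference quotients against smooth functions shows that every
  \<open>u\<close> in the domain of \<open>B\<close> for which \<open>W u\<close> is square integrable has the weak derivative \<open>B u + W u\<close>
  (\<open>gen_limit_weak_deriv\<close>). That \<open>W (R h)\<close> is square integrable is where the growth assumptions
  enter: together they give \<open>\<bar>W'\<bar> \<le> W\<^sup>2 / 2\<close> far out, so on the length scale \<open>1 / W\<close>, over which
  the kernel of \<open>R\<close> decays, \<open>W\<close> changes by a bounded factor only; a Schur test then bounds the operator
  \<open>W R\<close> (\<open>resolvent_in_mult_dom\<close>). Thus \<open>R\<close> is a right inverse of both \<open>1 - B\<close> and \<open>1 + A\<close>, with values
  in both domains. Moreover \<open>1 - B\<close> and \<open>1 + A\<close> are injective: \<open>B\<close> is dissipative as the generator of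
  contractions, and \<open>- A\<close> is dissipative because weak differentiation is the limit of difference
  quotients of the isometric translations (\<open>weak_deriv_dissipative\<close>) and \<open>W \<ge> 0\<close>. Hence both domains
  equal the range of \<open>R\<close>, and \<open>B\<close> and \<open>- A\<close> agree there (\<open>airy_generates\<close>).

  The operator norm of \<open>S\<^sub>t\<close> is the supremum of its continuous weight, so it remains to minimise the
  integral of \<open>W\<close> over windows of length \<open>t\<close>. For large \<open>t\<close> the window centred at the origin is optimal:
  moving it exchanges values of \<open>W\<close> near one end against larger values beyond the other
  (\<open>window_minimal_at_centre\<close>).
\<close>

section \<open>Representatives of square-integrable classes\<close>

lemma sq_int_rep: "sq_int (rep_l2 f)"
  using Quotient3_rel_rep[OF Quotient3_l2] Quotient3_rep_reflp[OF Quotient3_l2, of f]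
  by (auto simp: l2_eq_def)

lemma measurable_rep [measurable]: "rep_l2 f \<in> borel_measurable lebesgue"
  using sq_int_rep[of f] by (simp add: sq_int_def)

lemma abs_rep: "abs_l2 (rep_l2 f) = f"
  by (rule Quotient3_abs_rep[OF Quotient3_l2])

lemma rep_abs:
  assumes "sq_int f" shows "AE x in lebesgue. rep_l2 (abs_l2 f) x = f x"
proof -
  have "l2_eq f f" using assms by (simp add: l2_eq_def)
  then have "l2_eq (rep_l2 (abs_l2 f)) f" by (rule rep_abs_rsp_left[OF Quotient3_l2])
  then show ?thesis by (simp add: l2_eq_def)
qed

lemma abs_cong:
  assumes "sq_int f" "sq_int g" "AE x in lebesgue. f x = g x"
  shows "abs_l2 f = abs_l2 g"
  using Quotient3_rel[OF Quotient3_l2, of f g] assms by (auto simp: l2_eq_def)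

lemma l2_eqI:
  assumes "AE x in lebesgue. rep_l2 f x = rep_l2 g x" shows "f = g"
  using abs_cong[OF sq_int_rep sq_int_rep assms] by (simp add: abs_rep)

lemma sq_int_cong:
  assumes "sq_int f" "AE x in lebesgue. f x = g x" shows "sq_int g"
proof -
  have f: "f \<in> borel_measurable lebesgue" using assms by (simp add: sq_int_def)
  then have g: "g \<in> borel_measurable lebesgue"
    using borel_measurable_AE[OF f] assms(2) by auto
  have "integrable lebesgue (\<lambda>x. (cmod (g x))\<^sup>2) \<longleftrightarrow> integrable lebesgue (\<lambda>x. (cmod (f x))\<^sup>2)"
    by (rule integrable_cong_AE) (use assms f g in auto)
  then show ?thesis using assms g by (simp add: sq_int_def)
qed

lemma abs_eqI:
  assumes "AE x in lebesgue. f x = rep_l2 g x" shows "abs_l2 f = g"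
proof -
  have "sq_int f" by (rule sq_int_cong[OF sq_int_rep[of g]]) (use assms in auto)
  then show ?thesis using abs_cong[of f "rep_l2 g"] assms sq_int_rep abs_rep by simp
qed

lemma rep_plus: "AE x in lebesgue. rep_l2 (f + g) x = rep_l2 f x + rep_l2 g x"
proof -
  have "f + g = abs_l2 (\<lambda>x. rep_l2 f x + rep_l2 g x)"
    unfolding plus_l2_def by simp
  then show ?thesis using rep_abs[OF sq_int_add[OF sq_int_rep sq_int_rep]] by simp
qed

lemma rep_cscale: "AE x in lebesgue. rep_l2 (cscale c f) x = c * rep_l2 f x"
proof -
  have "cscale c f = abs_l2 (\<lambda>x. c * rep_l2 f x)"
    unfolding cscale_def by simp
  then show ?thesis using rep_abs[OF sq_int_cmult[OF sq_int_rep]] by simp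
qed

lemma rep_scaleR: "AE x in lebesgue. rep_l2 (r *\<^sub>R f) x = of_real r * rep_l2 f x"
  unfolding scaleR_l2_def by (rule rep_cscale)

lemma rep_uminus: "AE x in lebesgue. rep_l2 (- f) x = - rep_l2 f x"
  using rep_scaleR[of "-1" f] by simp

lemma rep_minus: "AE x in lebesgue. rep_l2 (f - g) x = rep_l2 f x - rep_l2 g x"
  using rep_plus[of f "-g"] rep_uminus[of g] by eventually_elim simp

lemma cscale_diff: "cscale c (f - g) = cscale c f - cscale c g"
  by (rule l2_eqI)
    (use rep_cscale[of c f] rep_cscale[of c g] rep_cscale[of c "f-g"] rep_minus[of f g]
       rep_minus[of "cscale c f" "cscale c g"] in \<open>eventually_elim, simp add: right_diff_distrib\<close>)

lemma norm_l2_sq: "(norm f)\<^sup>2 = (LINT x|lebesgue. (cmod (rep_l2 f x))\<^sup>2)"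
  by (simp add: norm_l2_def)

lemma inner_l2_rep: "f \<bullet> g = (LINT x|lebesgue. rep_l2 f x \<bullet> rep_l2 g x)"
  by (simp add: inner_l2_def)

text \<open>Extended nonnegative integrals carry the estimates below, because bounding such an integral
  proves square integrability and the norm bound at the same time.\<close>

lemma norm_l2_nn: "ennreal ((norm f)\<^sup>2) = (\<integral>\<^sup>+x. ennreal ((cmod (rep_l2 f x))\<^sup>2) \<partial>lebesgue)"
  unfolding norm_l2_sq using sq_int_rep[of f]
  by (subst nn_integral_eq_integral) (auto simp: sq_int_def)

lemma sq_int_boundI:
  assumes "f \<in> borel_measurable lebesgue"
    and "(\<integral>\<^sup>+x. ennreal ((cmod (f x))\<^sup>2) \<partial>lebesgue) \<le> ennreal (c\<^sup>2)"
  shows "sq_int f"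
  using assms unfolding sq_int_def
  by (auto intro!: integrableI_bounded simp: le_less_trans[OF _ ennreal_less_top])

lemma norm_l2_boundI:
  assumes "AE x in lebesgue. rep_l2 h x = f x" "c \<ge> 0"
    and "(\<integral>\<^sup>+x. ennreal ((cmod (f x))\<^sup>2) \<partial>lebesgue) \<le> ennreal (c\<^sup>2)"
  shows "norm h \<le> c"
proof -
  have "ennreal ((norm h)\<^sup>2) = (\<integral>\<^sup>+x. ennreal ((cmod (f x))\<^sup>2) \<partial>lebesgue)"
    unfolding norm_l2_nn by (rule nn_integral_cong_AE) (use assms(1) in auto)
  with assms(3) have "ennreal ((norm h)\<^sup>2) \<le> ennreal (c\<^sup>2)" by simp
  then have "(norm h)\<^sup>2 \<le> c\<^sup>2" by (simp only: ennreal_le_iff zero_le_power2)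
  then show ?thesis using assms(2) by (simp add: power2_le_iff_abs_le)
qed

lemma norm_l2_mono:
  assumes "AE x in lebesgue. cmod (rep_l2 f x) \<le> c * cmod (rep_l2 g x)" "c \<ge> 0"
  shows "norm f \<le> c * norm g"
proof -
  have "(norm f)\<^sup>2 \<le> (LINT x|lebesgue. c\<^sup>2 * (cmod (rep_l2 g x))\<^sup>2)"
    unfolding norm_l2_sq
  proof (rule integral_mono_AE)
    show "AE x in lebesgue. (cmod (rep_l2 f x))\<^sup>2 \<le> c\<^sup>2 * (cmod (rep_l2 g x))\<^sup>2"
      using assms(1)
      by eventually_elim (metis norm_ge_zero power_mono power_mult_distrib)
  qed (use sq_int_rep[of f] sq_int_rep[of g] in \<open>auto simp: sq_int_def\<close>)
  also have "\<dots> = (c * norm g)\<^sup>2" by (simp add: norm_l2_sq power_mult_distrib)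
  finally show ?thesis using assms(2) by (simp add: power2_le_iff_abs_le)
qed

lemma norm_cscale: "norm (cscale c f) = cmod c * norm f"
proof -
  have "(norm (cscale c f))\<^sup>2 = (LINT x|lebesgue. (cmod c)\<^sup>2 * (cmod (rep_l2 f x))\<^sup>2)"
    unfolding norm_l2_sq by (rule integral_cong_AE)
      (use rep_cscale[of c f] in \<open>auto elim!: eventually_mono simp: norm_mult power_mult_distrib\<close>)
  also have "\<dots> = (cmod c * norm f)\<^sup>2" by (simp add: norm_l2_sq power_mult_distrib)
  finally show ?thesis by (simp add: power2_eq_iff_nonneg)
qed

lemma sq_int_dominated:
  assumes "f \<in> borel_measurable lebesgue" "sq_int g"
    and "AE x in lebesgue. cmod (f x) \<le> c * cmod (g x)"
  shows "sq_int f"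
  unfolding sq_int_def
proof
  show "integrable lebesgue (\<lambda>x. (cmod (f x))\<^sup>2)"
  proof (rule Bochner_Integration.integrable_bound)
    show "integrable lebesgue (\<lambda>x. c\<^sup>2 * (cmod (g x))\<^sup>2)"
      using assms(2) by (simp add: sq_int_def)
    show "AE x in lebesgue. norm ((cmod (f x))\<^sup>2) \<le> norm (c\<^sup>2 * (cmod (g x))\<^sup>2)"
      using assms(3) by eventually_elim (simp, metis norm_ge_zero power_mono power_mult_distrib)
  qed (use assms(1) in measurable)
qed (fact assms(1))

text \<open>The bilinear pairing \<open>\<integral> f g\<close> without complex conjugation; the real inner product of the type
  class only sees the real part of a tested equation.\<close>

definition pair :: "l2 \<Rightarrow> l2 \<Rightarrow> complex" where
  "pair f g = (LINT x|lebesgue. rep_l2 f x * rep_l2 g x)"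

lemma integrable_mult_sq_int:
  assumes "sq_int f" "sq_int g"
  shows "integrable lebesgue (\<lambda>x. f x * g x)"
proof -
  have [measurable]: "f \<in> borel_measurable lebesgue" "g \<in> borel_measurable lebesgue"
    using assms by (auto simp: sq_int_def)
  have c: "sq_int (\<lambda>x. complex_of_real (cmod (f x)))" "sq_int (\<lambda>x. complex_of_real (cmod (g x)))"
    using assms by (auto simp: sq_int_def)
  show ?thesis
    by (rule Bochner_Integration.integrable_bound[OF integrable_inner_sq_int[OF c]])
      (auto simp: inner_complex_def norm_mult)
qed

lemma norm_pair_le: "cmod (pair f g) \<le> norm f * norm g"
proof -
  let ?f = "\<lambda>x. complex_of_real (cmod (rep_l2 f x))" and ?g = "\<lambda>x. complex_of_real (cmod (rep_l2 g x))"
  have c: "sq_int ?f" "sq_int ?g"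
    using sq_int_rep[of f] sq_int_rep[of g] by (auto simp: sq_int_def)
  have "cmod (pair f g) \<le> (LINT x|lebesgue. cmod (rep_l2 f x * rep_l2 g x))"
    unfolding pair_def by (rule integral_norm_bound)
  also have "\<dots> = abs_l2 ?f \<bullet> abs_l2 ?g"
    unfolding inner_l2_rep by (rule integral_cong_AE)
     (use rep_abs[OF c(1)] rep_abs[OF c(2)] in
        \<open>auto elim!: eventually_elim2 simp: inner_complex_def norm_mult\<close>)
  also have "\<dots> \<le> norm (abs_l2 ?f) * norm (abs_l2 ?g)"
    using Cauchy_Schwarz_ineq2 abs_le_D1 by blast
  also have "\<dots> \<le> norm f * norm g"
  proof (rule mult_mono)
    show "norm (abs_l2 ?f) \<le> norm f"
      using norm_l2_mono[of "abs_l2 ?f" 1 f] eventually_mono[OF rep_abs[OF c(1)]] by simp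
    show "norm (abs_l2 ?g) \<le> norm g"
      using norm_l2_mono[of "abs_l2 ?g" 1 g] eventually_mono[OF rep_abs[OF c(2)]] by simp
  qed auto
  finally show ?thesis .
qed

lemma pair_cong:
  assumes "AE x in lebesgue. rep_l2 f x * rep_l2 g x = h x"
  shows "pair f g = (LINT x|lebesgue. h x)"
proof -
  have "(\<lambda>x. rep_l2 f x * rep_l2 g x) \<in> borel_measurable lebesgue" by measurable
  from borel_measurable_AE[OF this assms] show ?thesis
    unfolding pair_def using assms by (intro integral_cong_AE) auto
qed

lemma bounded_bilinear_pair: "bounded_bilinear pair"
proof
  note i = integrable_mult_sq_int[OF sq_int_rep sq_int_rep]
  fix f g h :: l2 and r :: real
  show "pair (f + g) h = pair f h + pair g h"
    by (subst pair_cong[of _ _ "\<lambda>x. rep_l2 f x * rep_l2 h x + rep_l2 g x * rep_l2 h x"])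
      (use rep_plus[of f g] i in \<open>auto simp: pair_def algebra_simps elim: eventually_mono\<close>)
  show "pair f (g + h) = pair f g + pair f h"
    by (subst pair_cong[of _ _ "\<lambda>x. rep_l2 f x * rep_l2 g x + rep_l2 f x * rep_l2 h x"])
      (use rep_plus[of g h] i in \<open>auto simp: pair_def algebra_simps elim: eventually_mono\<close>)
  show "pair (r *\<^sub>R f) g = r *\<^sub>R pair f g"
    by (subst pair_cong[of _ _ "\<lambda>x. r *\<^sub>R (rep_l2 f x * rep_l2 g x)"])
      (use rep_scaleR[of r f] i in \<open>auto simp: pair_def algebra_simps scaleR_conv_of_real elim: eventually_mono\<close>)
  show "pair f (r *\<^sub>R g) = r *\<^sub>R pair f g"
    by (subst pair_cong[of _ _ "\<lambda>x. r *\<^sub>R (rep_l2 f x * rep_l2 g x)"])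
      (use rep_scaleR[of r g] i in \<open>auto simp: pair_def algebra_simps scaleR_conv_of_real elim: eventually_mono\<close>)
  show "\<exists>K. \<forall>a b. norm (pair a b) \<le> norm a * norm b * K"
    by (rule exI[of _ 1]) (simp add: norm_pair_le)
qed

text \<open>Pointwise convergence is required along null sequences only, so that the exceptional null set may
  depend on the sequence.\<close>

lemma l2_dominated_convergence:
  assumes F: "\<And>t. t > 0 \<Longrightarrow> AE x in lebesgue. cmod (rep_l2 (F t) x - rep_l2 f x) \<le> cmod (rep_l2 g x)"
    and lim: "\<And>u. u \<longlonglongrightarrow> 0 \<Longrightarrow> (\<And>n. u n > 0) \<Longrightarrow>
       AE x in lebesgue. (\<lambda>n. rep_l2 (F (u n)) x) \<longlonglongrightarrow> rep_l2 f x"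
  shows "(F \<longlongrightarrow> f) (at_right (0::real))"
  unfolding tendsto_at_iff_sequentially comp_def
proof (intro allI impI)
  fix u :: "nat \<Rightarrow> real"
  assume u: "\<forall>i. u i \<in> {0<..} - {0}" "u \<longlonglongrightarrow> 0"
  have pointwise: "AE x in lebesgue. (\<lambda>n. rep_l2 (F (u n)) x) \<longlonglongrightarrow> rep_l2 f x"
    using lim[OF u(2)] u(1) by simp
  have "(\<lambda>n. (LINT x|lebesgue. (cmod (rep_l2 (F (u n)) x - rep_l2 f x))\<^sup>2)) \<longlonglongrightarrow> (LINT x::real|lebesgue. (0::real))"
  proof (rule integral_dominated_convergence[where w="\<lambda>x. (cmod (rep_l2 g x))\<^sup>2"])
    show "integrable lebesgue (\<lambda>x. (cmod (rep_l2 g x))\<^sup>2)"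
      using sq_int_rep[of g] by (simp add: sq_int_def)
    show "AE x in lebesgue. (\<lambda>n. (cmod (rep_l2 (F (u n)) x - rep_l2 f x))\<^sup>2) \<longlonglongrightarrow> 0"
      using pointwise
    proof eventually_elim
      case (elim x)
      then have "(\<lambda>n. (cmod (rep_l2 (F (u n)) x - rep_l2 f x))\<^sup>2) \<longlonglongrightarrow> (cmod (rep_l2 f x - rep_l2 f x))\<^sup>2"
        by (intro tendsto_intros)
      then show ?case by simp
    qed
    show "AE x in lebesgue. norm ((cmod (rep_l2 (F (u n)) x - rep_l2 f x))\<^sup>2) \<le> (cmod (rep_l2 g x))\<^sup>2" for n
      using F[of "u n"] u(1) by (auto elim!: eventually_mono intro: power_mono)
  qed measurable
  also have "(\<lambda>n. (LINT x|lebesgue. (cmod (rep_l2 (F (u n)) x - rep_l2 f x))\<^sup>2)) = (\<lambda>n. (norm (F (u n) - f))\<^sup>2)"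
    unfolding norm_l2_sq
  proof (intro ext integral_cong_AE)
    show "AE x in lebesgue. (cmod (rep_l2 (F (u n)) x - rep_l2 f x))\<^sup>2 = (cmod (rep_l2 (F (u n) - f) x))\<^sup>2" for n
      using rep_minus[of "F (u n)" f] by eventually_elim simp
  qed measurable
  finally have "(\<lambda>n. sqrt ((norm (F (u n) - f))\<^sup>2)) \<longlonglongrightarrow> sqrt 0"
    by (intro tendsto_real_sqrt) simp
  then show "(\<lambda>n. F (u n)) \<longlonglongrightarrow> f"
    by (simp add: tendsto_norm_zero_iff LIM_zero_iff)
qed

section \<open>Borel representatives\<close>

lemma ex_borel_representative: "\<exists>g. g \<in> borel_measurable borel \<and> (AE x in lborel. rep_l2 f x = g x)"
proof -
  have "(\<lambda>x. Re (rep_l2 f x)) \<in> borel_measurable lebesgue" "(\<lambda>x. Im (rep_l2 f x)) \<in> borel_measurable lebesgue"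
    by measurable
  then obtain a b where [measurable]: "a \<in> borel_measurable lborel" "b \<in> borel_measurable lborel"
    and ab: "AE x in lborel. Re (rep_l2 f x) = a x" "AE x in lborel. Im (rep_l2 f x) = b x"
    using completion_ex_borel_measurable_real by metis
  have "(\<lambda>x. Complex (a x) (b x)) \<in> borel_measurable borel"
    unfolding Complex_eq by measurable
  moreover have "AE x in lborel. rep_l2 f x = Complex (a x) (b x)"
    using ab by eventually_elim (simp add: complex_eq_iff)
  ultimately show ?thesis by blast
qed

text \<open>Fubini's theorem needs joint measurability of expressions such as \<open>f (x + s)\<close>, which is
  immediate for Borel functions.\<close>

definition borel_rep :: "l2 \<Rightarrow> real \<Rightarrow> complex" where
  "borel_rep f = (SOME g. g \<in> borel_measurable borel \<and> (AE x in lborel. rep_l2 f x = g x))"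

lemma borel_rep_measurable [measurable]: "borel_rep f \<in> borel_measurable borel"
  and borel_rep_lborel: "AE x in lborel. rep_l2 f x = borel_rep f x"
  using someI_ex[OF ex_borel_representative[of f]] by (auto simp: borel_rep_def)

lemma borel_rep_AE: "AE x in lebesgue. rep_l2 f x = borel_rep f x"
  using borel_rep_lborel by (rule AE_completion)

lemma norm_l2_borel_rep: "ennreal ((norm f)\<^sup>2) = (\<integral>\<^sup>+x. ennreal ((cmod (borel_rep f x))\<^sup>2) \<partial>lborel)"
proof -
  have "ennreal ((norm f)\<^sup>2) = (\<integral>\<^sup>+x. ennreal ((cmod (borel_rep f x))\<^sup>2) \<partial>lebesgue)"
    unfolding norm_l2_nn by (rule nn_integral_cong_AE) (use borel_rep_AE[of f] in auto)
  then show ?thesis by (simp add: nn_integral_completion)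
qed

section \<open>Translation of the real line\<close>

lemma translation_measurable [measurable]: "(\<lambda>x. x + t) \<in> lebesgue \<rightarrow>\<^sub>M (lebesgue :: real measure)"
  using lebesgue_affine_measurable[where c="\<lambda>x::real. 1" and t=t] by (simp add: add.commute)

lemma AE_translation:
  assumes "AE x in lebesgue. P (x::real)" shows "AE x in lebesgue. P (x + t)"
proof -
  have "AE x in distr lebesgue lebesgue (\<lambda>x. t + 1 * x). P x"
    using assms by (subst (asm) lebesgue_real_affine[of 1 t]) (auto simp: AE_density)
  then have "AE x in lebesgue. P (t + 1 * x)"
    by (rule AE_distrD[rotated]) (use translation_measurable[of t] in \<open>simp add: add.commute\<close>)
  then show ?thesis by (simp add: add.commute)
qed

lemma integral_translation:
  fixes f :: "real \<Rightarrow> 'a :: euclidean_space"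
  shows "(LINT x|lebesgue. f (x + t)) = (LINT x|lebesgue. f x)"
  using lebesgue_integral_real_affine[of 1 f t] by (simp add: add.commute)

lemma integrable_translation:
  fixes f :: "real \<Rightarrow> 'a :: euclidean_space"
  assumes "integrable lebesgue f" shows "integrable lebesgue (\<lambda>x. f (x + t))"
  using lebesgue_integrable_real_affine[of f 1 t] assms by (simp add: add.commute)

lemma sq_int_translation:
  assumes "sq_int f" shows "sq_int (\<lambda>x. f (x + t))"
  using assms integrable_translation[of "\<lambda>x. (cmod (f x))\<^sup>2" t]
  by (auto simp: sq_int_def intro: measurable_compose[OF translation_measurable])

section \<open>Continuity of translation in the mean\<close>

definition shift :: "real \<Rightarrow> l2 \<Rightarrow> l2" where
  "shift t f = abs_l2 (\<lambda>x. rep_l2 f (x + t))"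

lemma rep_shift: "AE x in lebesgue. rep_l2 (shift t f) x = rep_l2 f (x + t)"
  unfolding shift_def by (rule rep_abs[OF sq_int_translation[OF sq_int_rep]])

lemma norm_shift: "norm (shift t f) = norm f"
proof -
  have "(norm (shift t f))\<^sup>2 = (LINT x|lebesgue. (cmod (rep_l2 f (x + t)))\<^sup>2)"
    unfolding norm_l2_sq
  proof (rule integral_cong_AE)
    show "AE x in lebesgue. (cmod (rep_l2 (shift t f) x))\<^sup>2 = (cmod (rep_l2 f (x + t)))\<^sup>2"
      using rep_shift[of t f] by eventually_elim simp
  qed (auto intro!: measurable_compose[OF translation_measurable])
  also have "\<dots> = (norm f)\<^sup>2"
    unfolding norm_l2_sq by (rule integral_translation[of "\<lambda>x. (cmod (rep_l2 f x))\<^sup>2"])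
  finally show ?thesis by (simp add: power2_eq_iff_nonneg)
qed

lemma shift_linear:
  "shift t (f + g) = shift t f + shift t g" "shift t (f - g) = shift t f - shift t g"
  "shift t (cscale c f) = cscale c (shift t f)"
proof -
  show "shift t (f + g) = shift t f + shift t g"
    by (rule l2_eqI)
      (use rep_shift[of t "f+g"] rep_shift[of t f] rep_shift[of t g] rep_plus[of "shift t f" "shift t g"]
         AE_translation[OF rep_plus[of f g], of t] in \<open>eventually_elim, simp\<close>)
  show "shift t (f - g) = shift t f - shift t g"
    by (rule l2_eqI)
      (use rep_shift[of t "f-g"] rep_shift[of t f] rep_shift[of t g] rep_minus[of "shift t f" "shift t g"]
         AE_translation[OF rep_minus[of f g], of t] in \<open>eventually_elim, simp\<close>)
  show "shift t (cscale c f) = cscale c (shift t f)"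
    by (rule l2_eqI)
      (use rep_shift[of t "cscale c f"] rep_shift[of t f] rep_cscale[of c "shift t f"]
         AE_translation[OF rep_cscale[of c f], of t] in \<open>eventually_elim, simp\<close>)
qed

definition shift_continuous :: "l2 \<Rightarrow> bool" where
  "shift_continuous f \<longleftrightarrow> ((\<lambda>t. shift t f) \<longlongrightarrow> f) (at_right 0)"

text \<open>Translations are isometries, so the vectors on which they act continuously form a closed set;
  this reduces continuity to a dense class of functions.\<close>

lemma shift_continuous_limit:
  assumes "\<And>e. e > 0 \<Longrightarrow> \<exists>g. shift_continuous g \<and> norm (f - g) < e"
  shows "shift_continuous f"
  unfolding shift_continuous_def
proof (rule tendstoI)
  fix e :: real assume "e > 0"
  then obtain g where g: "shift_continuous g" "norm (f - g) < e / 3"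
    using assms[of "e/3"] by auto
  have "\<forall>\<^sub>F t in at_right 0. dist (shift t g) g < e / 3"
    using g(1) \<open>e > 0\<close> unfolding shift_continuous_def by (intro tendstoD) auto
  then show "\<forall>\<^sub>F t in at_right 0. dist (shift t f) f < e"
  proof eventually_elim
    case (elim t)
    have "shift t f - f = shift t (f - g) + (shift t g - g) - (f - g)"
      by (simp add: shift_linear)
    then have "norm (shift t f - f) \<le> norm (shift t (f - g)) + norm (shift t g - g) + norm (f - g)"
      by (metis norm_triangle_ineq4 norm_triangle_ineq add_right_mono order_trans)
    with elim g(2) show ?case by (simp add: norm_shift dist_norm)
  qed
qed

lemma shift_continuous_add:
  "shift_continuous f \<Longrightarrow> shift_continuous g \<Longrightarrow> shift_continuous (f + g)"
  unfolding shift_continuous_def shift_linear by (rule tendsto_add)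

lemma shift_continuous_cscale: "shift_continuous f \<Longrightarrow> shift_continuous (cscale c f)"
proof -
  assume "shift_continuous f"
  then have "((\<lambda>t. cmod c * norm (shift t f - f)) \<longlongrightarrow> cmod c * 0) (at_right 0)"
    unfolding shift_continuous_def
    by (intro tendsto_mult_left) (simp add: tendsto_norm_zero_iff LIM_zero_iff)
  moreover have "cmod c * norm (shift t f - f) = norm (shift t (cscale c f) - cscale c f)" for t
    by (simp add: shift_linear norm_cscale flip: cscale_diff)
  ultimately show ?thesis
    unfolding shift_continuous_def by (simp add: tendsto_norm_zero_iff LIM_zero_iff)
qed

definition ind_l2 :: "real set \<Rightarrow> l2" where "ind_l2 A = abs_l2 (indicator A)"

lemma sq_int_indicator:
  assumes "A \<in> lmeasurable" shows "sq_int (indicator A)"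
proof -
  have "(\<lambda>x. (cmod (indicator A x))\<^sup>2) = (indicator A :: real \<Rightarrow> real)"
    by (auto simp: indicator_def)
  with assms show ?thesis by (auto simp: sq_int_def integrable_indicator_iff fmeasurable_def)
qed

lemma rep_ind_l2: "A \<in> lmeasurable \<Longrightarrow> AE x in lebesgue. rep_l2 (ind_l2 A) x = indicator A x"
  unfolding ind_l2_def by (rule rep_abs[OF sq_int_indicator])

lemma norm_sq_indicator:
  assumes "AE x in lebesgue. cmod (rep_l2 h x) \<le> indicator A x" "A \<in> lmeasurable"
  shows "norm h \<le> sqrt (measure lebesgue A)"
proof -
  have "(norm h)\<^sup>2 \<le> (LINT x|lebesgue. indicator A x)"
    unfolding norm_l2_sq
  proof (rule integral_mono_AE)
    show "AE x in lebesgue. (cmod (rep_l2 h x))\<^sup>2 \<le> indicator A x"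
      using assms(1)
    proof eventually_elim
      case (elim x)
      then show ?case by (auto simp: indicator_def abs_square_le_1 split: if_splits)
    qed
  qed (use sq_int_rep[of h] assms in \<open>auto simp: sq_int_def fmeasurable_def\<close>)
  also have "\<dots> = measure lebesgue A" by simp
  finally show ?thesis by (simp add: real_le_rsqrt)
qed

text \<open>Outer regularity: a compact set \<open>K\<close> lies at positive distance from the complement of an open
  \<open>U \<supseteq> K\<close> of almost the same measure, so for small \<open>t\<close> the symmetric difference of \<open>K\<close> and its translate
  is covered by \<open>U - K\<close> and a translate of it.\<close>

lemma shift_continuous_compact:
  assumes K: "compact K" shows "shift_continuous (ind_l2 K)"
  unfolding shift_continuous_def
proof (rule tendstoI)
  fix e :: real assume e: "e > 0"
  have Kl: "K \<in> lmeasurable" by (rule lmeasurable_compact[OF K])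
  obtain U where U: "open U" "K \<subseteq> U" "U - K \<in> lmeasurable" "emeasure lebesgue (U - K) < ennreal (e\<^sup>2 / 4)"
    using sets_lebesgue_outer_open[of K "e\<^sup>2 / 4"] Kl e by (auto simp: fmeasurable_def)
  have mU: "measure lebesgue (U - K) < e\<^sup>2 / 4"
    using U(3,4) e by (simp add: emeasure_eq_measure2 ennreal_less_iff)
  obtain d where d: "d > 0" "{x + y |x y. x \<in> K \<and> y \<in> ball 0 d} \<subseteq> U"
  proof (cases "U = UNIV")
    case False
    have "\<exists>d>0. \<forall>x\<in>K. \<forall>y\<in>-U. d \<le> dist x y"
      by (rule separate_compact_closed) (use K U(1,2) in auto)
    then obtain d where "d > 0" "\<And>x y. x \<in> K \<Longrightarrow> y \<in> - U \<Longrightarrow> d \<le> dist x y"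
      by auto
    then show ?thesis by (intro that[of d]) (fastforce simp: dist_norm)+
  qed (auto intro: that[of 1])
  have "\<forall>\<^sub>F t in at_right 0. t \<in> {0<..<d}" using d(1) by (rule eventually_at_right_real)
  then show "\<forall>\<^sub>F t in at_right 0. dist (shift t (ind_l2 K)) (ind_l2 K) < e"
  proof eventually_elim
    case (elim t)
    let ?B = "(U - K)" and ?C = "(+) (-t) ` (U - K)"
    have C: "?C \<in> lmeasurable" "measure lebesgue ?C = measure lebesgue (U - K)"
      using U(3) by (auto simp only: measurable_translation measure_translation)
    have "AE x in lebesgue. cmod (rep_l2 (shift t (ind_l2 K) - ind_l2 K) x) \<le> indicator (?B \<union> ?C) x"
      using rep_minus[of "shift t (ind_l2 K)" "ind_l2 K"] rep_shift[of t "ind_l2 K"] rep_ind_l2[OF Kl]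
        AE_translation[OF rep_ind_l2[OF Kl], of t]
    proof eventually_elim
      case (elim x)
      have "x \<in> ?B \<union> ?C" if "x + t \<in> K" "x \<notin> K"
      proof -
        have "x = (x + t) + (- t)" "- t \<in> ball 0 d" using \<open>t \<in> {0<..<d}\<close> by auto
        then have "x \<in> U" using d(2) that(1) by blast
        then show ?thesis using that(2) by simp
      qed
      moreover have "x \<in> ?B \<union> ?C" if "x + t \<notin> K" "x \<in> K"
      proof -
        have "t \<in> ball 0 d" using \<open>t \<in> {0<..<d}\<close> by auto
        then have "x + t \<in> U - K" using d(2) that by blast
        then have "-t + (x + t) \<in> ?C" by (rule imageI)
        then show ?thesis by simp
      qed
      ultimately show ?case using elim by (auto simp: indicator_def)
    qed
    moreover have "?B \<union> ?C \<in> lmeasurable" using U(3) C(1) by auto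
    ultimately have "norm (shift t (ind_l2 K) - ind_l2 K) \<le> sqrt (measure lebesgue (?B \<union> ?C))"
      by (rule norm_sq_indicator)
    also have "\<dots> \<le> sqrt (measure lebesgue ?B + measure lebesgue ?C)"
      using U(3) C(1) by (intro real_sqrt_le_mono measure_Un_le) (auto simp: fmeasurable_def)
    also have "\<dots> < sqrt (e\<^sup>2)"
      using mU C(2) zero_less_power[OF e, of 2] by (intro real_sqrt_less_mono) linarith
    finally show ?case using e by (simp add: dist_norm)
  qed
qed

text \<open>Approximation from inside by a closed set gives a compact set once \<open>A\<close> is cut down to a bounded set.\<close>

lemma shift_continuous_ind_l2:
  assumes A: "A \<in> lmeasurable" shows "shift_continuous (ind_l2 A)"
proof (rule shift_continuous_limit)
  fix e :: real assume e: "e > 0"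
  obtain K where K: "compact K" "K \<subseteq> A" "measure lebesgue (A - K) < e\<^sup>2"
  proof -
    have "(\<lambda>n. measure lebesgue (A - {- real n..real n})) \<longlonglongrightarrow> measure lebesgue (\<Inter>n. A - {- real n..real n})"
    proof (rule Lim_measure_decseq)
      show "range (\<lambda>n. A - {- real n..real n}) \<subseteq> sets lebesgue"
        using A by (auto simp: fmeasurable_def)
      show "emeasure lebesgue (A - {- real n..real n}) \<noteq> \<infinity>" for n
        using fmeasurableD2[OF fmeasurable_Diff[OF A, of "{- real n..real n}"]] by auto
    qed (auto simp: decseq_def)
    moreover have "(\<Inter>n. A - {- real n..real n}) = {}"
    proof -
      have "\<exists>n. x \<in> {- real n..real n}" for x
        using real_arch_simple[of "\<bar>x\<bar>"] by (auto simp: abs_le_iff intro: minus_le_iff[THEN iffD1])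
      then show ?thesis by blast
    qed
    ultimately have "(\<lambda>n. measure lebesgue (A - {- real n..real n})) \<longlonglongrightarrow> 0"
      by (simp only: measure_empty)
    then have "\<forall>\<^sub>F n in sequentially. measure lebesgue (A - {- real n..real n}) < e\<^sup>2 / 2"
      by (rule order_tendstoD) (use e in simp)
    then obtain n where n: "measure lebesgue (A - {- real n..real n}) < e\<^sup>2 / 2"
      by (auto simp: eventually_sequentially)
    let ?I = "{- real n..real n}"
    obtain T where T: "closed T" "T \<subseteq> A \<inter> ?I" "A \<inter> ?I - T \<in> lmeasurable"
        "emeasure lebesgue (A \<inter> ?I - T) < ennreal (e\<^sup>2 / 2)"
    proof (rule sets_lebesgue_inner_closed)
      show "A \<inter> ?I \<in> sets lebesgue" using A by (auto simp: fmeasurable_def)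
      show "e\<^sup>2 / 2 > 0" using e by simp
    qed
    have mT: "measure lebesgue (A \<inter> ?I - T) < e\<^sup>2 / 2"
      using T(3,4) e by (simp add: emeasure_eq_measure2 ennreal_less_iff)
    have "measure lebesgue (A - T) \<le> measure lebesgue (A - ?I) + measure lebesgue (A \<inter> ?I - T)"
    proof -
      have "A - T = (A - ?I) \<union> (A \<inter> ?I - T)" using T(2) by auto
      moreover have "A - ?I \<in> sets lebesgue" "A \<inter> ?I - T \<in> sets lebesgue"
        using A T(3) by (auto simp: fmeasurable_def)
      ultimately show ?thesis by (metis measure_Un_le)
    qed
    moreover have "compact T"
      using compact_Int_closed[of ?I T] T(1,2) by (simp add: inf.absorb2)
    ultimately show ?thesis using that[of T] T(2) n mT by auto
  qed
  have Kl: "K \<in> lmeasurable" by (rule lmeasurable_compact[OF K(1)])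
  have "AE x in lebesgue. cmod (rep_l2 (ind_l2 A - ind_l2 K) x) \<le> indicator (A - K) x"
    using rep_minus[of "ind_l2 A" "ind_l2 K"] rep_ind_l2[OF A] rep_ind_l2[OF Kl]
    by eventually_elim (use K(2) in \<open>auto simp: indicator_def\<close>)
  moreover have "A - K \<in> lmeasurable" using A Kl by auto
  ultimately have "norm (ind_l2 A - ind_l2 K) \<le> sqrt (measure lebesgue (A - K))"
    by (rule norm_sq_indicator)
  also have "\<dots> < sqrt (e\<^sup>2)" using K(3) by (rule real_sqrt_less_mono)
  finally have "norm (ind_l2 A - ind_l2 K) < e" using e by simp
  with shift_continuous_compact[OF K(1)]
  show "\<exists>g. shift_continuous g \<and> norm (ind_l2 A - g) < e" by blast
qed

lemma shift_continuous_zero: "shift_continuous 0"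
proof -
  have "shift t 0 = 0" for t
    using norm_shift[of t 0] by simp
  then show ?thesis by (simp add: shift_continuous_def)
qed

text \<open>A square-integrable simple function is a finite combination of indicators of the level sets of
  its nonzero values, and those level sets have finite measure.\<close>

lemma shift_continuous_simple:
  fixes s :: "real \<Rightarrow> complex"
  assumes s: "simple_function lebesgue s" and fin: "emeasure lebesgue {y. s y \<noteq> 0} \<noteq> \<infinity>"
  shows "sq_int s \<and> shift_continuous (abs_l2 s)"
proof -
  let ?A = "\<lambda>c. s -` {c}"
  have A: "?A c \<in> lmeasurable" if "c \<noteq> 0" for c
  proof (rule fmeasurableI2)
    show "{y. s y \<noteq> 0} \<in> lmeasurable"
    proof (rule fmeasurableI)
      show "{y. s y \<noteq> 0} \<in> sets lebesgue"
        using simple_functionD(2)[OF s, of "- {0}"] by (simp add: vimage_def)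
    qed (use fin in \<open>simp add: less_top\<close>)
    show "?A c \<in> sets lebesgue" using simple_functionD(2)[OF s, of "{c}"] by simp
  qed (use that in auto)
  have *: "sq_int (\<lambda>x. \<Sum>c\<in>S. c * indicator (?A c) x) \<and>
      shift_continuous (abs_l2 (\<lambda>x. \<Sum>c\<in>S. c * indicator (?A c) x))"
    if "finite S" "0 \<notin> S" for S
    using that
  proof (induction S)
    case empty
    have "abs_l2 (\<lambda>x. 0) = 0" by (simp add: zero_l2_def)
    then show ?case using sq_int_zero shift_continuous_zero by simp
  next
    case (insert c S)
    let ?g = "\<lambda>x. \<Sum>c\<in>S. c * indicator (?A c) x"
    have g: "sq_int ?g" "shift_continuous (abs_l2 ?g)" using insert by auto
    have i: "?A c \<in> lmeasurable" using A[of c] insert by auto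
    have "abs_l2 (\<lambda>x. c * indicator (?A c) x + ?g x) = cscale c (ind_l2 (?A c)) + abs_l2 ?g"
      by (rule abs_eqI)
        (use rep_plus[of "cscale c (ind_l2 (?A c))" "abs_l2 ?g"] rep_cscale[of c "ind_l2 (?A c)"]
          rep_ind_l2[OF i] rep_abs[OF g(1)] in \<open>eventually_elim, simp\<close>)
    moreover have "sq_int (\<lambda>x. c * indicator (?A c) x + ?g x)"
      by (intro sq_int_add sq_int_cmult sq_int_indicator i g)
    ultimately have "sq_int (\<lambda>x. c * indicator (?A c) x + ?g x)"
       "shift_continuous (abs_l2 (\<lambda>x. c * indicator (?A c) x + ?g x))"
      using g(2) by (simp_all only: shift_continuous_add shift_continuous_cscale shift_continuous_ind_l2 i)
    moreover have "(\<lambda>x. \<Sum>c\<in>insert c S. c * indicator (?A c) x) = (\<lambda>x. c * indicator (?A c) x + ?g x)"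
      using insert by (simp only: sum.insert not_False_eq_True)
    ultimately show ?case by (simp only:)
  qed
  have "s = (\<lambda>x. \<Sum>c\<in>range s - {0}. c * indicator (?A c) x)"
  proof
    fix x
    have f: "finite (range s - {0})" using simple_functionD(1)[OF s] by simp
    have "(\<Sum>c\<in>range s - {0}. c * indicator (?A c) x) = (\<Sum>c\<in>range s - {0}. if c = s x then c else 0)"
      by (rule sum.cong) (auto simp: indicator_def)
    also have "\<dots> = s x" using f by simp
    finally show "s x = (\<Sum>c\<in>range s - {0}. c * indicator (?A c) x)" by simp
  qed
  then show ?thesis
    using *[of "range s - {0}"] simple_functionD(1)[OF s] by simp
qed

lemma shift_tendsto: "((\<lambda>t. shift t f) \<longlongrightarrow> f) (at_right 0)"
proof -
  obtain s where s: "\<And>i. simple_function lebesgue (s i)"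
    and pointwise: "\<And>x. (\<lambda>i. s i x) \<longlonglongrightarrow> rep_l2 f x" and bound: "\<And>i x. cmod (s i x) \<le> 2 * cmod (rep_l2 f x)"
    using borel_measurable_implies_sequence_metric[OF measurable_rep[of f], of 0] by auto
  have [measurable]: "s i \<in> borel_measurable lebesgue" for i
    by (rule borel_measurable_simple_function[OF s])
  have fin: "emeasure lebesgue {y. s i y \<noteq> 0} \<noteq> \<infinity>" for i
  proof -
    have f2: "integrable lebesgue (\<lambda>x. (cmod (s i x))\<^sup>2)"
      using sq_int_dominated[OF _ sq_int_rep, of "s i" 2 f] bound by (simp add: sq_int_def)
    have "simple_function lebesgue (\<lambda>x. (cmod (s i x))\<^sup>2)"
      by (rule simple_function_compose1[OF s])
    then have "simple_function lebesgue (\<lambda>x. ennreal ((cmod (s i x))\<^sup>2))"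
      by (rule simple_function_compose1)
    then have "emeasure lebesgue {y \<in> space lebesgue. ennreal ((cmod (s i y))\<^sup>2) \<noteq> 0} \<noteq> \<infinity>"
    proof (rule simple_function_finite_support)
      show "(\<integral>\<^sup>+x. ennreal ((cmod (s i x))\<^sup>2) \<partial>lebesgue) < \<infinity>"
        using f2 by (simp add: nn_integral_eq_integral)
    qed simp
    then have "emeasure lebesgue {y \<in> space lebesgue. (cmod (s i y))\<^sup>2 \<noteq> 0} \<noteq> \<infinity>"
      by (simp add: ennreal_eq_0_iff)
    then show ?thesis by simp
  qed
  have sc: "sq_int (s i)" "shift_continuous (abs_l2 (s i))" for i
    using shift_continuous_simple[OF s fin] by auto
  have "(\<lambda>i. norm (f - abs_l2 (s i))) \<longlonglongrightarrow> 0"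
  proof -
    have "(\<lambda>n. (LINT x|lebesgue. (cmod (rep_l2 f x - s n x))\<^sup>2)) \<longlonglongrightarrow> (LINT x::real|lebesgue. (0::real))"
    proof (rule integral_dominated_convergence[where w="\<lambda>x. 9 * (cmod (rep_l2 f x))\<^sup>2"])
      show "integrable lebesgue (\<lambda>x. 9 * (cmod (rep_l2 f x))\<^sup>2)"
        using sq_int_rep[of f] by (simp add: sq_int_def)
      have "(\<lambda>n. (cmod (rep_l2 f x - s n x))\<^sup>2) \<longlonglongrightarrow> (cmod (rep_l2 f x - rep_l2 f x))\<^sup>2" for x
        by (intro tendsto_intros pointwise)
      then show "AE x in lebesgue. (\<lambda>n. (cmod (rep_l2 f x - s n x))\<^sup>2) \<longlonglongrightarrow> 0" by simp
      \<comment> \<open>\<open>s n\<close> is dominated by \<open>2 f\<close>, hence the difference by \<open>3 f\<close>.\<close>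
      have "(cmod (rep_l2 f x - s n x))\<^sup>2 \<le> (3 * cmod (rep_l2 f x))\<^sup>2" for n x
        using norm_triangle_ineq4[of "rep_l2 f x" "s n x"] bound[of n x] by (intro power_mono) auto
      then show "AE x in lebesgue. norm ((cmod (rep_l2 f x - s n x))\<^sup>2) \<le> 9 * (cmod (rep_l2 f x))\<^sup>2" for n
        by (simp add: power_mult_distrib)
    qed measurable
    also have "(\<lambda>n. (LINT x|lebesgue. (cmod (rep_l2 f x - s n x))\<^sup>2)) = (\<lambda>n. (norm (f - abs_l2 (s n)))\<^sup>2)"
      unfolding norm_l2_sq
    proof (intro ext integral_cong_AE)
      show "AE x in lebesgue. (cmod (rep_l2 f x - s n x))\<^sup>2 = (cmod (rep_l2 (f - abs_l2 (s n)) x))\<^sup>2" for n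
        using rep_minus[of f "abs_l2 (s n)"] rep_abs[OF sc(1)[of n]] by eventually_elim simp
    qed measurable
    finally have "(\<lambda>n. sqrt ((norm (f - abs_l2 (s n)))\<^sup>2)) \<longlonglongrightarrow> sqrt 0"
      by (intro tendsto_real_sqrt) simp
    then show ?thesis by simp
  qed
  then have "shift_continuous f"
  proof (intro shift_continuous_limit)
    fix e :: real assume "e > 0"
    with \<open>(\<lambda>i. norm (f - abs_l2 (s i))) \<longlonglongrightarrow> 0\<close>
    have "\<forall>\<^sub>F i in sequentially. norm (f - abs_l2 (s i)) < e" by (rule order_tendstoD)
    then show "\<exists>g. shift_continuous g \<and> norm (f - g) < e"
      using sc(2) by (auto simp: eventually_sequentially)
  qed
  then show ?thesis by (simp add: shift_continuous_def)
qed

section \<open>Potentials and their primitives\<close>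

definition potential :: "(real \<Rightarrow> real) \<Rightarrow> bool" where
  "potential V \<longleftrightarrow> Linf_loc V \<and> (AE x in lebesgue. 0 \<le> V x)"

lemma potential_measurable: "potential V \<Longrightarrow> V \<in> borel_measurable lebesgue"
  by (simp add: potential_def Linf_loc_def)

lemma potential_bounded:
  assumes "potential V" "compact K"
  shows "\<exists>M\<ge>0. AE x in lebesgue. x \<in> K \<longrightarrow> \<bar>V x\<bar> \<le> M"
proof -
  obtain M where "AE x in lebesgue. x \<in> K \<longrightarrow> \<bar>V x\<bar> \<le> M"
    using assms by (auto simp: potential_def Linf_loc_def)
  then have "AE x in lebesgue. x \<in> K \<longrightarrow> \<bar>V x\<bar> \<le> max 0 M"
    by eventually_elim auto
  then show ?thesis by (intro exI[of _ "max 0 M"]) auto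
qed

lemma potential_zero: "potential (\<lambda>x. 0)"
  by (auto simp: potential_def Linf_loc_def)

lemma potential_add_one: assumes "potential V" shows "potential (\<lambda>x. V x + 1)"
  unfolding potential_def Linf_loc_def
proof (intro conjI allI impI)
  show "(\<lambda>x. V x + 1) \<in> borel_measurable lebesgue"
    using potential_measurable[OF assms] by measurable
  show "AE x in lebesgue. 0 \<le> V x + 1"
    using assms unfolding potential_def by (auto elim: eventually_mono)
  fix K :: "real set" assume "compact K"
  from potential_bounded[OF assms this] obtain M where "AE x in lebesgue. x \<in> K \<longrightarrow> \<bar>V x\<bar> \<le> M" by auto
  then have "AE x in lebesgue. x \<in> K \<longrightarrow> \<bar>V x + 1\<bar> \<le> M + 1" by eventually_elim auto
  then show "\<exists>M. AE x in lebesgue. x \<in> K \<longrightarrow> \<bar>V x + 1\<bar> \<le> M" ..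
qed

lemma potential_set_integrable:
  assumes "potential V" shows "set_integrable lebesgue {a..b} V"
proof -
  obtain M where M: "AE x in lebesgue. x \<in> {a..b} \<longrightarrow> \<bar>V x\<bar> \<le> M" "M \<ge> 0"
    using potential_bounded[OF assms, of "{a..b}"] by auto
  show ?thesis
    unfolding set_integrable_def
  proof (rule Bochner_Integration.integrable_bound)
    have "{a..b} \<in> lmeasurable" by simp
    then show "integrable lebesgue (\<lambda>x. M * indicator {a..b} x)"
      by (auto simp: integrable_indicator_iff fmeasurable_def)
    show "AE x in lebesgue. norm (indicator {a..b} x *\<^sub>R V x) \<le> norm (M * indicator {a..b} x)"
      using M(1) by eventually_elim (use M(2) in \<open>auto simp: indicator_def\<close>)
    show "(\<lambda>x. indicator {a..b} x *\<^sub>R V x) \<in> borel_measurable lebesgue"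
      using potential_measurable[OF assms] by (intro borel_measurable_scaleR borel_measurable_indicator) auto
  qed
qed

text \<open>The primitive of \<open>V\<close> normalised at the origin; with it the exponent \<open>g\<^sub>t(x)\<close> becomes the increment
  \<open>prim V x - prim V (x + t)\<close>, which telescopes along the semigroup law.\<close>

definition prim :: "(real \<Rightarrow> real) \<Rightarrow> real \<Rightarrow> real" where
  "prim V x = (if 0 \<le> x then (LINT s:{0..x}|lebesgue. V s) else - (LINT s:{x..0}|lebesgue. V s))"

lemma prim_diff:
  assumes V: "potential V" and "a \<le> b"
  shows "(LINT s:{a..b}|lebesgue. V s) = prim V b - prim V a"
proof -
  note i = set_lebesgue_integral_eq_integral[OF potential_set_integrable[OF V]]
  have c: "integral {a..c} V + integral {c..b} V = integral {a..b} V" if "a \<le> c" "c \<le> b" for a b c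
    using that i(1) by (rule Henstock_Kurzweil_Integration.integral_combine)
  consider "0 \<le> a" | "a < 0" "0 \<le> b" | "b < 0" by linarith
  then show ?thesis
  proof cases
    case 1 then show ?thesis using \<open>a \<le> b\<close> c[of 0 a b] by (simp add: prim_def i(2))
  next
    case 2 then show ?thesis using \<open>a \<le> b\<close> c[of a 0 b] by (simp add: prim_def i(2))
  next
    case 3 then show ?thesis using \<open>a \<le> b\<close> c[of a b 0] by (simp add: prim_def i(2))
  qed
qed

lemma prim_diff_integral:
  assumes V: "potential V" and "a \<le> b"
  shows "prim V b = prim V a + integral {a..b} V"
  using prim_diff[OF assms] set_lebesgue_integral_eq_integral[OF potential_set_integrable[OF V]] by simp

lemma airy_g_prim: "potential V \<Longrightarrow> t \<ge> 0 \<Longrightarrow> airy_g V t x = prim V x - prim V (x + t)"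
  using prim_diff[of V x "x+t"] by (simp add: airy_g_def)

lemma prim_mono:
  assumes V: "potential V" and "a \<le> b" shows "prim V a \<le> prim V b"
proof -
  have "0 \<le> (LINT s:{a..b}|lebesgue. V s)"
    unfolding set_lebesgue_integral_def using V
    by (intro integral_nonneg_AE) (auto simp: potential_def elim!: eventually_mono)
  then show ?thesis using prim_diff[OF assms] by simp
qed

lemma prim_zero: "prim (\<lambda>x. 0) x = 0"
  by (simp add: prim_def)

lemma prim_add_one:
  assumes V: "potential V" shows "prim (\<lambda>x. V x + 1) x = prim V x + x"
proof -
  have "(LINT s:{a..b}|lebesgue. V s + 1) = (LINT s:{a..b}|lebesgue. V s) + (b - a)" if "a \<le> b" for a b
  proof -
    have "set_integrable lebesgue {a..b} (\<lambda>x. 1::real)"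
      using absolutely_integrable_on_const[of "{a..b}" "1::real"] by simp
    then show ?thesis
      using that potential_set_integrable[OF V]
      by (simp add: set_integral_add(2)) (simp add: set_lebesgue_integral_def)
  qed
  then show ?thesis by (simp add: prim_def)
qed

lemma prim_continuous:
  assumes V: "potential V" shows "continuous_on UNIV (prim V)"
proof -
  have "isCont (prim V) x" for x
  proof -
    note i = set_lebesgue_integral_eq_integral(1)[OF potential_set_integrable[OF V]]
    have "continuous_on {x-1..x+1} (\<lambda>y. prim V (x-1) + integral {x-1..y} V)"
      by (intro continuous_intros indefinite_integral_continuous_1 i)
    then have "continuous_on {x-1..x+1} (prim V)"
    proof (rule continuous_on_eq)
      fix y assume "y \<in> {x-1..x+1}"
      then show "prim V (x-1) + integral {x-1..y} V = prim V y"
        by (intro prim_diff_integral[OF V, symmetric]) auto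
    qed
    then show ?thesis by (rule continuous_on_interior) auto
  qed
  then show ?thesis by (simp add: continuous_on_eq_continuous_at)
qed

lemma prim_borel:
  assumes "potential V" shows "prim V \<in> borel_measurable borel"
  using prim_continuous[OF assms] by (rule borel_measurable_continuous_onI)

lemma prim_lebesgue:
  assumes "potential V" shows "prim V \<in> borel_measurable lebesgue"
  by (rule measurable_completion) (use prim_borel[OF assms] in simp)

text \<open>A local version of the fundamental theorem of calculus, for use with \<open>W\<close> outside the interval where it
  is merely bounded.\<close>

lemma prim_DERIV:
  assumes V: "potential V" and U: "open U" "x \<in> U" and c: "continuous_on U V"
  shows "(prim V has_real_derivative V x) (at x)"
proof -
  obtain d where d: "d > 0" "cball x d \<subseteq> U" using U open_contains_cball by blast
  then have s: "{x-d..x+d} \<subseteq> U" by (simp add: cball_eq_atLeastAtMost)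
  have "((\<lambda>y. integral {x-d..y} V) has_vector_derivative V x) (at x within {x-d..x+d})"
    using d by (intro integral_has_vector_derivative continuous_on_subset[OF c s]) auto
  then have "((\<lambda>y. prim V (x-d) + integral {x-d..y} V) has_vector_derivative V x) (at x within {x-d..x+d})"
    using has_vector_derivative_add[OF has_vector_derivative_const[of "prim V (x-d)"]] by fastforce
  then have "(prim V has_vector_derivative V x) (at x within {x-d..x+d})"
  proof (rule has_vector_derivative_transform[rotated 2])
    fix y assume "y \<in> {x-d..x+d}"
    then show "prim V y = prim V (x-d) + integral {x-d..y} V"
      by (intro prim_diff_integral[OF V]) auto
  qed (use d in simp)
  then have "(prim V has_real_derivative V x) (at x within {x-d..x+d})"
    by (simp add: has_real_derivative_iff_has_vector_derivative)
  moreover have "at x within {x-d..x+d} = at x"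
    using d(1) by (intro at_within_Icc_at) auto
  ultimately show ?thesis by simp
qed

section \<open>The weighted translation semigroup\<close>

text \<open>The semigroup is set up for an arbitrary potential: besides \<open>W\<close> itself, the zero potential (plain
  translation) and \<open>W + 1\<close> (the rescaled semigroup \<open>exp (- t) S\<^sub>t\<close>) occur.\<close>

definition evol :: "(real \<Rightarrow> real) \<Rightarrow> real \<Rightarrow> l2 \<Rightarrow> l2" where
  "evol V t f = abs_l2 (\<lambda>x. of_real (exp (prim V x - prim V (x + t))) * rep_l2 f (x + t))"

lemma rep_evol:
  assumes V: "potential V" and t: "t \<ge> 0"
  shows "AE x in lebesgue. rep_l2 (evol V t f) x = of_real (exp (prim V x - prim V (x + t))) * rep_l2 f (x + t)"
  unfolding evol_def
proof (rule rep_abs, rule sq_int_dominated[where c=1])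
  note [measurable] = prim_lebesgue[OF V]
  have [measurable]: "(\<lambda>x. prim V (x + t)) \<in> borel_measurable lebesgue" "(\<lambda>x. rep_l2 f (x + t)) \<in> borel_measurable lebesgue"
    by (rule measurable_compose[OF translation_measurable], measurable)+
  show "(\<lambda>x. of_real (exp (prim V x - prim V (x + t))) * rep_l2 f (x + t)) \<in> borel_measurable lebesgue"
    by measurable
  show "sq_int (\<lambda>x. rep_l2 f (x + t))" by (rule sq_int_translation[OF sq_int_rep])
  show "AE x in lebesgue. cmod (of_real (exp (prim V x - prim V (x + t))) * rep_l2 f (x + t))
         \<le> 1 * cmod (rep_l2 f (x + t))"
    using prim_mono[OF V] t by (auto simp: norm_mult intro!: mult_left_le_one_le)
qed

lemma rep_evol_shift:
  assumes V: "potential V" and t: "t \<ge> 0"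
  shows "AE x in lebesgue. rep_l2 (evol V t f) x = of_real (exp (prim V x - prim V (x + t))) * rep_l2 (shift t f) x"
  using rep_evol[OF assms, of f] rep_shift[of t f] by eventually_elim simp

lemma norm_evol_bound:
  assumes V: "potential V" and t: "t \<ge> 0" and b: "\<And>x. exp (prim V x - prim V (x + t)) \<le> c"
  shows "norm (evol V t f) \<le> c * norm f"
proof -
  have "0 \<le> c" using b[of 0] exp_gt_zero by (smt (verit))
  have "norm (evol V t f) \<le> c * norm (shift t f)"
  proof (rule norm_l2_mono)
    show "AE x in lebesgue. cmod (rep_l2 (evol V t f) x) \<le> c * cmod (rep_l2 (shift t f) x)"
      using rep_evol_shift[OF V t, of f]
      by eventually_elim (use b in \<open>auto simp: norm_mult intro!: mult_right_mono\<close>)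
  qed fact
  then show ?thesis by (simp add: norm_shift)
qed

lemma norm_evol:
  assumes V: "potential V" and t: "t \<ge> 0" shows "norm (evol V t f) \<le> norm f"
  using norm_evol_bound[OF assms, of 1 f] prim_mono[OF V] t by simp

lemma evol_linear:
  assumes V: "potential V" and t: "t \<ge> 0"
  shows "evol V t (f + g) = evol V t f + evol V t g" "evol V t (f - g) = evol V t f - evol V t g"
    "evol V t (cscale c f) = cscale c (evol V t f)"
proof -
  note r = rep_evol[OF assms]
  show "evol V t (f + g) = evol V t f + evol V t g"
    by (rule l2_eqI)
      (use r[of "f+g"] r[of f] r[of g] rep_plus[of "evol V t f" "evol V t g"]
         AE_translation[OF rep_plus[of f g], of t] in \<open>eventually_elim, simp add: distrib_left\<close>)
  show "evol V t (f - g) = evol V t f - evol V t g"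
    by (rule l2_eqI)
      (use r[of "f-g"] r[of f] r[of g] rep_minus[of "evol V t f" "evol V t g"]
         AE_translation[OF rep_minus[of f g], of t] in \<open>eventually_elim, simp add: right_diff_distrib\<close>)
  show "evol V t (cscale c f) = cscale c (evol V t f)"
    by (rule l2_eqI)
      (use r[of "cscale c f"] r[of f] rep_cscale[of c "evol V t f"]
         AE_translation[OF rep_cscale[of c f], of t] in \<open>eventually_elim, simp\<close>)
qed

lemma bounded_linear_evol:
  assumes V: "potential V" and t: "t \<ge> 0" shows "bounded_linear (evol V t)"
  by (rule bounded_linear_intro[of _ 1])
    (use evol_linear[OF assms] norm_evol[OF assms] in \<open>auto simp: scaleR_l2_def\<close>)

lemma evol_0: "potential V \<Longrightarrow> evol V 0 f = f"
  by (rule l2_eqI) (use rep_evol[of V 0 f] in simp)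

lemma evol_add:
  assumes V: "potential V" and st: "s \<ge> 0" "t \<ge> 0"
  shows "evol V (s + t) f = evol V s (evol V t f)"
proof (rule l2_eqI)
  have st': "s + t \<ge> 0" using st by simp
  show "AE x in lebesgue. rep_l2 (evol V (s + t) f) x = rep_l2 (evol V s (evol V t f)) x"
    using rep_evol[OF V st', of f] rep_evol[OF V st(1), of "evol V t f"]
      AE_translation[OF rep_evol[OF V st(2), of f], of s]
  proof eventually_elim
    case (elim x)
    have "exp (prim V x - prim V (x + (s + t))) = exp (prim V x - prim V (x + s)) * exp (prim V (x + s) - prim V (x + s + t))"
      by (simp add: add.assoc flip: exp_add)
    then show ?case unfolding elim by (simp add: add.assoc)
  qed
qed

text \<open>The weight and the translation are separated: \<open>G t\<close> carries the weight alone and converges by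
  dominated convergence, and \<open>evol V t f - G t\<close> is a weighted copy of \<open>shift t f - f\<close>.\<close>

lemma evol_continuous_0:
  assumes V: "potential V" shows "((\<lambda>t. evol V t f) \<longlongrightarrow> f) (at_right 0)"
proof -
  define G where "G t = abs_l2 (\<lambda>x. of_real (exp (prim V x - prim V (x + t))) * rep_l2 f x)" for t
  note [measurable] = prim_lebesgue[OF V]
  have [measurable]: "(\<lambda>x. prim V (x + t)) \<in> borel_measurable lebesgue" for t
    by (rule measurable_compose[OF translation_measurable], measurable)
  have e1: "exp (prim V x - prim V (x + t)) \<le> 1" if "t \<ge> 0" for x t
    using prim_mono[OF V] that by simp
  have G: "AE x in lebesgue. rep_l2 (G t) x = of_real (exp (prim V x - prim V (x + t))) * rep_l2 f x" if "t \<ge> 0" for t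
    unfolding G_def
    by (intro rep_abs sq_int_dominated[OF _ sq_int_rep[of f], where c=1])
      (use e1[OF that] in \<open>auto simp: norm_mult intro!: mult_left_le_one_le\<close>)
  have "(G \<longlongrightarrow> f) (at_right 0)"
  proof (rule l2_dominated_convergence[where g="2 *\<^sub>R f"])
    fix t :: real assume t: "t > 0"
    have "cmod (of_real (exp (prim V x - prim V (x + t))) - 1) \<le> 2" for x
      using norm_triangle_ineq4[of "of_real (exp (prim V x - prim V (x + t)))" "1::complex"] e1[OF less_imp_le[OF t], of x]
      by (simp del: exp_le_one_iff)
    then have "cmod (of_real (exp (prim V x - prim V (x + t))) - 1) * cmod (rep_l2 f x) \<le> 2 * cmod (rep_l2 f x)" for x
      by (rule mult_right_mono) simp
    then have b: "cmod (of_real (exp (prim V x - prim V (x + t))) * rep_l2 f x - rep_l2 f x) \<le> 2 * cmod (rep_l2 f x)" for x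
      by (simp add: left_diff_distrib flip: norm_mult)
    show "AE x in lebesgue. cmod (rep_l2 (G t) x - rep_l2 f x) \<le> cmod (rep_l2 (2 *\<^sub>R f) x)"
      using G[OF less_imp_le[OF t]] rep_scaleR[of 2 f]
    proof eventually_elim
      case (elim x)
      then show ?case using b[of x] by (simp add: norm_mult)
    qed
  next
    fix u :: "nat \<Rightarrow> real" assume u: "u \<longlonglongrightarrow> 0" "\<And>n. u n > 0"
    have "(\<lambda>n. of_real (exp (prim V x - prim V (x + u n))) * rep_l2 f x) \<longlonglongrightarrow> of_real (exp (prim V x - prim V (x + 0))) * rep_l2 f x" for x
      by (intro tendsto_intros u continuous_on_tendsto_compose[OF prim_continuous[OF V]]) auto
    note lim = this
    have "AE x in lebesgue. \<forall>n. rep_l2 (G (u n)) x = of_real (exp (prim V x - prim V (x + u n))) * rep_l2 f x"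
      using G u(2) by (auto simp: AE_all_countable less_imp_le)
    then show "AE x in lebesgue. (\<lambda>n. rep_l2 (G (u n)) x) \<longlonglongrightarrow> rep_l2 f x"
    proof eventually_elim
      case (elim x)
      then show ?case using lim[of x] by simp
    qed
  qed
  moreover have "((\<lambda>t. evol V t f - G t) \<longlongrightarrow> 0) (at_right 0)"
  proof (rule Lim_null_comparison)
    show "\<forall>\<^sub>F t in at_right 0. norm (evol V t f - G t) \<le> norm (shift t f - f)"
      using eventually_at_right_less[of 0]
    proof eventually_elim
      case (elim t)
      then have t: "t \<ge> 0" by simp
      have "norm (evol V t f - G t) \<le> 1 * norm (shift t f - f)"
      proof (rule norm_l2_mono)
        show "AE x in lebesgue. cmod (rep_l2 (evol V t f - G t) x) \<le> 1 * cmod (rep_l2 (shift t f - f) x)"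
          using rep_evol_shift[OF V t, of f] G[OF t] rep_minus[of "evol V t f" "G t"] rep_minus[of "shift t f" f]
        proof eventually_elim
          case (elim x)
          have "rep_l2 (evol V t f - G t) x = of_real (exp (prim V x - prim V (x + t))) * rep_l2 (shift t f - f) x"
            by (simp add: elim right_diff_distrib)
          then show ?case using e1[OF t, of x] by (simp add: norm_mult mult_left_le_one_le)
        qed
      qed simp
      then show ?case by simp
    qed
    show "((\<lambda>t. norm (shift t f - f)) \<longlongrightarrow> 0) (at_right 0)"
      using shift_tendsto[of f] by (simp add: tendsto_norm_zero_iff LIM_zero_iff)
  qed
  ultimately have "((\<lambda>t. (evol V t f - G t) + G t) \<longlongrightarrow> 0 + f) (at_right 0)"
    by (intro tendsto_add)
  then show ?thesis by simp
qed

lemma contraction_semigroup_evol: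
  assumes V: "potential V" shows "C0_contraction_semigroup (evol V)"
  unfolding C0_contraction_semigroup_def C0_semigroup_def
  using bounded_linear_evol[OF V] evol_linear(3)[OF V] evol_0[OF V] evol_add[OF V] evol_continuous_0[OF V]
    norm_evol[OF V] by (auto intro!: onorm_bound)

section \<open>Two integral inequalities\<close>

lemma norm_lebesgue_integral_le_nn:
  fixes f :: "'a \<Rightarrow> 'b :: {banach, second_countable_topology}"
  shows "ennreal (norm (integral\<^sup>L M f)) \<le> (\<integral>\<^sup>+x. ennreal (norm (f x)) \<partial>M)"
  by (cases "integrable M f") (auto intro: integral_norm_bound_ennreal simp: not_integrable_integral_eq)

text \<open>The \<open>L\<^sup>2\<close> norm of an integral over \<open>[0, t)\<close> is at most \<open>t\<close> times the largest \<open>L\<^sup>2\<close> norm of its members: Cauchy--Schwarz in \<open>s\<close>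
  for each \<open>x\<close>, followed by Tonelli.\<close>

lemma minkowski_integral:
  fixes D :: "real \<Rightarrow> real \<Rightarrow> complex"
  assumes D [measurable]: "case_prod D \<in> borel_measurable (lborel \<Otimes>\<^sub>M lborel)"
    and t: "t \<ge> 0" and e: "e \<ge> 0"
    and b: "\<And>s. s \<in> {0..<t} \<Longrightarrow> (\<integral>\<^sup>+x. ennreal ((cmod (D s x))\<^sup>2) \<partial>lborel) \<le> ennreal (e\<^sup>2)"
  shows "(\<integral>\<^sup>+x. ennreal ((cmod (LINT s|lborel. indicator {0..<t} s *\<^sub>R D s x))\<^sup>2) \<partial>lborel) \<le> ennreal ((t * e)\<^sup>2)"
proof -
  have [measurable]: "D s \<in> borel_measurable borel" for s
    using measurable_compose[OF measurable_Pair1' D, of s] by simp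
  let ?I = "\<lambda>s. ennreal (indicator {0..<t} s)"
  have I2: "?I s ^ 2 = ?I s" for s by (simp add: indicator_def)
  have It: "(\<integral>\<^sup>+s. ?I s \<partial>lborel) = ennreal t"
    using t by (simp add: ennreal_indicator)
  have "(\<integral>\<^sup>+x. ennreal ((cmod (LINT s|lborel. indicator {0..<t} s *\<^sub>R D s x))\<^sup>2) \<partial>lborel)
      \<le> (\<integral>\<^sup>+x. ennreal t * (\<integral>\<^sup>+s. ?I s * ennreal ((cmod (D s x))\<^sup>2) \<partial>lborel) \<partial>lborel)"
  proof (rule nn_integral_mono)
    fix x
    have "ennreal (cmod (LINT s|lborel. indicator {0..<t} s *\<^sub>R D s x))
       \<le> (\<integral>\<^sup>+s. ?I s * (?I s * ennreal (cmod (D s x))) \<partial>lborel)"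
      by (rule order_trans[OF norm_lebesgue_integral_le_nn])
        (auto intro!: nn_integral_mono simp: indicator_def)
    then have "ennreal (cmod (LINT s|lborel. indicator {0..<t} s *\<^sub>R D s x)) ^ 2
       \<le> (\<integral>\<^sup>+s. ?I s * (?I s * ennreal (cmod (D s x))) \<partial>lborel) ^ 2"
      by (rule power_mono) simp
    also have "\<dots> \<le> (\<integral>\<^sup>+s. ?I s ^ 2 \<partial>lborel) * (\<integral>\<^sup>+s. (?I s * ennreal (cmod (D s x))) ^ 2 \<partial>lborel)"
      by (rule Cauchy_Schwarz_nn_integral) measurable
    also have "\<dots> = ennreal t * (\<integral>\<^sup>+s. ?I s * ennreal ((cmod (D s x))\<^sup>2) \<partial>lborel)"
      by (simp only: power_mult_distrib I2 It ennreal_power norm_ge_zero)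
    finally show "ennreal ((cmod (LINT s|lborel. indicator {0..<t} s *\<^sub>R D s x))\<^sup>2)
       \<le> ennreal t * (\<integral>\<^sup>+s. ?I s * ennreal ((cmod (D s x))\<^sup>2) \<partial>lborel)"
      by (simp add: ennreal_power)
  qed
  also have "\<dots> = ennreal t * (\<integral>\<^sup>+x. (\<integral>\<^sup>+s. ?I s * ennreal ((cmod (D s x))\<^sup>2) \<partial>lborel) \<partial>lborel)"
    by (rule nn_integral_cmult) measurable
  also have "(\<integral>\<^sup>+x. (\<integral>\<^sup>+s. ?I s * ennreal ((cmod (D s x))\<^sup>2) \<partial>lborel) \<partial>lborel)
     = (\<integral>\<^sup>+s. (\<integral>\<^sup>+x. ?I s * ennreal ((cmod (D s x))\<^sup>2) \<partial>lborel) \<partial>lborel)"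
    by (rule lborel_pair.Fubini') measurable
  also have "\<dots> = (\<integral>\<^sup>+s. ?I s * (\<integral>\<^sup>+x. ennreal ((cmod (D s x))\<^sup>2) \<partial>lborel) \<partial>lborel)"
    by (intro nn_integral_cong nn_integral_cmult) measurable
  also have "\<dots> \<le> (\<integral>\<^sup>+s. ?I s * ennreal (e\<^sup>2) \<partial>lborel)"
    by (intro nn_integral_mono) (use b in \<open>auto simp: indicator_def\<close>)
  also have "\<dots> = ennreal t * ennreal (e\<^sup>2)"
    by (subst nn_integral_multc) (auto simp: It)
  finally have "(\<integral>\<^sup>+x. ennreal ((cmod (LINT s|lborel. indicator {0..<t} s *\<^sub>R D s x))\<^sup>2) \<partial>lborel)
      \<le> ennreal t * (ennreal t * ennreal (e\<^sup>2))"
    by (simp add: mult_left_mono)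
  also have "\<dots> = ennreal ((t * e)\<^sup>2)"
  proof -
    have "ennreal t * (ennreal t * ennreal (e\<^sup>2)) = ennreal (t * (t * e\<^sup>2))"
      using t by (simp add: ennreal_mult)
    then show ?thesis by (simp add: power2_eq_square ac_simps)
  qed
  finally show ?thesis .
qed

text \<open>Writing \<open>K\<close> as the square of its root and applying Cauchy--Schwarz in \<open>s\<close> bounds the square of the
  integral by \<open>A \<integral> K(x,s) \<bar>h(s)\<bar>\<^sup>2 ds\<close>; Tonelli and the bound on the other marginal finish the proof.\<close>

lemma schur_test:
  fixes K :: "real \<Rightarrow> real \<Rightarrow> real" and h :: "real \<Rightarrow> complex"
  assumes K [measurable]: "case_prod K \<in> borel_measurable (lborel \<Otimes>\<^sub>M lborel)" and K0: "\<And>x s. 0 \<le> K x s"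
    and h [measurable]: "h \<in> borel_measurable borel"
    and A: "\<And>x. (\<integral>\<^sup>+s. ennreal (K x s) \<partial>lborel) \<le> A"
    and B: "\<And>s. (\<integral>\<^sup>+x. ennreal (K x s) \<partial>lborel) \<le> B"
  shows "(\<integral>\<^sup>+x. ennreal ((cmod (LINT s|lborel. K x s *\<^sub>R h s))\<^sup>2) \<partial>lborel)
      \<le> A * (B * (\<integral>\<^sup>+s. ennreal ((cmod (h s))\<^sup>2) \<partial>lborel))"
proof -
  have [measurable]: "K x \<in> borel_measurable borel" for x
    using measurable_compose[OF measurable_Pair1' K, of x] by simp
  have [measurable]: "(\<lambda>x. K x s) \<in> borel_measurable borel" for s
    using measurable_compose[OF measurable_Pair2' K, of s] by simp
  have "(\<integral>\<^sup>+x. ennreal ((cmod (LINT s|lborel. K x s *\<^sub>R h s))\<^sup>2) \<partial>lborel)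
      \<le> (\<integral>\<^sup>+x. A * (\<integral>\<^sup>+s. ennreal (K x s) * ennreal ((cmod (h s))\<^sup>2) \<partial>lborel) \<partial>lborel)"
  proof (rule nn_integral_mono)
    fix x
    \<comment> \<open>Each Cauchy--Schwarz factor receives one square root of the kernel.\<close>
    let ?r = "\<lambda>s. ennreal (sqrt (K x s))"
    have r2: "?r s ^ 2 = ennreal (K x s)" for s using K0[of x s] by (simp add: ennreal_power)
    have r1: "ennreal (norm (K x s *\<^sub>R h s)) = ?r s * (?r s * ennreal (cmod (h s)))" for s
      using r2[of s] K0[of x s] by (simp add: ennreal_mult power2_eq_square mult.assoc[symmetric])
    have "ennreal (cmod (LINT s|lborel. K x s *\<^sub>R h s))
       \<le> (\<integral>\<^sup>+s. ?r s * (?r s * ennreal (cmod (h s))) \<partial>lborel)"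
      using norm_lebesgue_integral_le_nn[of lborel "\<lambda>s. K x s *\<^sub>R h s"] by (simp only: r1)
    then have "ennreal (cmod (LINT s|lborel. K x s *\<^sub>R h s)) ^ 2
       \<le> (\<integral>\<^sup>+s. ?r s * (?r s * ennreal (cmod (h s))) \<partial>lborel) ^ 2"
      by (rule power_mono) simp
    also have "\<dots> \<le> (\<integral>\<^sup>+s. ?r s ^ 2 \<partial>lborel) * (\<integral>\<^sup>+s. (?r s * ennreal (cmod (h s))) ^ 2 \<partial>lborel)"
      by (rule Cauchy_Schwarz_nn_integral) measurable
    also have "\<dots> = (\<integral>\<^sup>+s. ennreal (K x s) \<partial>lborel) * (\<integral>\<^sup>+s. ennreal (K x s) * ennreal ((cmod (h s))\<^sup>2) \<partial>lborel)"
      by (simp only: power_mult_distrib r2 ennreal_power norm_ge_zero)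
    also have "\<dots> \<le> A * (\<integral>\<^sup>+s. ennreal (K x s) * ennreal ((cmod (h s))\<^sup>2) \<partial>lborel)"
      by (intro mult_right_mono A) simp
    finally show "ennreal ((cmod (LINT s|lborel. K x s *\<^sub>R h s))\<^sup>2)
       \<le> A * (\<integral>\<^sup>+s. ennreal (K x s) * ennreal ((cmod (h s))\<^sup>2) \<partial>lborel)"
      by (simp add: ennreal_power)
  qed
  also have "\<dots> = A * (\<integral>\<^sup>+x. (\<integral>\<^sup>+s. ennreal (K x s) * ennreal ((cmod (h s))\<^sup>2) \<partial>lborel) \<partial>lborel)"
    by (rule nn_integral_cmult) measurable
  also have "(\<integral>\<^sup>+x. (\<integral>\<^sup>+s. ennreal (K x s) * ennreal ((cmod (h s))\<^sup>2) \<partial>lborel) \<partial>lborel)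
     = (\<integral>\<^sup>+s. (\<integral>\<^sup>+x. ennreal (K x s) * ennreal ((cmod (h s))\<^sup>2) \<partial>lborel) \<partial>lborel)"
    by (rule lborel_pair.Fubini'[symmetric]) measurable
  also have "\<dots> = (\<integral>\<^sup>+s. (\<integral>\<^sup>+x. ennreal (K x s) \<partial>lborel) * ennreal ((cmod (h s))\<^sup>2) \<partial>lborel)"
    by (intro nn_integral_cong nn_integral_multc) measurable
  also have "\<dots> \<le> (\<integral>\<^sup>+s. B * ennreal ((cmod (h s))\<^sup>2) \<partial>lborel)"
    by (intro nn_integral_mono mult_right_mono B) simp
  also have "\<dots> = B * (\<integral>\<^sup>+s. ennreal ((cmod (h s))\<^sup>2) \<partial>lborel)"
    by (rule nn_integral_cmult) measurable
  finally show ?thesis by (simp add: mult_left_mono)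
qed

section \<open>Averages along the semigroup\<close>

lemma sq_int_borel_rep: "sq_int (borel_rep h)"
  by (rule sq_int_cong[OF sq_int_rep borel_rep_AE])

text \<open>The integral of the orbit \<open>s \<mapsto> S\<^sub>s h\<close> over \<open>[0, t)\<close>, evaluated pointwise. The interval is half open
  so that the half line splits into \<open>[x, x + t)\<close> and \<open>[x + t, \<infinity>)\<close> without an exceptional point.\<close>

definition avg_fun :: "(real \<Rightarrow> real) \<Rightarrow> real \<Rightarrow> l2 \<Rightarrow> real \<Rightarrow> complex" where
  "avg_fun V t h x = (LINT s|lborel. indicator {0..<t} s *\<^sub>R (of_real (exp (prim V x - prim V (x + s))) * borel_rep h (x + s)))"

definition avg :: "(real \<Rightarrow> real) \<Rightarrow> real \<Rightarrow> l2 \<Rightarrow> l2" where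
  "avg V t h = abs_l2 (avg_fun V t h)"

lemma avg_fun_zero:
  "avg_fun (\<lambda>_. 0) t f x = (LINT s|lborel. indicator {x..<x+t} s *\<^sub>R borel_rep f s)"
proof -
  have "avg_fun (\<lambda>_. 0) t f x = (LINT s|lborel. indicator {x..<x+t} (x + 1 * s) *\<^sub>R borel_rep f (x + 1 * s))"
    unfolding avg_fun_def by (intro Bochner_Integration.integral_cong) (auto simp: indicator_def prim_zero)
  also have "\<dots> = (LINT s|lborel. indicator {x..<x+t} s *\<^sub>R borel_rep f s)"
    by (subst (2) lborel_integral_real_affine[of 1 _ x]) simp_all
  finally show ?thesis .
qed

lemma avg_integrable:
  assumes V: "potential V"
  shows "integrable lborel (\<lambda>s. indicator {0..<t} s *\<^sub>R (of_real (exp (prim V x - prim V (x + s))) * borel_rep h (x + s)))"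
proof -
  note [measurable] = prim_borel[OF V]
  have "sq_int (\<lambda>s. borel_rep h (s + x))" by (rule sq_int_translation[OF sq_int_borel_rep])
  moreover have "sq_int (indicator {0..<t})"
    by (intro sq_int_indicator bounded_set_imp_lmeasurable) auto
  ultimately have "integrable lebesgue (\<lambda>s. indicator {0..<t} s * borel_rep h (s + x))"
    using integrable_mult_sq_int by blast
  then have i: "integrable lborel (\<lambda>s. indicator {0..<t} s * borel_rep h (s + x))"
    by (subst (asm) integrable_completion) measurable
  show ?thesis
  proof (rule Bochner_Integration.integrable_bound[OF i])
    show "AE s in lborel. norm (indicator {0..<t} s *\<^sub>R (of_real (exp (prim V x - prim V (x + s))) * borel_rep h (x + s)))
       \<le> norm (indicator {0..<t} s * borel_rep h (s + x))"
      using prim_mono[OF V] by (auto simp: indicator_def norm_mult add.commute mult_left_le_one_le)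
  qed measurable
qed

text \<open>The function \<open>avg_fun V t h - t h\<close> is the integral over \<open>s\<close> of \<open>S\<^sub>s h - h\<close>, to which
  Minkowski's inequality applies.\<close>

lemma avg_estimate:
  assumes V: "potential V" and t: "t \<ge> 0" and e: "e \<ge> 0"
    and b: "\<And>s. s \<in> {0..<t} \<Longrightarrow> norm (evol V s h - h) \<le> e"
  shows "AE x in lebesgue. rep_l2 (avg V t h) x = avg_fun V t h x"
    and "norm (avg V t h - t *\<^sub>R h) \<le> t * e"
proof -
  note [measurable] = prim_borel[OF V]
  define D where "D s x = of_real (exp (prim V x - prim V (x + s))) * borel_rep h (x + s) - borel_rep h x" for s x
  have D: "case_prod D \<in> borel_measurable (lborel \<Otimes>\<^sub>M lborel)"
    unfolding D_def by measurable
  have Db: "(\<integral>\<^sup>+x. ennreal ((cmod (D s x))\<^sup>2) \<partial>lborel) \<le> ennreal (e\<^sup>2)" if s: "s \<in> {0..<t}" for s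
  proof -
    have s0: "s \<ge> 0" using s by simp
    have "AE x in lebesgue. rep_l2 (evol V s h - h) x = D s x"
      using rep_minus[of "evol V s h" h] rep_evol[OF V s0, of h] borel_rep_AE[of h] AE_translation[OF borel_rep_AE[of h], of s]
      by eventually_elim (simp add: D_def)
    then have "ennreal ((norm (evol V s h - h))\<^sup>2) = (\<integral>\<^sup>+x. ennreal ((cmod (D s x))\<^sup>2) \<partial>lebesgue)"
      unfolding norm_l2_nn by (intro nn_integral_cong_AE) (auto elim: eventually_mono)
    moreover have "ennreal ((norm (evol V s h - h))\<^sup>2) \<le> ennreal (e\<^sup>2)"
      using b[OF s] by (intro ennreal_leI power_mono) auto
    ultimately show ?thesis by (simp add: nn_integral_completion)
  qed
  have eq: "avg_fun V t h x - of_real t * borel_rep h x = (LINT s|lborel. indicator {0..<t} s *\<^sub>R D s x)" for x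
  proof -
    have "(LINT s|lborel. indicator {0..<t} s *\<^sub>R D s x) = (LINT s|lborel.
      indicator {0..<t} s *\<^sub>R (of_real (exp (prim V x - prim V (x + s))) * borel_rep h (x + s)) - indicator {0..<t} s *\<^sub>R borel_rep h x)"
      by (simp add: D_def scaleR_right_diff_distrib)
    also have "\<dots> = avg_fun V t h x - (LINT s|lborel. indicator {0..<t} s *\<^sub>R borel_rep h x)"
      unfolding avg_fun_def
      by (intro Bochner_Integration.integral_diff avg_integrable V integrable_scaleR_left)
        (use t in \<open>simp add: integrable_indicator_iff\<close>)
    also have "(LINT s|lborel. indicator {0..<t} s *\<^sub>R borel_rep h x) = of_real t * borel_rep h x"
      using t by (simp add: scaleR_conv_of_real)
    finally show ?thesis by simp
  qed
  have [measurable]: "avg_fun V t h \<in> borel_measurable borel"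
    unfolding avg_fun_def by measurable
  have bound: "(\<integral>\<^sup>+x. ennreal ((cmod (avg_fun V t h x - of_real t * borel_rep h x))\<^sup>2) \<partial>lebesgue) \<le> ennreal ((t * e)\<^sup>2)"
    using minkowski_integral[OF D t e Db] by (simp add: eq nn_integral_completion)
  have "sq_int (\<lambda>x. avg_fun V t h x - of_real t * borel_rep h x)"
    by (rule sq_int_boundI[OF _ bound], rule measurable_completion) measurable
  then have "sq_int (\<lambda>x. (avg_fun V t h x - of_real t * borel_rep h x) + of_real t * borel_rep h x)"
    by (intro sq_int_add sq_int_cmult sq_int_borel_rep)
  then have "sq_int (avg_fun V t h)" by simp
  then show 1: "AE x in lebesgue. rep_l2 (avg V t h) x = avg_fun V t h x"
    unfolding avg_def by (rule rep_abs)
  show "norm (avg V t h - t *\<^sub>R h) \<le> t * e"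
  proof (rule norm_l2_boundI[OF _ _ bound])
    show "AE x in lebesgue. rep_l2 (avg V t h - t *\<^sub>R h) x = avg_fun V t h x - of_real t * borel_rep h x"
      using 1 rep_minus[of "avg V t h" "t *\<^sub>R h"] rep_scaleR[of t h] borel_rep_AE[of h]
      by eventually_elim simp
  qed (use t e in simp)
qed

lemma rep_avg:
  assumes V: "potential V" and t: "t \<ge> 0"
  shows "AE x in lebesgue. rep_l2 (avg V t h) x = avg_fun V t h x"
\<comment> \<open>Any bound on \<open>S\<^sub>s h - h\<close> will do here; contractivity gives this one.\<close>
proof (rule avg_estimate(1)[OF assms, where e="2 * norm h"])
  fix s assume "s \<in> {0..<t}"
  then show "norm (evol V s h - h) \<le> 2 * norm h"
    using norm_triangle_ineq4[of "evol V s h" h] norm_evol[OF V, of s h] by simp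
qed simp

lemma avg_tendsto:
  assumes V: "potential V" shows "((\<lambda>t. avg V t h /\<^sub>R t) \<longlongrightarrow> h) (at_right 0)"
proof (rule tendstoI)
  fix e :: real assume e: "e > 0"
  then have "\<forall>\<^sub>F t in at_right 0. dist (evol V t h) h < e / 2"
    by (intro tendstoD[OF evol_continuous_0[OF V]]) simp
  then obtain d where d: "d > 0" "\<And>t. 0 < t \<Longrightarrow> t < d \<Longrightarrow> dist (evol V t h) h < e / 2"
    by (auto simp: eventually_at_right[of 0 1])
  have "\<forall>\<^sub>F t in at_right 0. t \<in> {0<..<d}" using d(1) by (rule eventually_at_right_real)
  then show "\<forall>\<^sub>F t in at_right 0. dist (avg V t h /\<^sub>R t) h < e"
  proof eventually_elim
    case (elim t)
    have "norm (evol V s h - h) \<le> e / 2" if "s \<in> {0..<t}" for s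
      using d(2)[of s] elim that e by (cases "s = 0") (auto simp: evol_0[OF V] dist_norm)
    then have "norm (avg V t h - t *\<^sub>R h) \<le> t * (e / 2)"
      using elim e by (intro avg_estimate(2)[OF V]) auto
    moreover have "avg V t h /\<^sub>R t - h = (avg V t h - t *\<^sub>R h) /\<^sub>R t"
      using elim by (simp add: scaleR_right_diff_distrib)
    ultimately have "norm (avg V t h /\<^sub>R t - h) \<le> e / 2"
      using elim by (simp only: norm_scaleR) (simp add: field_simps)
    then show ?case using e by (simp add: dist_norm)
  qed
qed

section \<open>The resolvent as an integral operator\<close>

definition kern :: "(real \<Rightarrow> real) \<Rightarrow> real \<Rightarrow> real \<Rightarrow> real" where
  "kern V x s = (if x \<le> s then exp (prim V x - prim V s) else 0)"

definition res_fun :: "(real \<Rightarrow> real) \<Rightarrow> l2 \<Rightarrow> real \<Rightarrow> complex" where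
  "res_fun V h x = (LINT s|lborel. kern V x s *\<^sub>R borel_rep h s)"

definition resolvent :: "(real \<Rightarrow> real) \<Rightarrow> l2 \<Rightarrow> l2" where
  "resolvent V h = abs_l2 (res_fun V h)"

text \<open>On the level of primitives this says \<open>V \<ge> 1\<close>, the form in which kernel estimates use it.\<close>

definition coercive :: "(real \<Rightarrow> real) \<Rightarrow> bool" where
  "coercive V \<longleftrightarrow> potential V \<and> (\<forall>x s. x \<le> s \<longrightarrow> s - x \<le> prim V s - prim V x)"

lemma coercive_add_one:
  assumes "potential W" shows "coercive (\<lambda>x. W x + 1)"
  unfolding coercive_def prim_add_one[OF assms]
  using potential_add_one[OF assms] prim_mono[OF assms] by fastforce

lemma kern_nonneg: "0 \<le> kern V x s"
  by (simp add: kern_def)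

lemma kern_measurable [measurable (raw)]:
  assumes "potential V"
  shows "case_prod (kern V) \<in> borel_measurable (lborel \<Otimes>\<^sub>M lborel)"
proof -
  note [measurable] = prim_borel[OF assms]
  show ?thesis unfolding kern_def by measurable
qed

lemma kern_measurable1:
  assumes "potential V"
  shows "kern V x \<in> borel_measurable borel" "(\<lambda>x. kern V x s) \<in> borel_measurable borel"
proof -
  note [measurable] = prim_borel[OF assms]
  show "kern V x \<in> borel_measurable borel" unfolding kern_def by measurable
  show "(\<lambda>x. kern V x s) \<in> borel_measurable borel" unfolding kern_def by measurable
qed

lemma nn_integral_exp: "(\<integral>\<^sup>+s. ennreal (exp (x - s)) * indicator {x..} s \<partial>lborel) = 1"
proof -
  have "filterlim (\<lambda>s. - x + s) at_top at_top"
    by (rule filterlim_tendsto_add_at_top[OF tendsto_const filterlim_ident])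
  then have "filterlim (\<lambda>s. x - s) at_bot at_top"
    by (simp add: filterlim_uminus_at_top)
  then have "((\<lambda>s. exp (x - s)) \<longlongrightarrow> 0) at_top"
    by (rule filterlim_compose[OF exp_at_bot])
  then have "((\<lambda>s. - exp (x - s)) \<longlongrightarrow> 0) at_top"
    using tendsto_minus by fastforce
  then have "(\<integral>\<^sup>+s. ennreal (exp (x - s)) * indicator {x..} s \<partial>lborel) = ennreal (0 - (- exp (x - x)))"
    by (intro nn_integral_FTC_atLeast) (auto intro!: derivative_eq_intros)
  then show ?thesis by simp
qed

text \<open>Comparison with the kernel of the constant potential 1, in the two forms that allow integration
  over \<open>s\<close> and over \<open>x\<close>.\<close>

lemma kern_le_exp:
  assumes "coercive V"
  shows "ennreal (kern V x s) \<le> ennreal (exp (x - s)) * indicator {x..} s"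
    "ennreal (kern V x s) \<le> ennreal (exp (x - s)) * indicator {..s} x"
proof -
  have "kern V x s \<le> exp (x - s) * of_bool (x \<le> s)"
  proof (cases "x \<le> s")
    case True
    with assms have "s - x \<le> prim V s - prim V x" by (simp add: coercive_def)
    then show ?thesis using True by (simp add: kern_def)
  qed (simp add: kern_def)
  then have "ennreal (kern V x s) \<le> ennreal (exp (x - s) * of_bool (x \<le> s))"
    by (rule ennreal_leI)
  then show "ennreal (kern V x s) \<le> ennreal (exp (x - s)) * indicator {x..} s"
    "ennreal (kern V x s) \<le> ennreal (exp (x - s)) * indicator {..s} x"
    by (cases "x \<le> s"; simp)+
qed

lemma nn_integral_kern_right:
  assumes "coercive V" shows "(\<integral>\<^sup>+s. ennreal (kern V x s) \<partial>lborel) \<le> 1"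
proof -
  have "(\<integral>\<^sup>+s. ennreal (kern V x s) \<partial>lborel) \<le> (\<integral>\<^sup>+s. ennreal (exp (x - s)) * indicator {x..} s \<partial>lborel)"
    by (intro nn_integral_mono) (rule kern_le_exp(1)[OF assms])
  then show ?thesis by (simp add: nn_integral_exp)
qed

lemma nn_integral_kern_left:
  assumes "coercive V" shows "(\<integral>\<^sup>+x. ennreal (kern V x s) \<partial>lborel) \<le> 1"
proof -
  have "(\<integral>\<^sup>+x. ennreal (kern V x s) \<partial>lborel) \<le> (\<integral>\<^sup>+x. ennreal (exp (x - s)) * indicator {..s} x \<partial>lborel)"
    by (intro nn_integral_mono) (rule kern_le_exp(2)[OF assms])
  also have "\<dots> = (\<integral>\<^sup>+x. ennreal (exp (- x - s)) * indicator {..s} (- x) \<partial>lborel)"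
    by (subst nn_integral_real_affine[where c="-1" and t=0]) auto
  also have "\<dots> = (\<integral>\<^sup>+x. ennreal (exp (- s - x)) * indicator {-s..} x \<partial>lborel)"
    by (intro nn_integral_cong) (auto simp: indicator_def algebra_simps)
  finally show ?thesis by (simp add: nn_integral_exp)
qed

lemma sq_int_kern:
  assumes V: "coercive V" shows "sq_int (\<lambda>s. of_real (kern V x s))"
proof (rule sq_int_boundI[where c=1])
  have p: "potential V" using V by (simp add: coercive_def)
  note [measurable] = kern_measurable1[OF p]
  show "(\<lambda>s. complex_of_real (kern V x s)) \<in> borel_measurable lebesgue"
    by (rule measurable_completion) measurable
  have "(kern V x s)\<^sup>2 \<le> kern V x s" for s
    using prim_mono[OF p, of x s] by (auto simp: kern_def power2_eq_square)
  then have "(\<integral>\<^sup>+s. ennreal ((cmod (of_real (kern V x s)))\<^sup>2) \<partial>lebesgue) \<le> (\<integral>\<^sup>+s. ennreal (kern V x s) \<partial>lebesgue)"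
    by (intro nn_integral_mono) (simp add: ennreal_leI)
  also have "\<dots> \<le> 1" using nn_integral_kern_right[OF V] by (simp add: nn_integral_completion)
  finally show "(\<integral>\<^sup>+s. ennreal ((cmod (of_real (kern V x s)))\<^sup>2) \<partial>lebesgue) \<le> ennreal (1\<^sup>2)" by simp
qed

lemma integrable_kern:
  assumes V: "coercive V" shows "integrable lborel (\<lambda>s. kern V x s *\<^sub>R borel_rep h s)"
proof -
  have p: "potential V" using V by (simp add: coercive_def)
  note [measurable] = kern_measurable1[OF p]
  have "integrable lebesgue (\<lambda>s. of_real (kern V x s) * borel_rep h s)"
    by (rule integrable_mult_sq_int[OF sq_int_kern[OF V] sq_int_borel_rep])
  then show ?thesis
    by (subst (asm) integrable_completion) (simp_all add: scaleR_conv_of_real)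
qed

lemma res_fun_measurable:
  assumes "potential V" shows "res_fun V h \<in> borel_measurable borel"
proof -
  note [measurable] = kern_measurable[OF assms]
  show ?thesis unfolding res_fun_def by measurable
qed

text \<open>The Schur test for the kernel \<open>w(x) kern V x s\<close>. The weight 1 shows that the resolvent acts on
  \<open>L\<^sup>2\<close>; later the weight is the potential itself far from the origin.\<close>

lemma weighted_res_fun_sq_int:
  assumes V: "coercive V" and w [measurable]: "w \<in> borel_measurable borel" and w0: "\<And>x. 0 \<le> w x"
    and A: "\<And>x. (\<integral>\<^sup>+s. ennreal (w x * kern V x s) \<partial>lborel) \<le> ennreal A"
    and B: "\<And>s. (\<integral>\<^sup>+x. ennreal (w x * kern V x s) \<partial>lborel) \<le> ennreal B"
    and AB: "A \<ge> 0" "B \<ge> 0"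
  shows "sq_int (\<lambda>x. of_real (w x) * res_fun V h x)"
proof -
  have p: "potential V" using V by (simp add: coercive_def)
  note [measurable] = kern_measurable[OF p] res_fun_measurable[OF p]
  have "(\<integral>\<^sup>+x. ennreal ((cmod (LINT s|lborel. (w x * kern V x s) *\<^sub>R borel_rep h s))\<^sup>2) \<partial>lborel)
      \<le> ennreal A * (ennreal B * (\<integral>\<^sup>+s. ennreal ((cmod (borel_rep h s))\<^sup>2) \<partial>lborel))"
    by (rule schur_test[where K="\<lambda>x s. w x * kern V x s"]) (use A B w0 kern_nonneg in auto)
  also have "\<dots> = ennreal ((sqrt (A * B) * norm h)\<^sup>2)"
    using AB by (simp add: norm_l2_borel_rep[symmetric] power_mult_distrib ennreal_mult mult.assoc)
  also have "(\<lambda>x. LINT s|lborel. (w x * kern V x s) *\<^sub>R borel_rep h s) = (\<lambda>x. of_real (w x) * res_fun V h x)"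
    by (simp add: res_fun_def scaleR_conv_of_real mult.assoc)
  finally have *: "(\<integral>\<^sup>+x. ennreal ((cmod (of_real (w x) * res_fun V h x))\<^sup>2) \<partial>lborel) \<le> ennreal ((sqrt (A * B) * norm h)\<^sup>2)" .
  show ?thesis
  proof (rule sq_int_boundI)
    show "(\<lambda>x. of_real (w x) * res_fun V h x) \<in> borel_measurable lebesgue"
      by (rule measurable_completion) measurable
    show "(\<integral>\<^sup>+x. ennreal ((cmod (of_real (w x) * res_fun V h x))\<^sup>2) \<partial>lebesgue) \<le> ennreal ((sqrt (A * B) * norm h)\<^sup>2)"
      using * by (simp add: nn_integral_completion)
  qed
qed

lemma rep_resolvent:
  assumes V: "coercive V" shows "AE x in lebesgue. rep_l2 (resolvent V h) x = res_fun V h x"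
  unfolding resolvent_def
  using weighted_res_fun_sq_int[OF V, of "\<lambda>_. 1" 1 1 h] nn_integral_kern_right[OF V] nn_integral_kern_left[OF V]
  by (intro rep_abs) simp

text \<open>The weight \<open>exp (E x - E (x + t))\<close> turns the kernel at \<open>x + t\<close> into the kernel at \<open>x\<close>, so the evolved
  resolvent integrates over \<open>s \<ge> x + t\<close> what the resolvent integrates over \<open>s \<ge> x\<close>.\<close>

lemma evol_resolvent:
  assumes V: "coercive V" and t: "t \<ge> 0"
  shows "evol V t (resolvent V h) = resolvent V h - avg V t h"
proof (rule l2_eqI)
  have p: "potential V" using V by (simp add: coercive_def)
  note [measurable] = prim_borel[OF p]
  have eq: "of_real (exp (prim V x - prim V (x + t))) * res_fun V h (x + t) = res_fun V h x - avg_fun V t h x" for x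
  proof -
    let ?c = "exp (prim V x - prim V (x + t))"
    have i: "integrable lborel (\<lambda>s. (?c * kern V (x + t) s) *\<^sub>R borel_rep h s)"
      using integrable_scaleR_right[OF integrable_kern[OF V], of ?c] by simp
    have "avg_fun V t h x = (LINT s|lborel. indicator {x..<x+t} (x + 1 * s) *\<^sub>R (of_real (exp (prim V x - prim V (x + 1 * s))) * borel_rep h (x + 1 * s)))"
      unfolding avg_fun_def by (intro Bochner_Integration.integral_cong) (auto simp: indicator_def)
    also have "\<dots> = (LINT s|lborel. indicator {x..<x+t} s *\<^sub>R (of_real (exp (prim V x - prim V s)) * borel_rep h s))"
      by (subst (2) lborel_integral_real_affine[of 1 _ x]) simp_all
    also have "\<dots> = (LINT s|lborel. kern V x s *\<^sub>R borel_rep h s - (?c * kern V (x + t) s) *\<^sub>R borel_rep h s)"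
      by (intro Bochner_Integration.integral_cong)
        (use t in \<open>auto simp: indicator_def kern_def scaleR_conv_of_real simp flip: exp_add of_real_mult\<close>)
    also have "\<dots> = res_fun V h x - (LINT s|lborel. (?c * kern V (x + t) s) *\<^sub>R borel_rep h s)"
      unfolding res_fun_def by (intro Bochner_Integration.integral_diff integrable_kern V i)
    also have "(LINT s|lborel. (?c * kern V (x + t) s) *\<^sub>R borel_rep h s) = of_real ?c * res_fun V h (x + t)"
      unfolding res_fun_def by (simp add: scaleR_conv_of_real mult.assoc)
    finally show ?thesis by simp
  qed
  show "AE x in lebesgue. rep_l2 (evol V t (resolvent V h)) x = rep_l2 (resolvent V h - avg V t h) x"
    using rep_evol[OF p t, of "resolvent V h"] rep_minus[of "resolvent V h" "avg V t h"]
      rep_resolvent[OF V, of h] AE_translation[OF rep_resolvent[OF V, of h], of t] rep_avg[OF p t, of h]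
    by eventually_elim (simp only: eq)
qed

text \<open>The graph of the generator as a relation, which avoids choosing a limit for vectors outside its
  domain.\<close>

definition gen_limit :: "(real \<Rightarrow> l2 \<Rightarrow> l2) \<Rightarrow> l2 \<Rightarrow> l2 \<Rightarrow> bool" where
  "gen_limit S f g \<longleftrightarrow> ((\<lambda>t. (S t f - f) /\<^sub>R t) \<longlongrightarrow> g) (at_right 0)"

lemma evol_add_one:
  assumes W: "potential W" and t: "t \<ge> 0"
  shows "evol W t f = exp t *\<^sub>R evol (\<lambda>x. W x + 1) t f"
proof (rule l2_eqI)
  show "AE x in lebesgue. rep_l2 (evol W t f) x = rep_l2 (exp t *\<^sub>R evol (\<lambda>x. W x + 1) t f) x"
    using rep_evol[OF W t, of f] rep_evol[OF potential_add_one[OF W] t, of f]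
      rep_scaleR[of "exp t" "evol (\<lambda>x. W x + 1) t f"]
  proof eventually_elim
    case (elim x)
    have "exp (prim W x - prim W (x + t)) = exp t * exp (prim W x + x - (prim W (x + t) + (x + t)))"
      by (simp flip: exp_add)
    then show ?case unfolding elim by (simp add: prim_add_one[OF W])
  qed
qed

text \<open>Passing from \<open>W + 1\<close> to \<open>W\<close> multiplies the semigroup by \<open>exp t\<close>, which contributes the summand \<open>R h\<close>;
  the averages converge to \<open>h\<close>.\<close>

lemma gen_limit_resolvent:
  assumes W: "potential W"
  defines "R \<equiv> resolvent (\<lambda>x. W x + 1)"
  shows "gen_limit (evol W) (R h) (R h - h)"
  unfolding gen_limit_def
proof (rule Lim_transform_eventually)
  let ?V = "\<lambda>x. W x + 1"
  note V = coercive_add_one[OF W]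
  have "((\<lambda>t. (exp t - 1) / t) \<longlongrightarrow> 1) (at (0::real))"
    using DERIV_exp[of "0::real"] by (simp add: has_field_derivative_iff)
  then have d: "((\<lambda>t::real. (exp t - 1) / t) \<longlongrightarrow> 1) (at_right 0)"
    by (rule filterlim_at_split[THEN iffD1, THEN conjunct2])
  have "((\<lambda>t::real. exp t) \<longlongrightarrow> exp 0) (at_right 0)" by (intro tendsto_intros)
  then have "((\<lambda>t. ((exp t - 1) / t) *\<^sub>R R h - exp t *\<^sub>R (avg ?V t h /\<^sub>R t)) \<longlongrightarrow> 1 *\<^sub>R R h - exp 0 *\<^sub>R h) (at_right 0)"
    by (intro tendsto_intros d avg_tendsto potential_add_one[OF W])
  then show "((\<lambda>t. ((exp t - 1) / t) *\<^sub>R R h - exp t *\<^sub>R (avg ?V t h /\<^sub>R t)) \<longlongrightarrow> R h - h) (at_right 0)"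
    by simp
  show "\<forall>\<^sub>F t in at_right 0. ((exp t - 1) / t) *\<^sub>R R h - exp t *\<^sub>R (avg ?V t h /\<^sub>R t) = (evol W t (R h) - R h) /\<^sub>R t"
    using eventually_at_right_less[of 0]
  proof eventually_elim
    case (elim t)
    then show ?case unfolding R_def
      by (subst evol_add_one[OF W], simp, subst evol_resolvent[OF V])
        (simp_all add: algebra_simps diff_divide_distrib divide_inverse)
  qed
qed

section \<open>The resolvent maps into the domain of the potential\<close>

text \<open>The part of the growth assumptions that controls the resolvent. The bound \<open>\<bar>W'\<bar> \<le> W\<^sup>2 / 2\<close> says that
  \<open>1 / W\<close> has slope at most \<open>1 / 2\<close>.\<close>

locale tame_potential =
  fixes W :: "real \<Rightarrow> real" and r R :: real
  assumes pot: "potential W" and R: "r < R" "0 \<le> r"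
    and cont: "continuous_on {x. r < \<bar>x\<bar>} W"
    and deriv: "\<And>x. R \<le> \<bar>x\<bar> \<Longrightarrow> \<exists>D. (W has_real_derivative D) (at x) \<and> \<bar>D\<bar> \<le> (W x)\<^sup>2 / 2"
    and nonneg: "\<And>x. R \<le> \<bar>x\<bar> \<Longrightarrow> 0 \<le> W x"
begin

definition E :: "real \<Rightarrow> real" where "E = prim (\<lambda>x. W x + 1)"
definition K :: "real \<Rightarrow> real \<Rightarrow> real" where "K = kern (\<lambda>x. W x + 1)"

lemma K_eq: "K x s = (if x \<le> s then exp (E x - E s) else 0)"
  by (simp add: K_def E_def kern_def)

text \<open>The potential far from the origin. Cutting off the interval around the origin makes it Borel
  measurable and leaves only points at which \<open>W\<close> is differentiable.\<close>

definition w :: "real \<Rightarrow> real" where "w x = indicator {x. R \<le> \<bar>x\<bar>} x *\<^sub>R W x"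

lemma w_eq: "w x = (if R \<le> \<bar>x\<bar> then W x else 0)"
  by (simp add: w_def)

lemma w_nonneg: "0 \<le> w x"
  using nonneg by (simp add: w_eq)

lemma w_borel [measurable]: "w \<in> borel_measurable borel"
proof -
  have c: "closed {x::real. R \<le> \<bar>x\<bar>}"
    by (intro closed_Collect_le continuous_intros)
  have "continuous_on {x. R \<le> \<bar>x\<bar>} W"
    by (rule continuous_on_subset[OF cont]) (use R in auto)
  then show ?thesis
    unfolding w_def using c by (intro borel_measurable_continuous_on_indicator) auto
qed

lemma E_growth: "x \<le> s \<Longrightarrow> s - x \<le> E s - E x"
  using coercive_add_one[OF pot] by (simp add: coercive_def E_def)

lemma E_borel [measurable]: "E \<in> borel_measurable borel"
  unfolding E_def by (intro prim_borel potential_add_one pot)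

lemma E_DERIV [derivative_intros]:
  assumes "(g has_real_derivative g') (at x)" "R \<le> \<bar>g x\<bar>"
  shows "((\<lambda>x. E (g x)) has_real_derivative ((W (g x) + 1) * g')) (at x)"
proof (rule DERIV_chain2[OF _ assms(1)])
  show "(E has_real_derivative (W (g x) + 1)) (at (g x))"
    unfolding E_def
  proof (rule prim_DERIV[OF potential_add_one[OF pot]])
    show "open {x::real. r < \<bar>x\<bar>}" by (intro open_Collect_less continuous_intros)
  qed (use assms R cont in \<open>auto intro!: continuous_intros\<close>)
qed

text \<open>The function \<open>W exp (E / 2)\<close> is nondecreasing far out on either side, because the derivative of \<open>E / 2\<close>
  is \<open>(W + 1) / 2\<close> and \<open>\<bar>W'\<bar>\<close> is at most \<open>W\<^sup>2 / 2\<close>. Only half of the exponent is spent here; the other half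
  remains for integrability of the kernel.\<close>

lemma weight_mono:
  assumes "x \<le> s" and far: "\<And>y. x \<le> y \<Longrightarrow> y \<le> s \<Longrightarrow> R \<le> \<bar>y\<bar>"
  shows "W x \<le> W s * exp ((E s - E x) / 2)"
proof -
  have "W x * exp (E x / 2) \<le> W s * exp (E s / 2)"
  proof (rule DERIV_nonneg_imp_nondecreasing[OF assms(1)])
    fix y assume y: "x \<le> y" "y \<le> s"
    from deriv[OF far[OF y]] obtain D where D: "(W has_real_derivative D) (at y)" "\<bar>D\<bar> \<le> (W y)\<^sup>2 / 2" by auto
    have "((\<lambda>x. W x * exp (E x / 2)) has_real_derivative (D + W y * (W y + 1) / 2) * exp (E y / 2)) (at y)"
      using far[OF y] by (auto intro!: derivative_eq_intros D(1) simp: field_simps)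
    moreover have "0 \<le> D + W y * (W y + 1) / 2"
    proof -
      have "W y * (W y + 1) / 2 = (W y)\<^sup>2 / 2 + W y / 2" by (simp add: power2_eq_square algebra_simps)
      then show ?thesis using D(2) nonneg[OF far[OF y]] by linarith
    qed
    ultimately show "\<exists>z. ((\<lambda>x. W x * exp (E x / 2)) has_real_derivative z) (at y) \<and> 0 \<le> z"
      using mult_nonneg_nonneg[OF _ exp_ge_zero] by blast
  qed
  then have "W x * exp (E x / 2) * exp (- (E x / 2)) \<le> W s * exp (E s / 2) * exp (- (E x / 2))"
    by (rule mult_right_mono) simp
  then show ?thesis by (simp add: mult.assoc diff_divide_distrib flip: exp_add)
qed

text \<open>The weight is moved from \<open>x\<close> to \<open>s\<close>, where it is, up to a factor, the derivative of the remaining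
  exponential in \<open>s\<close>.\<close>

lemma weight_kern_le:
  assumes "x \<le> s" and far: "\<And>y. x \<le> y \<Longrightarrow> y \<le> s \<Longrightarrow> R \<le> \<bar>y\<bar>"
  shows "w x * K x s \<le> (w s + 1) * exp ((E x - E s) / 2)"
proof -
  have "w x * K x s \<le> (W s * exp ((E s - E x) / 2)) * exp (E x - E s)"
    using weight_mono[OF assms] far[of x] assms(1) by (simp add: w_eq K_eq mult_right_mono)
  also have "\<dots> = W s * exp ((E x - E s) / 2)"
    by (simp add: mult.assoc diff_divide_distrib flip: exp_add)
  also have "\<dots> \<le> (w s + 1) * exp ((E x - E s) / 2)"
    using far[of s] assms(1) by (intro mult_right_mono) (auto simp: w_eq)
  finally show ?thesis .
qed

lemma E_tendsto: "((\<lambda>s. exp ((c - E s) / 2)) \<longlongrightarrow> 0) at_top" "((\<lambda>s. exp (E (- s) - c)) \<longlongrightarrow> 0) at_top"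
proof -
  have "filterlim (\<lambda>s. (c - E s) / 2) at_bot at_top"
  proof (rule filterlim_at_bot_mono)
    show "filterlim (\<lambda>s. - ((E 0 - c) / 2 + (1/2) * s)) at_bot at_top"
      unfolding filterlim_uminus_at_top[symmetric]
      by (intro filterlim_tendsto_add_at_top[OF tendsto_const]
          filterlim_tendsto_pos_mult_at_top[OF tendsto_const _ filterlim_ident]) simp
    show "\<forall>\<^sub>F s in at_top. (c - E s) / 2 \<le> - ((E 0 - c) / 2 + (1/2) * s)"
      using eventually_ge_at_top[of 0]
    proof eventually_elim
      case (elim s)
      then show ?case using E_growth[of 0 s] by (simp add: field_simps)
    qed
  qed
  then show "((\<lambda>s. exp ((c - E s) / 2)) \<longlongrightarrow> 0) at_top"
    by (rule filterlim_compose[OF exp_at_bot])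
  have "filterlim (\<lambda>s. E (- s) - c) at_bot at_top"
  proof (rule filterlim_at_bot_mono)
    show "filterlim (\<lambda>s. - ((c - E 0) + s)) at_bot at_top"
      unfolding filterlim_uminus_at_top[symmetric]
      by (rule filterlim_tendsto_add_at_top[OF tendsto_const filterlim_ident])
    show "\<forall>\<^sub>F s in at_top. E (- s) - c \<le> - ((c - E 0) + s)"
      using eventually_ge_at_top[of 0]
    proof eventually_elim
      case (elim s)
      then show ?case using E_growth[of "-s" 0] by simp
    qed
  qed
  then show "((\<lambda>s. exp (E (- s) - c)) \<longlongrightarrow> 0) at_top"
    by (rule filterlim_compose[OF exp_at_bot])
qed

lemma nn_integral_decay_right:
  assumes "R \<le> x"
  shows "(\<integral>\<^sup>+s. ennreal ((w s + 1) * exp ((E x - E s) / 2)) * indicator {x..} s \<partial>lborel) = 2"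
proof -
  have "(\<integral>\<^sup>+s. ennreal ((w s + 1) * exp ((E x - E s) / 2)) * indicator {x..} s \<partial>lborel)
     = ennreal (- 2 * 0 - (- 2 * exp ((E x - E x) / 2)))"
  proof (rule nn_integral_FTC_atLeast[where F="\<lambda>s. - 2 * exp ((E x - E s) / 2)"])
    show "((\<lambda>s. - 2 * exp ((E x - E s) / 2)) \<longlongrightarrow> - 2 * 0) at_top"
      by (intro tendsto_intros E_tendsto)
    show "((\<lambda>s. - 2 * exp ((E x - E s) / 2)) has_real_derivative (w s + 1) * exp ((E x - E s) / 2)) (at s)"
      if "x \<le> s" for s
      using assms that R by (auto intro!: derivative_eq_intros simp: w_eq field_simps)
  qed (use w_nonneg in \<open>auto intro!: mult_nonneg_nonneg add_nonneg_nonneg\<close>)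
  then show ?thesis by simp
qed

lemma nn_integral_decay_left:
  assumes "x \<le> - R"
  shows "(\<integral>\<^sup>+s. ennreal ((w s + 1) * exp ((E x - E s) / 2)) * indicator {x..-R} s \<partial>lborel) \<le> 2"
proof -
  have "(\<integral>\<^sup>+s. ennreal ((w s + 1) * exp ((E x - E s) / 2)) * indicator {x..-R} s \<partial>lborel)
     = ennreal (- 2 * exp ((E x - E (-R)) / 2) - (- 2 * exp ((E x - E x) / 2)))"
  proof (rule nn_integral_FTC_Icc[where F="\<lambda>s. - 2 * exp ((E x - E s) / 2)"])
    show "((\<lambda>s. - 2 * exp ((E x - E s) / 2)) has_real_derivative (w s + 1) * exp ((E x - E s) / 2)) (at s)"
      if "s \<in> {x..-R}" for s
      using assms that R by (auto intro!: derivative_eq_intros simp: w_eq field_simps)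
  qed (use w_nonneg assms in \<open>auto intro!: mult_nonneg_nonneg add_nonneg_nonneg\<close>)
  also have "\<dots> \<le> ennreal 2" by (rule ennreal_leI) simp
  finally show ?thesis by simp
qed

text \<open>On the right half line a single exact integral suffices. For \<open>x \<le> - R\<close> the mass up to \<open>- R\<close> is again an
  exact integral, and beyond \<open>- R\<close> the kernel factors through the point \<open>- R\<close>, which accounts for the
  summand \<open>W (- R)\<close>.\<close>

lemma weighted_kern_right:
  "(\<integral>\<^sup>+s. ennreal (w x * K x s) \<partial>lborel) \<le> ennreal (2 + W (-R))"
proof -
  note V = coercive_add_one[OF pot]
  note [measurable] = kern_measurable1[OF potential_add_one[OF pot], folded K_def]
  have W0: "0 \<le> W (-R)" using nonneg[of "-R"] R by simp
  consider "R \<le> x" | "x \<le> - R" | "\<bar>x\<bar> < R" by linarith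
  then show ?thesis
  proof cases
    case 1
    have "(\<integral>\<^sup>+s. ennreal (w x * K x s) \<partial>lborel) \<le> (\<integral>\<^sup>+s. ennreal ((w s + 1) * exp ((E x - E s) / 2)) * indicator {x..} s \<partial>lborel)"
    proof (rule nn_integral_mono)
      fix s
      show "ennreal (w x * K x s) \<le> ennreal ((w s + 1) * exp ((E x - E s) / 2)) * indicator {x..} s"
      proof (cases "x \<le> s")
        case True
        then have "w x * K x s \<le> (w s + 1) * exp ((E x - E s) / 2)"
          using 1 by (intro weight_kern_le) auto
        then show ?thesis using True by (simp add: ennreal_leI)
      qed (simp add: K_eq)
    qed
    also have "\<dots> \<le> ennreal (2 + W (-R))"
      unfolding nn_integral_decay_right[OF 1] using W0 ennreal_leI[of 2 "2 + W (-R)"] by simp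
    finally show ?thesis .
  next
    case 2
    have "(\<integral>\<^sup>+s. ennreal (w x * K x s) \<partial>lborel) \<le> (\<integral>\<^sup>+s. ennreal ((w s + 1) * exp ((E x - E s) / 2)) * indicator {x..-R} s
        + ennreal (W (-R)) * ennreal (K (-R) s) \<partial>lborel)"
    proof (rule nn_integral_mono)
      fix s
      consider "s < x" | "x \<le> s" "s \<le> - R" | "- R < s" by linarith
      then show "ennreal (w x * K x s) \<le> ennreal ((w s + 1) * exp ((E x - E s) / 2)) * indicator {x..-R} s
        + ennreal (W (-R)) * ennreal (K (-R) s)"
      proof cases
        case 2
        then have "w x * K x s \<le> (w s + 1) * exp ((E x - E s) / 2)"
          using R by (intro weight_kern_le) auto
        then have "ennreal (w x * K x s) \<le> ennreal ((w s + 1) * exp ((E x - E s) / 2)) * indicator {x..-R} s"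
          using 2 by (simp add: ennreal_leI)
        then show ?thesis by (rule order_trans) simp
      next
        case 3
        have "W x \<le> W (-R) * exp ((E (-R) - E x) / 2)"
          using \<open>x \<le> -R\<close> R by (intro weight_mono) auto
        also have "\<dots> \<le> W (-R) * exp (E (-R) - E x)"
          using W0 E_growth[OF \<open>x \<le> -R\<close>] \<open>x \<le> -R\<close> by (intro mult_left_mono) auto
        finally have "w x * K x s \<le> (W (-R) * exp (E (-R) - E x)) * exp (E x - E s)"
          using 3 \<open>x \<le> -R\<close> R by (simp add: w_eq K_eq mult_right_mono)
        also have "\<dots> = W (-R) * K (-R) s"
          using 3 by (simp add: K_eq mult.assoc flip: exp_add)
        finally have "ennreal (w x * K x s) \<le> ennreal (W (-R)) * ennreal (K (-R) s)"
          using ennreal_leI ennreal_mult[OF W0, of "K (-R) s"] by (metis K_def kern_nonneg)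
        then show ?thesis by (rule order_trans) simp
      qed (simp add: K_eq)
    qed
    also have "\<dots> = (\<integral>\<^sup>+s. ennreal ((w s + 1) * exp ((E x - E s) / 2)) * indicator {x..-R} s \<partial>lborel)
        + ennreal (W (-R)) * (\<integral>\<^sup>+s. ennreal (K (-R) s) \<partial>lborel)"
      by (simp add: nn_integral_add nn_integral_cmult)
    also have "\<dots> \<le> 2 + ennreal (W (-R)) * 1"
      by (intro add_mono nn_integral_decay_left[OF 2] mult_left_mono nn_integral_kern_right[OF V, folded K_def]) simp
    also have "\<dots> = ennreal (2 + W (-R))" using W0 by simp
    finally show ?thesis .
  next
    case 3
    then show ?thesis by (simp add: w_eq)
  qed
qed

text \<open>In the variable \<open>x\<close> the integrand is dominated by the derivative of \<open>exp (E x - E s)\<close>, whose values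
  lie between 0 and 1 for \<open>x \<le> s\<close>; the two half lines contribute at most 1 each.\<close>

lemma weighted_kern_left:
  "(\<integral>\<^sup>+x. ennreal (w x * K x s) \<partial>lborel) \<le> ennreal 2"
proof -
  let ?f = "\<lambda>x. (w x + 1) * exp (E x - E s)"
  \<comment> \<open>The left half line and the constraint \<open>x \<le> s\<close> combine to \<open>x \<le> - ?m\<close>.\<close>
  let ?m = "max R (- s)"
  have "(\<integral>\<^sup>+x. ennreal (w x * K x s) \<partial>lborel)
      \<le> (\<integral>\<^sup>+x. ennreal (?f x) * indicator {R..s} x + ennreal (?f x) * indicator {..-?m} x \<partial>lborel)"
  proof (rule nn_integral_mono)
    fix x
    consider "R \<le> x" "x \<le> s" | "x \<le> - R" "x \<le> s" | "\<bar>x\<bar> < R \<or> s < x" by linarith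
    then show "ennreal (w x * K x s) \<le> ennreal (?f x) * indicator {R..s} x + ennreal (?f x) * indicator {..-?m} x"
    proof cases
      case 1
      have "w x * K x s \<le> ?f x" using 1 by (simp add: K_eq mult_right_mono)
      then show ?thesis using 1 R by (auto simp: indicator_def intro: ennreal_leI)
    next
      case 2
      have "w x * K x s \<le> ?f x" using 2 by (simp add: K_eq mult_right_mono)
      then show ?thesis using 2 R by (auto simp: indicator_def intro: ennreal_leI)
    qed (auto simp: w_eq K_eq)
  qed
  also have "\<dots> = (\<integral>\<^sup>+x. ennreal (?f x) * indicator {R..s} x \<partial>lborel) + (\<integral>\<^sup>+x. ennreal (?f x) * indicator {..-?m} x \<partial>lborel)"
    by (rule nn_integral_add) measurable
  also have "\<dots> \<le> ennreal 1 + ennreal 1"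
  proof (rule add_mono)
    show "(\<integral>\<^sup>+x. ennreal (?f x) * indicator {R..s} x \<partial>lborel) \<le> ennreal 1"
    proof (cases "R \<le> s")
      case True
      have "(\<integral>\<^sup>+x. ennreal (?f x) * indicator {R..s} x \<partial>lborel) = ennreal (exp (E s - E s) - exp (E R - E s))"
      proof (rule nn_integral_FTC_Icc[where F="\<lambda>x. exp (E x - E s)"])
        show "((\<lambda>x. exp (E x - E s)) has_real_derivative ?f x) (at x)" if "x \<in> {R..s}" for x
          using that R by (auto intro!: derivative_eq_intros simp: w_eq)
      qed (use w_nonneg True in \<open>auto intro!: mult_nonneg_nonneg add_nonneg_nonneg\<close>)
      also have "\<dots> \<le> ennreal 1" by (rule ennreal_leI) simp
      finally show ?thesis .
    qed simp
    have "(\<integral>\<^sup>+x. ennreal (?f x) * indicator {..-?m} x \<partial>lborel) = (\<integral>\<^sup>+x. ennreal (?f (0 + (-1) * x)) * indicator {..-?m} (0 + (-1) * x) \<partial>lborel)"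
      by (subst nn_integral_real_affine[where c="-1" and t=0]) auto
    also have "\<dots> = (\<integral>\<^sup>+x. ennreal (?f (- x)) * indicator {?m..} x \<partial>lborel)"
      by (intro nn_integral_cong) (auto simp: indicator_def)
    also have "\<dots> = ennreal (- 0 - (- exp (E (- ?m) - E s)))"
    proof (rule nn_integral_FTC_atLeast[where F="\<lambda>x. - exp (E (- x) - E s)"])
      show "((\<lambda>x. - exp (E (- x) - E s)) \<longlongrightarrow> - 0) at_top"
        by (intro tendsto_intros E_tendsto)
      show "((\<lambda>x. - exp (E (- x) - E s)) has_real_derivative ?f (- x)) (at x)" if "?m \<le> x" for x
        using that R by (auto intro!: derivative_eq_intros simp: w_eq algebra_simps)
    qed (use w_nonneg in \<open>auto intro!: mult_nonneg_nonneg add_nonneg_nonneg\<close>)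
    also have "\<dots> \<le> ennreal 1"
    proof (rule ennreal_leI)
      have "- ?m \<le> s" by linarith
      then show "- 0 - (- exp (E (- ?m) - E s)) \<le> 1" using E_growth[of "-?m" s] by simp
    qed
    finally show "(\<integral>\<^sup>+x. ennreal (?f x) * indicator {..-?m} x \<partial>lborel) \<le> ennreal 1" .
  qed
  finally show ?thesis by (simp flip: ennreal_plus)
qed

text \<open>Near the origin \<open>W\<close> is essentially bounded, and far away the Schur test applies.\<close>

lemma resolvent_in_mult_dom: "resolvent (\<lambda>x. W x + 1) h \<in> mult_dom W"
proof -
  let ?V = "\<lambda>x. W x + 1"
  note V = coercive_add_one[OF pot]
  have 1: "sq_int (\<lambda>x. of_real (w x) * res_fun ?V h x)"
    by (rule weighted_res_fun_sq_int[OF V w_borel w_nonneg weighted_kern_right[unfolded K_def] weighted_kern_left[unfolded K_def]])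
      (use nonneg[of "-R"] R in auto)
  obtain M where M: "AE x in lebesgue. x \<in> {-R..R} \<longrightarrow> \<bar>W x\<bar> \<le> M" "M \<ge> 0"
    using potential_bounded[OF pot, of "{-R..R}"] by auto
  let ?u = "rep_l2 (resolvent ?V h)"
  have 2: "sq_int (\<lambda>x. of_real (W x - w x) * ?u x)"
  proof (rule sq_int_dominated[OF _ sq_int_rep[of "resolvent ?V h"], where c=M])
    show "AE x in lebesgue. cmod (of_real (W x - w x) * ?u x) \<le> M * cmod (?u x)"
      using M(1)
    proof eventually_elim
      case (elim x)
      then have "\<bar>W x - w x\<bar> \<le> M" using M(2) by (auto simp: w_eq)
      then show ?case by (simp add: norm_mult mult_right_mono del: of_real_diff)
    qed
    have "w \<in> borel_measurable lebesgue" by (rule measurable_completion) simp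
    then show "(\<lambda>x. of_real (W x - w x) * ?u x) \<in> borel_measurable lebesgue"
      using potential_measurable[OF pot] by measurable
  qed
  show ?thesis
    unfolding mult_dom_def mem_Collect_eq
  proof (rule sq_int_cong[OF sq_int_add[OF 1 2]])
    show "AE x in lebesgue. of_real (w x) * res_fun ?V h x + of_real (W x - w x) * ?u x = of_real (W x) * ?u x"
      using rep_resolvent[OF V, of h] by eventually_elim (simp add: algebra_simps)
  qed
qed

end

section \<open>Smooth functions and bump functions\<close>

text \<open>Derivatives up to order \<open>n\<close> exist and are differentiable. Recursion through \<open>deriv f\<close> makes closure
  under products an induction on \<open>n\<close>, with the Leibniz rule as its step.\<close>

fun smooth_n :: "nat \<Rightarrow> (real \<Rightarrow> real) \<Rightarrow> bool" where
  "smooth_n 0 f \<longleftrightarrow> (\<forall>x. f differentiable (at x))"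
| "smooth_n (Suc n) f \<longleftrightarrow> (\<forall>x. f differentiable (at x)) \<and> smooth_n n (deriv f)"

lemma smooth_n_differentiable: "smooth_n n f \<Longrightarrow> f differentiable (at x)"
  by (cases n) auto

lemma smooth_n_iff: "smooth_n n f \<longleftrightarrow> (\<forall>k\<le>n. \<forall>x. (deriv ^^ k) f differentiable (at x))"
proof (induction n arbitrary: f)
  case (Suc n)
  have "(\<forall>k\<le>Suc n. P k) \<longleftrightarrow> P 0 \<and> (\<forall>k\<le>n. P (Suc k))" for P
    by (metis Suc_le_mono le0 not0_implies_Suc)
  then show ?case using Suc by (simp add: funpow_Suc_right del: funpow.simps(2))
qed simp

lemma smooth_iff: "(\<forall>n x. (deriv ^^ n) f differentiable (at x)) \<longleftrightarrow> (\<forall>n. smooth_n n f)"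
  using smooth_n_iff by blast

lemma smooth_n_SucI:
  assumes "\<And>x. (f has_real_derivative f' x) (at x)" "smooth_n n f'"
  shows "smooth_n (Suc n) f"
proof -
  have "deriv f = f'" using assms(1) by (auto intro!: DERIV_imp_deriv)
  then show ?thesis using assms real_differentiable_def by auto
qed

lemma smooth_n_DERIV: "smooth_n n f \<Longrightarrow> (f has_real_derivative deriv f x) (at x)"
  using smooth_n_differentiable DERIV_deriv_iff_real_differentiable by blast

lemma smooth_n_Suc_D: "smooth_n (Suc n) f \<Longrightarrow> smooth_n n f"
  unfolding smooth_n_iff by auto

lemma smooth_n_const: "smooth_n n (\<lambda>x. c)"
proof (induction n arbitrary: c)
  case (Suc n)
  show ?case by (rule smooth_n_SucI[OF _ Suc[of 0]]) simp
qed simp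

lemma smooth_n_add: "smooth_n n f \<Longrightarrow> smooth_n n g \<Longrightarrow> smooth_n n (\<lambda>x. f x + g x)"
proof (induction n arbitrary: f g)
  case (Suc n)
  have "smooth_n n (\<lambda>x. deriv f x + deriv g x)" using Suc by simp
  then show ?case
    by (rule smooth_n_SucI[rotated]) (intro DERIV_add smooth_n_DERIV[OF Suc(2)] smooth_n_DERIV[OF Suc(3)])
qed simp

lemma smooth_n_mult: "smooth_n n f \<Longrightarrow> smooth_n n g \<Longrightarrow> smooth_n n (\<lambda>x. f x * g x)"
proof (induction n arbitrary: f g)
  case (Suc n)
  have "smooth_n n (\<lambda>x. deriv f x * g x + deriv g x * f x)"
    using Suc smooth_n_Suc_D[OF Suc(2)] smooth_n_Suc_D[OF Suc(3)] by (intro smooth_n_add) auto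
  then show ?case
    by (rule smooth_n_SucI[rotated]) (intro DERIV_mult smooth_n_DERIV[OF Suc(2)] smooth_n_DERIV[OF Suc(3)])
qed simp

lemma smooth_n_diff: "smooth_n n f \<Longrightarrow> smooth_n n g \<Longrightarrow> smooth_n n (\<lambda>x. f x - g x)"
  using smooth_n_add[of n f "\<lambda>x. (-1) * g x"] smooth_n_mult[OF smooth_n_const[of n "-1"], of g] by simp

lemma smooth_n_affine: "smooth_n n f \<Longrightarrow> smooth_n n (\<lambda>x. f (c * x + d))"
proof (induction n arbitrary: f)
  case 0
  have "((\<lambda>x. f (c * x + d)) has_real_derivative deriv f (c * x + d) * c) (at x)" for x
    by (rule DERIV_chain2[OF smooth_n_DERIV[OF 0]]) (auto intro!: derivative_eq_intros)
  then show ?case using real_differentiable_def by auto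
next
  case (Suc n)
  have "smooth_n n (\<lambda>x. deriv f (c * x + d) * c)"
    using Suc by (intro smooth_n_mult smooth_n_const) auto
  then show ?case
    by (rule smooth_n_SucI[rotated], intro DERIV_chain2[OF smooth_n_DERIV[OF Suc(2)]])
      (auto intro!: derivative_eq_intros)
qed

text \<open>The family of functions \<open>p(1/x) exp (-1/x)\<close>, extended by zero to \<open>x \<le> 0\<close>, is closed under
  differentiation, also at the origin; so all its members are smooth.\<close>

definition flat :: "real poly \<Rightarrow> real \<Rightarrow> real" where
  "flat p x = (if 0 < x then poly p (1 / x) * exp (- (1 / x)) else 0)"

lemma poly_exp_tendsto: "((\<lambda>u. poly p u * exp (- u)) \<longlongrightarrow> (0::real)) at_top"
proof -
  have "((\<lambda>u. \<Sum>i\<le>degree p. coeff p i * (u ^ i / exp u)) \<longlongrightarrow> (\<Sum>i\<le>degree p. coeff p i * 0)) at_top"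
    by (intro tendsto_intros tendsto_power_div_exp_0)
  then show ?thesis
    by (simp add: poly_altdef sum_distrib_right exp_minus divide_inverse mult.assoc)
qed

lemma flat_DERIV:
  "(flat p has_real_derivative flat ([:0, 0, 1:] * (p - pderiv p)) x) (at x)"
proof -
  consider "x > 0" | "x < 0" | "x = 0" by linarith
  then show ?thesis
  proof cases
    case 1
    have "((\<lambda>x. poly p (1 / x) * exp (- (1 / x))) has_real_derivative
        poly p (1 / x) * (exp (- (1 / x)) * (1 / x\<^sup>2)) + poly (pderiv p) (1 / x) * (- 1 / x\<^sup>2) * exp (- (1 / x))) (at x)"
      using 1 by (auto intro!: derivative_eq_intros DERIV_chain2[OF poly_DERIV] simp: power2_eq_square)
    then have "((\<lambda>x. poly p (1 / x) * exp (- (1 / x))) has_real_derivative flat ([:0, 0, 1:] * (p - pderiv p)) x) (at x)"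
      using 1 by (simp add: flat_def power2_eq_square field_simps)
    then show ?thesis
      by (rule has_field_derivative_transform_within_open[of _ _ _ "{0<..}"]) (use 1 in \<open>auto simp: flat_def\<close>)
  next
    case 2
    have "((\<lambda>x. 0) has_real_derivative 0) (at x)" by simp
    then have "(flat p has_real_derivative 0) (at x)"
      by (rule has_field_derivative_transform_within_open[of _ _ _ "{..<0}"]) (use 2 in \<open>auto simp: flat_def\<close>)
    then show ?thesis using 2 by (simp add: flat_def)
  next
    case 3
    have "((\<lambda>y. (flat p y - flat p 0) / (y - 0)) \<longlongrightarrow> 0) (at 0)"
    proof (rule filterlim_split_at)
      show "((\<lambda>y. (flat p y - flat p 0) / (y - 0)) \<longlongrightarrow> 0) (at_left 0)"
      proof (rule Lim_transform_eventually[OF tendsto_const])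
        show "\<forall>\<^sub>F y in at_left 0. 0 = (flat p y - flat p 0) / (y - 0)"
          unfolding eventually_at_topological by (intro exI[of _ UNIV]) (auto simp: flat_def)
      qed
      have "((\<lambda>y. poly ([:0, 1:] * p) (inverse y) * exp (- inverse y)) \<longlongrightarrow> 0) (at_right 0)"
        by (rule filterlim_compose[OF poly_exp_tendsto filterlim_inverse_at_top_right])
      then show "((\<lambda>y. (flat p y - flat p 0) / (y - 0)) \<longlongrightarrow> 0) (at_right 0)"
      proof (rule Lim_transform_eventually)
        show "\<forall>\<^sub>F y in at_right 0. poly ([:0, 1:] * p) (inverse y) * exp (- inverse y) = (flat p y - flat p 0) / (y - 0)"
          using eventually_at_right_less[of 0]
          by eventually_elim (simp add: flat_def divide_inverse)
      qed
    qed
    then show ?thesis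
      by (simp add: has_field_derivative_iff flat_def 3)
  qed
qed

lemma smooth_n_flat: "smooth_n n (flat p)"
proof (induction n arbitrary: p)
  case 0
  then show ?case using flat_DERIV real_differentiable_def by auto
next
  case (Suc n)
  then show ?case by (rule smooth_n_SucI[OF flat_DERIV])
qed

text \<open>As \<open>n\<close> grows, \<open>exp (- 1 / (n y))\<close> tends to 1 for every \<open>y > 0\<close>, so these test functions converge to the
  indicator of the open interval from \<open>a\<close> to \<open>b\<close>.\<close>

definition bump :: "real \<Rightarrow> real \<Rightarrow> nat \<Rightarrow> real \<Rightarrow> real" where
  "bump a b n x = flat 1 (real (Suc n) * (x - a)) * flat 1 (real (Suc n) * (b - x))"

lemma bump_bounds: "0 \<le> bump a b n x" "bump a b n x \<le> indicator {a<..<b} x"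
  by (auto simp: bump_def flat_def zero_less_mult_iff indicator_def mult_le_one split: if_splits)

lemma bump_support: "bump a b n x \<noteq> 0 \<Longrightarrow> x \<in> {a..b}"
  by (auto simp: bump_def flat_def zero_less_mult_iff split: if_splits)

lemma test_functionI:
  assumes "\<And>n. smooth_n n \<phi>" "\<And>x. \<phi> x \<noteq> 0 \<Longrightarrow> x \<in> {a..b}"
  shows "test_function \<phi>"
  unfolding test_function_def
proof
  show "\<forall>n x. (deriv ^^ n) \<phi> differentiable (at x)" using assms(1) by (simp add: smooth_iff)
  have "closure {x. \<phi> x \<noteq> 0} \<subseteq> {a..b}"
    by (rule closure_minimal) (use assms(2) in auto)
  moreover have "compact {a..b}" by (rule compact_Icc)
  ultimately show "compact (closure {x. \<phi> x \<noteq> 0})"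
    by (meson bounded_subset closed_closure compact_eq_bounded_closed)
qed

lemma test_function_bump: "test_function (bump a b n)"
proof (rule test_functionI[OF _ bump_support])
  fix k
  have "smooth_n k (\<lambda>x. flat 1 (real (Suc n) * x + (- real (Suc n) * a)) * flat 1 ((- real (Suc n)) * x + real (Suc n) * b))"
    by (intro smooth_n_mult smooth_n_affine smooth_n_flat)
  also have "(\<lambda>x. flat 1 (real (Suc n) * x + (- real (Suc n) * a)) * flat 1 ((- real (Suc n)) * x + real (Suc n) * b)) = bump a b n"
    by (auto simp: bump_def fun_eq_iff algebra_simps)
  finally show "smooth_n k (bump a b n)" .
qed

lemma bump_tendsto: "(\<lambda>n. bump a b n x) \<longlonglongrightarrow> indicator {a<..<b} x"
proof -
  have f: "(\<lambda>n. flat 1 (real (Suc n) * y)) \<longlonglongrightarrow> indicator {0<..} y" for y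
  proof (cases "y > 0")
    case True
    have "(\<lambda>n. exp (- (inverse (real (Suc n)) * (1 / y)))) \<longlonglongrightarrow> exp (- (0 * (1 / y)))"
      by (intro tendsto_intros LIMSEQ_inverse_real_of_nat)
    then show ?thesis using True by (simp add: flat_def divide_inverse)
  qed (simp add: flat_def zero_less_mult_iff)
  have "(\<lambda>n. bump a b n x) \<longlonglongrightarrow> indicator {0<..} (x - a) * indicator {0<..} (b - x)"
    unfolding bump_def by (intro tendsto_mult f)
  then show ?thesis by (auto simp: indicator_def)
qed

section \<open>Test functions as elements of the Hilbert space\<close>

lemma test_smooth: "test_function \<phi> \<Longrightarrow> smooth_n n \<phi>"
  using smooth_iff by (auto simp: test_function_def)

lemma test_DERIV: "test_function \<phi> \<Longrightarrow> (\<phi> has_real_derivative deriv \<phi> x) (at x)"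
  using smooth_n_DERIV[OF test_smooth] by blast

lemma test_support:
  assumes "test_function \<phi>" shows "\<exists>N>0. \<forall>x. N < \<bar>x\<bar> \<longrightarrow> \<phi> x = 0"
proof -
  have "bounded (closure {x. \<phi> x \<noteq> 0})"
    using assms by (auto simp: test_function_def compact_imp_bounded)
  then obtain N where "N > 0" "\<forall>x\<in>closure {x. \<phi> x \<noteq> 0}. norm x \<le> N"
    unfolding bounded_pos by blast
  then show ?thesis
    using closure_subset[of "{x. \<phi> x \<noteq> 0}"] by (intro exI[of _ N]) force
qed

lemma test_deriv:
  assumes "test_function \<phi>" shows "test_function (deriv \<phi>)"
proof -
  obtain N where N: "N > 0" "\<And>x. \<bar>x\<bar> > N \<Longrightarrow> \<phi> x = 0" using test_support[OF assms] by blast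
  have "deriv \<phi> x = 0" if "\<bar>x\<bar> > N" for x
  proof (rule DERIV_imp_deriv)
    have "((\<lambda>x. 0) has_real_derivative 0) (at x)" by simp
    moreover have "open {y::real. N < \<bar>y\<bar>}" by (intro open_Collect_less continuous_intros)
    ultimately show "(\<phi> has_real_derivative 0) (at x)"
      by (rule has_field_derivative_transform_within_open) (use that N in auto)
  qed
  moreover have "smooth_n n (deriv \<phi>)" for n
    using test_smooth[OF assms, of "Suc n"] by simp
  ultimately show ?thesis
    by (intro test_functionI[where a="-N" and b=N]) (force simp: not_less abs_le_iff)+
qed

lemma test_continuous: "test_function \<phi> \<Longrightarrow> continuous_on A \<phi>"
  using test_DERIV DERIV_isCont continuous_at_imp_continuous_on by blast

lemma test_measurable: "test_function \<phi> \<Longrightarrow> \<phi> \<in> borel_measurable borel"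
  using test_continuous borel_measurable_continuous_onI by blast

lemma test_bounded:
  assumes "test_function \<phi>" shows "\<exists>B\<ge>0. \<forall>x. \<bar>\<phi> x\<bar> \<le> B"
proof -
  obtain N where N: "N > 0" "\<And>x. \<bar>x\<bar> > N \<Longrightarrow> \<phi> x = 0" using test_support[OF assms] by blast
  have "bounded (\<phi> ` {-N..N})"
    by (intro compact_imp_bounded compact_continuous_image test_continuous assms compact_Icc)
  then obtain B where "B > 0" and B: "\<And>x. x \<in> {-N..N} \<Longrightarrow> \<bar>\<phi> x\<bar> \<le> B"
    by (auto simp: bounded_pos)
  then have "\<bar>\<phi> x\<bar> \<le> B" for x
  proof (cases "\<bar>x\<bar> > N")
    case False
    then have "x \<in> {-N..N}" by auto
    then show ?thesis by (rule B)
  qed (use N(2) \<open>B > 0\<close> in auto)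
  then show ?thesis using \<open>B > 0\<close> by (intro exI[of _ B]) auto
qed

lemma sq_int_bounded_support:
  assumes f: "f \<in> borel_measurable lebesgue" and B: "\<And>x. cmod (f x) \<le> B" and N: "\<And>x. x \<notin> {a..b} \<Longrightarrow> f x = 0"
  shows "sq_int f"
proof (rule sq_int_dominated[OF f])
  show "sq_int (indicator {a..b})" by (intro sq_int_indicator) simp
  show "AE x in lebesgue. cmod (f x) \<le> B * cmod (indicator {a..b} x)"
    using B N by (auto simp: indicator_def)
qed

definition test_l2 :: "(real \<Rightarrow> real) \<Rightarrow> l2" where "test_l2 \<phi> = abs_l2 (\<lambda>x. of_real (\<phi> x))"

lemma sq_int_test:
  assumes "test_function \<phi>" shows "sq_int (\<lambda>x. of_real (\<phi> x))"
proof -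
  obtain N where N: "N > 0" "\<And>x. \<bar>x\<bar> > N \<Longrightarrow> \<phi> x = 0" using test_support[OF assms] by blast
  obtain B where B: "\<And>x. \<bar>\<phi> x\<bar> \<le> B" using test_bounded[OF assms] by blast
  note [measurable] = test_measurable[OF assms]
  show ?thesis
  proof (rule sq_int_bounded_support[where a="-N" and b=N and B=B])
    show "(\<lambda>x. complex_of_real (\<phi> x)) \<in> borel_measurable lebesgue"
      by (rule measurable_completion) measurable
  qed (use N(2) B in \<open>auto simp: not_le\<close>)
qed

lemma rep_test_l2: "test_function \<phi> \<Longrightarrow> AE x in lebesgue. rep_l2 (test_l2 \<phi>) x = of_real (\<phi> x)"
  unfolding test_l2_def by (rule rep_abs[OF sq_int_test])

lemma pair_test_l2:
  assumes "test_function \<phi>"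
  shows "(LINT x|lebesgue. rep_l2 f x * of_real (\<phi> x)) = pair f (test_l2 \<phi>)"
  by (rule pair_cong[symmetric]) (use rep_test_l2[OF assms] in \<open>auto elim: eventually_mono\<close>)

lemma is_weak_deriv_pair:
  "is_weak_deriv f g \<longleftrightarrow> (\<forall>\<phi>. test_function \<phi> \<longrightarrow> pair f (test_l2 (deriv \<phi>)) = - pair g (test_l2 \<phi>))"
  unfolding is_weak_deriv_def using pair_test_l2 test_deriv by auto

text \<open>Bump functions converge to indicators, so \<open>f\<close> integrates to zero over every interval. Hence all
  its averages along translations vanish, and these averages converge to \<open>f\<close>.\<close>

lemma fundamental_lemma:
  assumes z: "\<And>\<phi>. test_function \<phi> \<Longrightarrow> pair f (test_l2 \<phi>) = 0"
  shows "f = 0"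
proof -
  have 1: "(LINT x|lborel. borel_rep f x * of_real (indicator {a<..<b} x)) = 0" for a b
  proof -
    have "(\<lambda>n. (LINT x|lebesgue. borel_rep f x * of_real (bump a b n x))) \<longlonglongrightarrow> (LINT x|lebesgue. borel_rep f x * of_real (indicator {a<..<b} x))"
    proof (rule integral_dominated_convergence[where w="\<lambda>x. cmod (borel_rep f x * of_real (indicator {a<..<b} x))"])
      have i: "sq_int (\<lambda>x. of_real (indicator {a<..<b} x))"
        using sq_int_indicator[of "{a<..<b}"] by (simp add: of_real_indicator)
      then show "integrable lebesgue (\<lambda>x. cmod (borel_rep f x * of_real (indicator {a<..<b} x)))"
        by (intro integrable_norm integrable_mult_sq_int sq_int_borel_rep)
      show "(\<lambda>x. borel_rep f x * of_real (indicator {a<..<b} x)) \<in> borel_measurable lebesgue"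
        by (rule borel_measurable_integrable) (intro integrable_mult_sq_int sq_int_borel_rep i)
      show "(\<lambda>x. borel_rep f x * of_real (bump a b n x)) \<in> borel_measurable lebesgue" for n
        by (rule borel_measurable_integrable) (intro integrable_mult_sq_int sq_int_borel_rep sq_int_test test_function_bump)
      show "AE x in lebesgue. (\<lambda>n. borel_rep f x * of_real (bump a b n x)) \<longlonglongrightarrow> borel_rep f x * of_real (indicator {a<..<b} x)"
        by (intro always_eventually allI tendsto_intros bump_tendsto)
      show "AE x in lebesgue. norm (borel_rep f x * of_real (bump a b n x)) \<le> cmod (borel_rep f x * of_real (indicator {a<..<b} x))" for n
        using bump_bounds[of a b n] by (auto simp: norm_mult intro!: mult_left_mono)
    qed
    moreover have "(LINT x|lebesgue. borel_rep f x * of_real (bump a b n x)) = 0" for n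
    proof -
      have "(LINT x|lebesgue. borel_rep f x * of_real (bump a b n x)) = pair f (test_l2 (bump a b n))"
        by (rule pair_cong[symmetric])
          (use rep_test_l2[OF test_function_bump[of a b n]] borel_rep_AE[of f] in \<open>eventually_elim, simp\<close>)
      then show ?thesis using z[OF test_function_bump] by simp
    qed
    ultimately have "(LINT x|lebesgue. borel_rep f x * of_real (indicator {a<..<b} x)) = 0"
      by (simp add: LIMSEQ_const_iff)
    then show ?thesis by (subst (asm) integral_completion) auto
  qed
  have "avg (\<lambda>_. 0) t f = 0" if t: "t > 0" for t
  proof -
    have "avg_fun (\<lambda>_. 0) t f x = 0" for x
    proof -
      have "avg_fun (\<lambda>_. 0) t f x = (LINT s|lborel. indicator {x..<x+t} s *\<^sub>R borel_rep f s)"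
        by (rule avg_fun_zero)
      also have "\<dots> = (LINT s|lborel. borel_rep f s * of_real (indicator {x<..<x+t} s))"
      proof (rule integral_cong_AE)
        show "AE s in lborel. indicator {x..<x+t} s *\<^sub>R borel_rep f s = borel_rep f s * of_real (indicator {x<..<x+t} s)"
          using AE_lborel_singleton[of x] by eventually_elim (auto simp: indicator_def)
      qed measurable
      finally show ?thesis using 1 by simp
    qed
    then have "avg_fun (\<lambda>_. 0) t f = (\<lambda>x. 0)" by auto
    then show ?thesis by (simp add: avg_def zero_l2_def)
  qed
  then have "\<forall>\<^sub>F t in at_right 0. (0::l2) = avg (\<lambda>_. 0) t f /\<^sub>R t"
    using eventually_at_right_less[of "0::real"] by (auto elim: eventually_mono)
  then have "((\<lambda>t. avg (\<lambda>_. 0) t f /\<^sub>R t) \<longlongrightarrow> 0) (at_right 0)"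
    by (rule Lim_transform_eventually[OF tendsto_const])
  from tendsto_unique[OF _ avg_tendsto[OF potential_zero] this] show ?thesis by simp
qed

interpretation pair: bounded_bilinear pair by (rule bounded_bilinear_pair)

lemma weak_deriv_unique: "is_weak_deriv f g \<Longrightarrow> is_weak_deriv f g' \<Longrightarrow> g = g'"
  using fundamental_lemma[of "g - g'"] by (auto simp: is_weak_deriv_pair pair.diff_left)

lemma weak_deriv_eq: "is_weak_deriv f g \<Longrightarrow> weak_deriv f = g"
  unfolding weak_deriv_def using weak_deriv_unique by blast

lemma is_weak_deriv_diff:
  "is_weak_deriv f g \<Longrightarrow> is_weak_deriv f' g' \<Longrightarrow> is_weak_deriv (f - f') (g - g')"
  by (auto simp: is_weak_deriv_pair pair.diff_left)

section \<open>Weak derivatives and difference quotients\<close>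

lemma nn_integral_translation:
  assumes "f \<in> borel_measurable borel" shows "(\<integral>\<^sup>+x. f (x + (t::real)) \<partial>lborel) = (\<integral>\<^sup>+x. f x \<partial>lborel)"
  using nn_integral_real_affine[OF assms, of 1 t] by (simp add: add.commute)

text \<open>The hypothesis of Fubini's theorem, from \<open>\<bar>a b\<bar> \<le> \<bar>a\<bar>\<^sup>2 + \<bar>b\<bar>\<^sup>2\<close>. The factor \<open>c\<close> selects translation to the
  left or to the right.\<close>

lemma integrable_convolution:
  fixes a b :: "real \<Rightarrow> complex"
  assumes [measurable]: "a \<in> borel_measurable borel" "b \<in> borel_measurable borel"
    and ab: "sq_int a" "sq_int b"
  shows "integrable (lborel \<Otimes>\<^sub>M lborel) (\<lambda>(s, x). indicator {0..<t} s *\<^sub>R (a (x + c * s) * b x))"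
proof (rule integrableI_bounded)
  have fin: "(\<integral>\<^sup>+x. ennreal ((cmod (f x))\<^sup>2) \<partial>lborel) < \<infinity>" if "sq_int f" for f
    using that by (auto simp: sq_int_def integrable_iff_bounded nn_integral_completion)
  let ?A = "\<integral>\<^sup>+x. ennreal ((cmod (a x))\<^sup>2) \<partial>lborel" and ?B = "\<integral>\<^sup>+x. ennreal ((cmod (b x))\<^sup>2) \<partial>lborel"
  have "(\<integral>\<^sup>+z. ennreal (norm (case z of (s, x) \<Rightarrow> indicator {0..<t} s *\<^sub>R (a (x + c * s) * b x))) \<partial>(lborel \<Otimes>\<^sub>M lborel))
     = (\<integral>\<^sup>+s. (\<integral>\<^sup>+x. ennreal (indicator {0..<t} s) * ennreal (cmod (a (x + c * s)) * cmod (b x)) \<partial>lborel) \<partial>lborel)"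
    by (subst lborel.nn_integral_fst[symmetric]) (auto simp: norm_mult ennreal_mult)
  also have "\<dots> \<le> (\<integral>\<^sup>+s. indicator {0..<t} s * (?A + ?B) \<partial>lborel)"
  proof (rule nn_integral_mono)
    fix s
    have "(\<integral>\<^sup>+x. ennreal (indicator {0..<t} s) * ennreal (cmod (a (x + c * s)) * cmod (b x)) \<partial>lborel)
      = ennreal (indicator {0..<t} s) * (\<integral>\<^sup>+x. ennreal (cmod (a (x + c * s)) * cmod (b x)) \<partial>lborel)"
      by (rule nn_integral_cmult) measurable
    also have "\<dots> \<le> ennreal (indicator {0..<t} s) * (\<integral>\<^sup>+x. ennreal ((cmod (a (x + c * s)))\<^sup>2) + ennreal ((cmod (b x))\<^sup>2) \<partial>lborel)"
    proof (intro mult_left_mono nn_integral_mono)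
      fix x
      have "2 * (cmod (a (x + c * s)) * cmod (b x)) \<le> (cmod (a (x + c * s)))\<^sup>2 + (cmod (b x))\<^sup>2"
        using sum_squares_bound[of "cmod (a (x + c * s))" "cmod (b x)"] by (simp add: mult.assoc)
      moreover have "0 \<le> cmod (a (x + c * s)) * cmod (b x)" by simp
      ultimately have "cmod (a (x + c * s)) * cmod (b x) \<le> (cmod (a (x + c * s)))\<^sup>2 + (cmod (b x))\<^sup>2" by linarith
      then show "ennreal (cmod (a (x + c * s)) * cmod (b x)) \<le> ennreal ((cmod (a (x + c * s)))\<^sup>2) + ennreal ((cmod (b x))\<^sup>2)"
        by (simp add: ennreal_leI flip: ennreal_plus)
    qed simp
    also have "\<dots> = indicator {0..<t} s * (?A + ?B)"
      using nn_integral_translation[of "\<lambda>x. ennreal ((cmod (a x))\<^sup>2)" "c * s"]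
      by (subst nn_integral_add) (auto simp: ennreal_indicator)
    finally show "(\<integral>\<^sup>+x. ennreal (indicator {0..<t} s) * ennreal (cmod (a (x + c * s)) * cmod (b x)) \<partial>lborel)
      \<le> indicator {0..<t} s * (?A + ?B)" .
  qed
  also have "\<dots> = emeasure lborel {0..<t} * (?A + ?B)"
    by (subst nn_integral_multc) auto
  also have "\<dots> < \<infinity>"
    using fin[OF ab(1)] fin[OF ab(2)] by (cases "0 \<le> t") (auto simp: ennreal_mult_less_top)
  finally show "(\<integral>\<^sup>+z. ennreal (norm (case z of (s, x) \<Rightarrow> indicator {0..<t} s *\<^sub>R (a (x + c * s) * b x))) \<partial>(lborel \<Otimes>\<^sub>M lborel)) < \<infinity>" .
qed measurable

lemma test_translate:
  assumes "test_function \<phi>" shows "test_function (\<lambda>x. \<phi> (x - t))"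
proof -
  obtain N where N: "N > 0" "\<And>x. \<bar>x\<bar> > N \<Longrightarrow> \<phi> x = 0" using test_support[OF assms] by blast
  have "smooth_n n (\<lambda>x. \<phi> (x - t))" for n
    using smooth_n_affine[OF test_smooth[OF assms], of n 1 "-t"] by simp
  then show ?thesis
    by (rule test_functionI[where a="-N+t" and b="N+t"]) (use N(2) in \<open>force simp: not_le abs_le_iff not_less\<close>)
qed

text \<open>The adjoint of averaging over \<open>[x, x + t)\<close> under the pairing. Its derivative is a difference of
  two translates of \<open>\<phi>\<close>, which makes it the right test function for increments.\<close>

definition window :: "real \<Rightarrow> (real \<Rightarrow> real) \<Rightarrow> real \<Rightarrow> real" where
  "window t \<phi> x = (LINT s|lborel. indicator {0..<t} s * \<phi> (x - s))"

lemma window_test: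
  assumes \<phi>: "test_function \<phi>" and t: "t \<ge> 0"
  shows "test_function (window t \<phi>)" "deriv (window t \<phi>) x = \<phi> x - \<phi> (x - t)"
proof -
  have "\<exists>P. \<forall>x. - \<infinity> < ereal x \<longrightarrow> ereal x < \<infinity> \<longrightarrow> (P has_vector_derivative \<phi> x) (at x)"
    by (rule einterval_antiderivative) (use DERIV_isCont[OF test_DERIV[OF \<phi>]] in auto)
  then obtain P where P: "\<And>x. (P has_real_derivative \<phi> x) (at x)"
    by (auto simp: has_real_derivative_iff_has_vector_derivative)
  note [measurable] = test_measurable[OF \<phi>]
  have eq: "window t \<phi> x = P x - P (x - t)" for x
  proof -
    have "window t \<phi> x = (LINT s|lborel. \<phi> (x - s) * indicator {0..t} s)"
      unfolding window_def
    proof (rule integral_cong_AE)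
      show "AE s in lborel. indicator {0..<t} s * \<phi> (x - s) = \<phi> (x - s) * indicator {0..t} s"
        using AE_lborel_singleton[of t] by eventually_elim (auto simp: indicator_def)
    qed measurable
    also have "\<dots> = - P (x - t) - (- P (x - 0))"
    proof (rule integral_FTC_Icc_real[OF t])
      show "((\<lambda>s. - P (x - s)) has_real_derivative \<phi> (x - s)) (at s)" for s
        by (auto intro!: derivative_eq_intros DERIV_chain2[OF P])
      have "continuous_on UNIV (\<lambda>s. \<phi> (x - s))"
        by (intro continuous_on_compose2[OF test_continuous[OF \<phi>, of UNIV]] continuous_intros) auto
      then show "isCont (\<lambda>s. \<phi> (x - s)) s" for s by (simp add: continuous_on_eq_continuous_at)
    qed
    finally show ?thesis by simp
  qed
  have D: "(window t \<phi> has_real_derivative (\<phi> x - \<phi> (x - t))) (at x)" for x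
    unfolding eq[abs_def] by (auto intro!: derivative_eq_intros P DERIV_chain2[OF P])
  then show "deriv (window t \<phi>) x = \<phi> x - \<phi> (x - t)" by (rule DERIV_imp_deriv)
  have "smooth_n (Suc n) (window t \<phi>)" for n
    by (rule smooth_n_SucI[OF D]) (intro smooth_n_diff test_smooth \<phi> test_translate)
  then have s: "smooth_n n (window t \<phi>)" for n by (rule smooth_n_Suc_D)
  obtain N where N: "N > 0" "\<And>x. \<bar>x\<bar> > N \<Longrightarrow> \<phi> x = 0" using test_support[OF \<phi>] by blast
  have "window t \<phi> x = 0" if "x \<notin> {-N..N+t}" for x
  proof -
    have "indicator {0..<t} s * \<phi> (x - s) = 0" for s
      using N(2)[of "x - s"] that by (auto simp: indicator_def)
    then show ?thesis by (simp only: window_def Bochner_Integration.integral_zero)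
  qed
  then show "test_function (window t \<phi>)"
    by (intro test_functionI[OF s, where a="-N" and b="N+t"]) blast
qed

lemma pair_borel_rep_test_l2:
  assumes "test_function \<phi>" shows "pair g (test_l2 \<phi>) = (LINT x|lborel. borel_rep g x * of_real (\<phi> x))"
proof -
  note [measurable] = test_measurable[OF assms]
  have "pair g (test_l2 \<phi>) = (LINT x|lebesgue. borel_rep g x * of_real (\<phi> x))"
    by (rule pair_cong) (use rep_test_l2[OF assms] borel_rep_AE[of g] in \<open>eventually_elim, simp\<close>)
  also have "\<dots> = (LINT x|lborel. borel_rep g x * of_real (\<phi> x))"
    by (rule integral_completion) measurable
  finally show ?thesis .
qed

lemma pair_avg:
  assumes \<phi>: "test_function \<phi>" and t: "t \<ge> 0"
  shows "pair (avg (\<lambda>_. 0) t g) (test_l2 \<phi>) = pair g (test_l2 (window t \<phi>))"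
proof -
  note [measurable] = test_measurable[OF \<phi>]
  let ?\<phi> = "\<lambda>x. complex_of_real (\<phi> x)"
  note sq = sq_int_test[OF \<phi>] sq_int_borel_rep[of g]
  have i1: "integrable (lborel \<Otimes>\<^sub>M lborel) (\<lambda>(s, x). indicator {0..<t} s *\<^sub>R (borel_rep g (x + 1 * s) * ?\<phi> x))"
    by (intro integrable_convolution sq) measurable
  have i2: "integrable (lborel \<Otimes>\<^sub>M lborel) (\<lambda>(s, x). indicator {0..<t} s *\<^sub>R (?\<phi> (x + (-1) * s) * borel_rep g x))"
    by (intro integrable_convolution sq) measurable
  have m [measurable]: "avg_fun (\<lambda>_. 0) t g \<in> borel_measurable borel"
    unfolding avg_fun_def prim_zero by measurable
  have "pair (avg (\<lambda>_. 0) t g) (test_l2 \<phi>) = (LINT x|lebesgue. avg_fun (\<lambda>_. 0) t g x * ?\<phi> x)"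
    by (rule pair_cong) (use rep_test_l2[OF \<phi>] rep_avg[OF potential_zero t, of g] in \<open>eventually_elim, simp\<close>)
  also have "\<dots> = (LINT x|lborel. avg_fun (\<lambda>_. 0) t g x * ?\<phi> x)"
    by (rule integral_completion) measurable
  also have "\<dots> = (LINT x|lborel. LINT s|lborel. indicator {0..<t} s *\<^sub>R (borel_rep g (x + 1 * s) * ?\<phi> x))"
    unfolding avg_fun_def prim_zero by (simp flip: integral_mult_left_zero)
  also have "\<dots> = (LINT s|lborel. LINT x|lborel. indicator {0..<t} s *\<^sub>R (borel_rep g (x + 1 * s) * ?\<phi> x))"
    by (rule lborel_pair.Fubini_integral[OF i1])
  also have "\<dots> = (LINT s|lborel. LINT x|lborel. indicator {0..<t} s *\<^sub>R (?\<phi> (x + (-1) * s) * borel_rep g x))"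
  proof (rule Bochner_Integration.integral_cong[OF refl])
    fix s :: real
    show "(LINT x|lborel. indicator {0..<t} s *\<^sub>R (borel_rep g (x + 1 * s) * ?\<phi> x))
       = (LINT x|lborel. indicator {0..<t} s *\<^sub>R (?\<phi> (x + (-1) * s) * borel_rep g x))"
      by (subst (2) lborel_integral_real_affine[where c=1 and t=s]) (auto simp: ac_simps)
  qed
  also have "\<dots> = (LINT x|lborel. LINT s|lborel. indicator {0..<t} s *\<^sub>R (?\<phi> (x + (-1) * s) * borel_rep g x))"
    by (rule lborel_pair.Fubini_integral[OF i2, symmetric])
  also have "\<dots> = (LINT x|lborel. borel_rep g x * of_real (window t \<phi> x))"
  proof (rule Bochner_Integration.integral_cong[OF refl])
    fix x
    have "(LINT s|lborel. indicator {0..<t} s *\<^sub>R (?\<phi> (x + (-1) * s) * borel_rep g x))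
      = (LINT s|lborel. of_real (indicator {0..<t} s * \<phi> (x - s)) * borel_rep g x)"
      by (simp add: scaleR_conv_of_real mult.assoc)
    also have "\<dots> = (LINT s|lborel. complex_of_real (indicator {0..<t} s * \<phi> (x - s))) * borel_rep g x"
      by (rule integral_mult_left_zero)
    also have "\<dots> = borel_rep g x * of_real (window t \<phi> x)"
      unfolding window_def by (simp only: integral_complex_of_real mult.commute)
    finally show "(LINT s|lborel. indicator {0..<t} s *\<^sub>R (?\<phi> (x + (-1) * s) * borel_rep g x)) = borel_rep g x * of_real (window t \<phi> x)" .
  qed
  also have "\<dots> = pair g (test_l2 (window t \<phi>))"
    by (rule pair_borel_rep_test_l2[symmetric]) (rule window_test(1)[OF \<phi> t])
  finally show ?thesis .
qed

lemma pair_shift_test_l2: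
  assumes \<phi>: "test_function \<phi>"
  shows "pair (shift t f) (test_l2 \<phi>) = pair f (test_l2 (\<lambda>x. \<phi> (x - t)))"
proof -
  have "pair (shift t f) (test_l2 \<phi>) = (LINT x|lebesgue. rep_l2 f (x + t) * of_real (\<phi> (x + t - t)))"
    by (rule pair_cong) (use rep_test_l2[OF \<phi>] rep_shift[of t f] in \<open>eventually_elim, simp\<close>)
  also have "\<dots> = (LINT x|lebesgue. rep_l2 f x * of_real (\<phi> (x - t)))"
    by (rule integral_translation)
  also have "\<dots> = pair f (test_l2 (\<lambda>x. \<phi> (x - t)))"
    by (rule pair_test_l2) (rule test_translate[OF \<phi>])
  finally show ?thesis .
qed

lemma test_l2_diff:
  assumes "test_function \<phi>" "test_function \<psi>"
  shows "test_l2 (\<lambda>x. \<phi> x - \<psi> x) = test_l2 \<phi> - test_l2 \<psi>"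
  unfolding test_l2_def[of "\<lambda>x. \<phi> x - \<psi> x"]
  by (rule abs_eqI) (use rep_test_l2[OF assms(1)] rep_test_l2[OF assms(2)] rep_minus[of "test_l2 \<phi>" "test_l2 \<psi>"] in \<open>eventually_elim, simp\<close>)

text \<open>The fundamental theorem of calculus for weak derivatives. Tested with \<open>\<phi>\<close>, the increment of \<open>f\<close>
  becomes minus the pairing of \<open>f\<close> with the derivative of \<open>window t \<phi>\<close>; so the weak derivative can be
  inserted, and averaging can be moved back from the test function to \<open>g\<close>.\<close>

lemma weak_deriv_increment:
  assumes fg: "is_weak_deriv f g" and t: "t \<ge> 0"
  shows "shift t f - f = avg (\<lambda>_. 0) t g"
proof -
  have "shift t f - f - avg (\<lambda>_. 0) t g = 0"
  proof (rule fundamental_lemma)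
    fix \<phi> assume \<phi>: "test_function \<phi>"
    have "pair f (test_l2 (\<lambda>x. \<phi> x - \<phi> (x - t))) = - pair g (test_l2 (window t \<phi>))"
      using fg window_test[OF \<phi> t] by (simp add: is_weak_deriv_pair flip: window_test(2)[OF \<phi> t])
    then have "pair f (test_l2 \<phi>) - pair f (test_l2 (\<lambda>x. \<phi> (x - t))) = - pair g (test_l2 (window t \<phi>))"
      unfolding test_l2_diff[OF \<phi> test_translate[OF \<phi>, of t]] pair.diff_right .
    moreover have "b - a - c = 0" if "a - b = - c" for a b c :: complex
    proof -
      have "b - a - c = - (a - b) - c" by simp
      then show ?thesis unfolding that by simp
    qed
    ultimately show "pair (shift t f - f - avg (\<lambda>_. 0) t g) (test_l2 \<phi>) = 0"
      unfolding pair.diff_left pair_avg[OF \<phi> t] pair_shift_test_l2[OF \<phi>] by blast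
  qed
  then show ?thesis by simp
qed

lemma gen_limit_dissipative:
  assumes "gen_limit S f g" and c: "\<And>t. t > 0 \<Longrightarrow> norm (S t f) \<le> norm f"
  shows "f \<bullet> g \<le> 0"
proof (rule tendsto_upperbound)
  show "((\<lambda>t. f \<bullet> ((S t f - f) /\<^sub>R t)) \<longlongrightarrow> f \<bullet> g) (at_right 0)"
    using assms(1) unfolding gen_limit_def by (intro tendsto_intros)
  show "\<forall>\<^sub>F t in at_right 0. f \<bullet> ((S t f - f) /\<^sub>R t) \<le> 0"
    using eventually_at_right_less[of 0]
  proof eventually_elim
    case (elim t)
    have "f \<bullet> S t f \<le> norm f * norm (S t f)" by (rule norm_cauchy_schwarz)
    also have "\<dots> \<le> norm f * norm f" using c[OF elim] by (rule mult_left_mono) simp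
    finally have "f \<bullet> (S t f - f) \<le> 0" by (simp add: inner_diff_right power2_norm_eq_inner flip: power2_eq_square)
    then show ?case using elim by (simp add: mult_nonneg_nonpos)
  qed
qed simp

text \<open>By the increment formula, \<open>g\<close> is the strong limit of the difference quotients of the translations,
  which are contractions.\<close>

lemma weak_deriv_dissipative:
  assumes "is_weak_deriv f g" shows "f \<bullet> g \<le> 0"
proof (rule gen_limit_dissipative[of shift])
  show "gen_limit shift f g"
    unfolding gen_limit_def
  proof (rule Lim_transform_eventually[OF avg_tendsto[OF potential_zero]])
    show "\<forall>\<^sub>F t in at_right 0. avg (\<lambda>_. 0) t g /\<^sub>R t = (shift t f - f) /\<^sub>R t"
      using eventually_at_right_less[of 0] by eventually_elim (simp add: weak_deriv_increment[OF assms])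
  qed
qed (simp add: norm_shift)

section \<open>Weak differentiability on the domain of the generator\<close>

lemma avg_fun_zero_AE:
  assumes "AE x in lebesgue. rep_l2 f x = h x"
  shows "avg_fun (\<lambda>_. 0) t f x = (LINT s|lebesgue. indicator {x..x+t} s *\<^sub>R h s)"
proof -
  have [measurable]: "h \<in> borel_measurable lebesgue" by (rule borel_measurable_AE[OF measurable_rep assms])
  have b: "borel_rep f \<in> borel_measurable lebesgue" by (rule measurable_completion) simp
  have ii: "(\<lambda>s. indicator {x..<x+t} s *\<^sub>R borel_rep f s) \<in> borel_measurable lebesgue"
    by (rule measurable_completion) measurable
  have "avg_fun (\<lambda>_. 0) t f x = (LINT s|lebesgue. indicator {x..<x+t} s *\<^sub>R borel_rep f s)"
    unfolding avg_fun_zero by (rule integral_completion[symmetric]) measurable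
  also have "\<dots> = (LINT s|lebesgue. indicator {x..x+t} s *\<^sub>R h s)"
  proof (rule integral_cong_AE[OF ii])
    show "(\<lambda>s. indicator {x..x+t} s *\<^sub>R h s) \<in> borel_measurable lebesgue"
      by (intro borel_measurable_scaleR borel_measurable_indicator) auto
    have "AE s in lebesgue. s \<noteq> x + t"
      by (rule AE_completion[OF AE_lborel_singleton])
    then show "AE s in lebesgue. indicator {x..<x+t} s *\<^sub>R borel_rep f s = indicator {x..x+t} s *\<^sub>R h s"
      using borel_rep_AE[of f] assms by eventually_elim (auto simp: indicator_def)
  qed
  finally show ?thesis .
qed

text \<open>For test functions the increment formula is the classical fundamental theorem of calculus.\<close>

lemma shift_test_l2_increment:
  assumes \<phi>: "test_function \<phi>" and t: "t \<ge> 0"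
  shows "shift t (test_l2 \<phi>) - test_l2 \<phi> = avg (\<lambda>_. 0) t (test_l2 (deriv \<phi>))"
proof (rule l2_eqI)
  note d = test_deriv[OF \<phi>]
  note [measurable] = test_measurable[OF d]
  have eq: "avg_fun (\<lambda>_. 0) t (test_l2 (deriv \<phi>)) x = of_real (\<phi> (x + t) - \<phi> x)" for x
  proof -
    have "avg_fun (\<lambda>_. 0) t (test_l2 (deriv \<phi>)) x = (LINT s|lebesgue. complex_of_real (deriv \<phi> s * indicator {x..x+t} s))"
      unfolding avg_fun_zero_AE[OF rep_test_l2[OF d]] by (simp add: scaleR_conv_of_real mult.commute)
    also have "\<dots> = of_real (LINT s|lborel. deriv \<phi> s * indicator {x..x+t} s)"
    proof -
      have "(LINT s|lebesgue. deriv \<phi> s * indicator {x..x+t} s) = (LINT s|lborel. deriv \<phi> s * indicator {x..x+t} s)"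
        by (rule integral_completion) measurable
      then show ?thesis by (simp only: integral_complex_of_real)
    qed
    also have "(LINT s|lborel. deriv \<phi> s * indicator {x..x+t} s) = \<phi> (x + t) - \<phi> x"
      by (rule integral_FTC_Icc_real) (use t test_DERIV[OF \<phi>] DERIV_isCont[OF test_DERIV[OF d]] in auto)
    finally show ?thesis .
  qed
  show "AE x in lebesgue. rep_l2 (shift t (test_l2 \<phi>) - test_l2 \<phi>) x = rep_l2 (avg (\<lambda>_. 0) t (test_l2 (deriv \<phi>))) x"
    using rep_minus[of "shift t (test_l2 \<phi>)" "test_l2 \<phi>"] rep_shift[of t "test_l2 \<phi>"] rep_test_l2[OF \<phi>]
      AE_translation[OF rep_test_l2[OF \<phi>], of t] rep_avg[OF potential_zero t, of "test_l2 (deriv \<phi>)"]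
    by eventually_elim (simp add: eq)
qed

lemma pair_shift_shift: "pair (shift t u) (shift t v) = pair u v"
proof -
  have "pair (shift t u) (shift t v) = (LINT x|lebesgue. rep_l2 u (x + t) * rep_l2 v (x + t))"
    by (rule pair_cong) (use rep_shift[of t u] rep_shift[of t v] in \<open>eventually_elim, simp\<close>)
  also have "\<dots> = pair u v"
    unfolding pair_def by (rule integral_translation[of "\<lambda>x. rep_l2 u x * rep_l2 v x"])
  finally show ?thesis .
qed

text \<open>Multiplication by a test function localises the potential, which need not be square integrable.\<close>

definition test_mult :: "(real \<Rightarrow> real) \<Rightarrow> l2 \<Rightarrow> l2" where
  "test_mult \<phi> f = abs_l2 (\<lambda>x. of_real (\<phi> x) * rep_l2 f x)"

lemma rep_test_mult:
  assumes \<phi>: "test_function \<phi>" shows "AE x in lebesgue. rep_l2 (test_mult \<phi> f) x = of_real (\<phi> x) * rep_l2 f x"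
proof -
  obtain B where B: "\<And>x. \<bar>\<phi> x\<bar> \<le> B" using test_bounded[OF \<phi>] by blast
  have [measurable]: "\<phi> \<in> borel_measurable lebesgue"
    by (rule measurable_completion) (use test_measurable[OF \<phi>] in simp)
  show ?thesis unfolding test_mult_def
  proof (rule rep_abs, rule sq_int_dominated[OF _ sq_int_rep[of f], where c=B])
    show "AE x in lebesgue. cmod (of_real (\<phi> x) * rep_l2 f x) \<le> B * cmod (rep_l2 f x)"
      using B by (auto simp: norm_mult intro!: mult_right_mono)
  qed measurable
qed

lemma bounded_linear_test_mult:
  assumes \<phi>: "test_function \<phi>" shows "bounded_linear (test_mult \<phi>)"
proof -
  obtain B where B: "\<And>x. \<bar>\<phi> x\<bar> \<le> B" "B \<ge> 0" using test_bounded[OF \<phi>] by blast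
  note r = rep_test_mult[OF \<phi>]
  show ?thesis
  proof (rule bounded_linear_intro)
    show "test_mult \<phi> (f + g) = test_mult \<phi> f + test_mult \<phi> g" for f g
      by (rule l2_eqI)
        (use r[of f] r[of g] r[of "f+g"] rep_plus[of f g] rep_plus[of "test_mult \<phi> f" "test_mult \<phi> g"] in
          \<open>eventually_elim, simp add: distrib_left\<close>)
    show "test_mult \<phi> (a *\<^sub>R f) = a *\<^sub>R test_mult \<phi> f" for a f
      by (rule l2_eqI)
        (use r[of f] r[of "a *\<^sub>R f"] rep_scaleR[of a f] rep_scaleR[of a "test_mult \<phi> f"] in
          \<open>eventually_elim, simp\<close>)
    have "norm (test_mult \<phi> f) \<le> B * norm f" for f
    proof (rule norm_l2_mono[OF _ B(2)])
      show "AE x in lebesgue. cmod (rep_l2 (test_mult \<phi> f) x) \<le> B * cmod (rep_l2 f x)"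
        using r[of f] by eventually_elim (use B in \<open>auto simp: norm_mult intro!: mult_right_mono\<close>)
    qed
    then show "norm (test_mult \<phi> f) \<le> norm f * B" for f by (simp add: mult.commute)
  qed
qed

text \<open>The upper bound is \<open>exp (- a) \<le> 1 / (1 + a) \<le> 1 - a + a\<^sup>2\<close>, where the last step is \<open>1 + a\<^sup>3 \<ge> 1\<close>.\<close>

lemma exp_minus_estimate: "0 \<le> a \<Longrightarrow> \<bar>exp (- a) - 1 + a\<bar> \<le> (a::real)\<^sup>2"
proof -
  assume a: "0 \<le> a"
  have "1 - a \<le> exp (- a)" using exp_ge_add_one_self[of "-a"] by simp
  moreover have "exp (- a) \<le> 1 - a + a\<^sup>2"
  proof -
    have "exp (- a) * (1 + a) \<le> exp (- a) * exp a"
      by (intro mult_left_mono exp_ge_add_one_self) simp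
    also have "\<dots> = 1" by (simp flip: exp_add)
    also have "1 \<le> (1 - a + a\<^sup>2) * (1 + a)"
      using a by (simp add: power2_eq_square algebra_simps)
    finally show ?thesis using a by (simp add: mult_le_cancel_right)
  qed
  ultimately show ?thesis by simp
qed

lemma prim_lipschitz:
  assumes W: "potential W" and M: "AE x in lebesgue. x \<in> {a..b} \<longrightarrow> \<bar>W x\<bar> \<le> M"
    and x: "a \<le> x" "x \<le> y" "y \<le> b"
  shows "prim W y - prim W x \<le> M * (y - x)"
proof -
  have "prim W y - prim W x = (LINT s:{x..y}|lebesgue. W s)" using prim_diff[OF W x(2)] by simp
  also have "\<dots> \<le> (LINT s:{x..y}|lebesgue. M)"
    unfolding set_lebesgue_integral_def
  proof (rule integral_mono_AE)
    show "integrable lebesgue (\<lambda>s. indicator {x..y} s *\<^sub>R W s)"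
      using potential_set_integrable[OF W, of x y] by (simp add: set_integrable_def)
    show "integrable lebesgue (\<lambda>s. indicator {x..y} s *\<^sub>R M)"
      using absolutely_integrable_on_const[of "{x..y}" M] by (simp add: set_integrable_def)
    show "AE s in lebesgue. indicator {x..y} s *\<^sub>R W s \<le> indicator {x..y} s *\<^sub>R M"
      using M by eventually_elim (use x in \<open>auto simp: indicator_def\<close>)
  qed
  also have "\<dots> = M * (y - x)" using x by (simp add: set_lebesgue_integral_def mult.commute)
  finally show ?thesis .
qed

lemma rep_mult_op: "u \<in> mult_dom W \<Longrightarrow> AE x in lebesgue. rep_l2 (mult_op W u) x = of_real (W x) * rep_l2 u x"
  unfolding mult_op_def mult_dom_def by (rule rep_abs) simp

text \<open>The derivative of the weight \<open>exp (E x - E (x + t))\<close> at \<open>t = 0\<close> is \<open>- W x\<close>. As \<open>W\<close> is only locally bounded,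
  this is not a pointwise statement everywhere, but it holds in the mean after multiplication with a
  test function: to first order the weight is \<open>1\<close> minus an integral of \<open>W\<close> over \<open>[x, x + t]\<close>, and averages
  converge in the mean; the quadratic remainder is uniform because \<open>E\<close> is Lipschitz on compact sets.\<close>

lemma multiplier_derivative:
  assumes W: "potential W" and \<phi>: "test_function \<phi>"
  obtains h Q where
    "AE x in lebesgue. rep_l2 h x = of_real (W x * \<phi> x)"
    "\<And>t. t \<ge> 0 \<Longrightarrow> AE x in lebesgue. rep_l2 (Q t) x = of_real ((exp (prim W x - prim W (x + t)) - 1) * \<phi> x)"
    "((\<lambda>t. Q t /\<^sub>R t) \<longlongrightarrow> - h) (at_right 0)"
proof -
  obtain N where N: "N > 0" "\<And>x. \<bar>x\<bar> > N \<Longrightarrow> \<phi> x = 0" using test_support[OF \<phi>] by blast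
  obtain M where M: "M \<ge> 0" "AE x in lebesgue. x \<in> {-N..N+1} \<longrightarrow> \<bar>W x\<bar> \<le> M"
    using potential_bounded[OF W, of "{-N..N+1}"] by auto
  have Wm [measurable]: "W \<in> borel_measurable lebesgue" by (rule potential_measurable[OF W])
  have [measurable]: "\<phi> \<in> borel_measurable lebesgue"
    by (rule measurable_completion) (use test_measurable[OF \<phi>] in simp)
  \<comment> \<open>The extra unit length keeps \<open>x + t\<close> inside for \<open>\<bar>x\<bar> \<le> N\<close> and \<open>t \<le> 1\<close>.\<close>
  let ?h = "\<lambda>x. complex_of_real (indicator {-N..N+1} x * W x)"
  define h where "h = abs_l2 ?h"
  have h: "AE x in lebesgue. rep_l2 h x = ?h x"
    unfolding h_def
  proof (rule rep_abs, rule sq_int_dominated[where c=M and g="indicator {-N..N+1}"])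
    show "sq_int (indicator {-N..N+1})" by (intro sq_int_indicator) simp
    show "AE x in lebesgue. cmod (?h x) \<le> M * cmod (indicator {-N..N+1} x)"
      using M(2) by eventually_elim (auto simp: indicator_def)
    have "(\<lambda>x. indicator {-N..N+1} x * W x) \<in> borel_measurable lebesgue"
      by (intro borel_measurable_times borel_measurable_indicator Wm) auto
    then show "?h \<in> borel_measurable lebesgue" by measurable
  qed
  define Q where "Q t = abs_l2 (\<lambda>x. of_real ((exp (prim W x - prim W (x + t)) - 1) * \<phi> x))" for t
  note [measurable] = prim_lebesgue[OF W]
  have Q: "AE x in lebesgue. rep_l2 (Q t) x = of_real ((exp (prim W x - prim W (x + t)) - 1) * \<phi> x)" if t: "t \<ge> 0" for t
    unfolding Q_def
  proof (rule rep_abs, rule sq_int_dominated[OF _ sq_int_test[OF \<phi>], where c=1])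
    have [measurable]: "(\<lambda>x. prim W (x + t)) \<in> borel_measurable lebesgue"
      by (rule measurable_compose[OF translation_measurable], measurable)
    show "(\<lambda>x. complex_of_real ((exp (prim W x - prim W (x + t)) - 1) * \<phi> x)) \<in> borel_measurable lebesgue"
      by measurable
    have "\<bar>exp (prim W x - prim W (x + t)) - 1\<bar> \<le> 1" for x
      using prim_mono[OF W, of x "x+t"] t by (simp add: abs_if)
    then show "AE x in lebesgue. cmod (complex_of_real ((exp (prim W x - prim W (x + t)) - 1) * \<phi> x)) \<le> 1 * cmod (of_real (\<phi> x))"
      by (auto simp: norm_mult abs_mult intro!: mult_left_le_one_le simp del: of_real_mult of_real_diff)
  qed
  have av: "avg_fun (\<lambda>_. 0) t h x = of_real (prim W (x + t) - prim W x)" if "x \<in> {-N..N}" "0 \<le> t" "t \<le> 1" for t x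
  proof -
    have "avg_fun (\<lambda>_. 0) t h x = (LINT s|lebesgue. indicator {x..x+t} s *\<^sub>R ?h s)"
      by (rule avg_fun_zero_AE[OF h])
    also have "\<dots> = (LINT s|lebesgue. complex_of_real (indicator {x..x+t} s *\<^sub>R W s))"
      by (intro Bochner_Integration.integral_cong) (use that in \<open>auto simp: indicator_def\<close>)
    also have "\<dots> = of_real (LINT s:{x..x+t}|lebesgue. W s)"
      by (simp add: set_lebesgue_integral_def integral_complex_of_real del: of_real_mult)
    finally show ?thesis using prim_diff[OF W, of x "x+t"] that by simp
  qed
  have bound: "norm (Q t + test_mult \<phi> (avg (\<lambda>_. 0) t h)) \<le> (M * t)\<^sup>2 * norm (test_l2 \<phi>)" if t: "0 < t" "t \<le> 1" for t
  proof (rule norm_l2_mono)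
    show "AE x in lebesgue. cmod (rep_l2 (Q t + test_mult \<phi> (avg (\<lambda>_. 0) t h)) x) \<le> (M * t)\<^sup>2 * cmod (rep_l2 (test_l2 \<phi>) x)"
      using Q[OF less_imp_le[OF t(1)]] rep_test_mult[OF \<phi>, of "avg (\<lambda>_. 0) t h"] rep_plus[of "Q t" "test_mult \<phi> (avg (\<lambda>_. 0) t h)"]
        rep_avg[OF potential_zero less_imp_le[OF t(1)], of h] rep_test_l2[OF \<phi>]
    proof eventually_elim
      case (elim x)
      show ?case
      proof (cases "x \<in> {-N..N}")
        case True
        define a where "a = prim W (x + t) - prim W x"
        have a: "0 \<le> a" "a \<le> M * t"
          using prim_mono[OF W, of x "x+t"] prim_lipschitz[OF W M(2), of x "x+t"] True t by (auto simp: a_def)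
        have "rep_l2 (Q t + test_mult \<phi> (avg (\<lambda>_. 0) t h)) x = of_real ((exp (- a) - 1 + a) * \<phi> x)"
          using elim av[OF True] t by (simp add: a_def algebra_simps)
        moreover have "\<bar>exp (- a) - 1 + a\<bar> \<le> (M * t)\<^sup>2"
          using exp_minus_estimate[OF a(1)] power_mono[OF a(2,1), of 2] by linarith
        ultimately show ?thesis
          using elim(5) by (simp add: norm_mult abs_mult mult_right_mono del: of_real_mult of_real_diff of_real_add)
      next
        case False
        then have "\<phi> x = 0" using N(2)[of x] by (auto simp: not_le abs_if split: if_splits)
        then show ?thesis using elim by simp
      qed
    qed
  qed simp
  have "((\<lambda>t. (Q t + test_mult \<phi> (avg (\<lambda>_. 0) t h)) /\<^sub>R t) \<longlongrightarrow> 0) (at_right 0)"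
  proof (rule Lim_null_comparison)
    show "((\<lambda>t::real. M\<^sup>2 * t * norm (test_l2 \<phi>)) \<longlongrightarrow> 0) (at_right 0)"
      by (intro tendsto_eq_intros) auto
    have "\<forall>\<^sub>F t in at_right 0. t \<in> {0<..<1::real}" by (rule eventually_at_right_real) simp
    then show "\<forall>\<^sub>F t in at_right 0. norm ((Q t + test_mult \<phi> (avg (\<lambda>_. 0) t h)) /\<^sub>R t) \<le> M\<^sup>2 * t * norm (test_l2 \<phi>)"
    proof eventually_elim
      case (elim t)
      then have "norm (Q t + test_mult \<phi> (avg (\<lambda>_. 0) t h)) / t \<le> (M * t)\<^sup>2 * norm (test_l2 \<phi>) / t"
        using bound[of t] by (intro divide_right_mono) auto
      also have "\<dots> = M\<^sup>2 * t * norm (test_l2 \<phi>)" using elim by (simp add: power2_eq_square)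
      finally show ?case using elim by (simp only: norm_scaleR) (simp add: field_simps)
    qed
  qed
  moreover have "((\<lambda>t. test_mult \<phi> (avg (\<lambda>_. 0) t h /\<^sub>R t)) \<longlongrightarrow> test_mult \<phi> h) (at_right 0)"
    by (rule bounded_linear.tendsto[OF bounded_linear_test_mult[OF \<phi>] avg_tendsto[OF potential_zero]])
  ultimately have "((\<lambda>t. (Q t + test_mult \<phi> (avg (\<lambda>_. 0) t h)) /\<^sub>R t - test_mult \<phi> (avg (\<lambda>_. 0) t h /\<^sub>R t)) \<longlongrightarrow> 0 - test_mult \<phi> h) (at_right 0)"
    by (rule tendsto_diff)
  then have "((\<lambda>t. Q t /\<^sub>R t) \<longlongrightarrow> - test_mult \<phi> h) (at_right 0)"
    by (simp add: linear_scale[OF bounded_linear.linear[OF bounded_linear_test_mult[OF \<phi>]]] scaleR_add_right)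
  moreover have "AE x in lebesgue. rep_l2 (test_mult \<phi> h) x = of_real (W x * \<phi> x)"
    using rep_test_mult[OF \<phi>, of h] h
  proof eventually_elim
    case (elim x)
    have "N < \<bar>x\<bar>" if "x \<notin> {-N..N+1}" using that by auto
    then show ?case using elim N(2)[of x] by (cases "x \<in> {-N..N+1}") auto
  qed
  ultimately show ?thesis using Q that by blast
qed

text \<open>Tested against \<open>\<phi>\<close>, the difference quotient of \<open>S\<^sub>t u\<close> splits into the increment of the weight, which
  yields \<open>- W u\<close>, and a translation, which is moved to \<open>\<phi>\<close> and yields \<open>- \<phi>'\<close>.\<close>

lemma gen_limit_weak_deriv:
  assumes W: "potential W" and u: "gen_limit (evol W) u g" and d: "u \<in> mult_dom W"
  shows "is_weak_deriv u (g + mult_op W u)"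
  unfolding is_weak_deriv_pair
proof (intro allI impI)
  fix \<phi> assume \<phi>: "test_function \<phi>"
  obtain h Q where h: "AE x in lebesgue. rep_l2 h x = of_real (W x * \<phi> x)"
    and Q: "\<And>t. t \<ge> 0 \<Longrightarrow> AE x in lebesgue. rep_l2 (Q t) x = of_real ((exp (prim W x - prim W (x + t)) - 1) * \<phi> x)"
    and lim: "((\<lambda>t. Q t /\<^sub>R t) \<longlongrightarrow> - h) (at_right 0)"
    using multiplier_derivative[OF W \<phi>] by blast
  let ?A = "\<lambda>t. avg (\<lambda>_. 0) t (test_l2 (deriv \<phi>))"
  have eq: "pair ((evol W t u - u) /\<^sub>R t) (test_l2 \<phi>) = pair (shift t u) (Q t /\<^sub>R t) - pair (shift t u) (?A t /\<^sub>R t)"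
    if t: "t > 0" for t
  proof -
    have t0: "t \<ge> 0" using t by simp
    have "pair (evol W t u) (test_l2 \<phi>) = pair (shift t u) (Q t + test_l2 \<phi>)"
      unfolding pair_def[of "shift t u" "Q t + test_l2 \<phi>"]
    proof (rule pair_cong)
      show "AE x in lebesgue. rep_l2 (evol W t u) x * rep_l2 (test_l2 \<phi>) x = rep_l2 (shift t u) x * rep_l2 (Q t + test_l2 \<phi>) x"
        using rep_evol_shift[OF W t0, of u] rep_test_l2[OF \<phi>] Q[OF t0] rep_plus[of "Q t" "test_l2 \<phi>"]
        by eventually_elim (simp add: algebra_simps)
    qed
    moreover have "pair u (test_l2 \<phi>) = pair (shift t u) (?A t + test_l2 \<phi>)"
      using shift_test_l2_increment[OF \<phi> t0] pair_shift_shift[of t u "test_l2 \<phi>"] by (simp add: diff_eq_eq)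
    ultimately show ?thesis
      by (simp add: pair.scaleR_left pair.scaleR_right pair.diff_left pair.add_right flip: scaleR_right_diff_distrib)
  qed
  have "((\<lambda>t. pair (shift t u) (Q t /\<^sub>R t) - pair (shift t u) (?A t /\<^sub>R t)) \<longlongrightarrow> pair u (- h) - pair u (test_l2 (deriv \<phi>))) (at_right 0)"
    by (intro tendsto_diff pair.tendsto shift_tendsto lim avg_tendsto potential_zero)
  moreover have "((\<lambda>t. pair ((evol W t u - u) /\<^sub>R t) (test_l2 \<phi>)) \<longlongrightarrow> pair g (test_l2 \<phi>)) (at_right 0)"
    using u unfolding gen_limit_def by (intro pair.tendsto tendsto_const)
  then have "((\<lambda>t. pair (shift t u) (Q t /\<^sub>R t) - pair (shift t u) (?A t /\<^sub>R t)) \<longlongrightarrow> pair g (test_l2 \<phi>)) (at_right 0)"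
  proof (rule Lim_transform_eventually)
    show "\<forall>\<^sub>F t in at_right 0. pair ((evol W t u - u) /\<^sub>R t) (test_l2 \<phi>) = pair (shift t u) (Q t /\<^sub>R t) - pair (shift t u) (?A t /\<^sub>R t)"
      using eventually_at_right_less[of 0] by eventually_elim (rule eq)
  qed
  ultimately have "pair u (- h) - pair u (test_l2 (deriv \<phi>)) = pair g (test_l2 \<phi>)"
    by (rule tendsto_unique[rotated]) simp
  moreover have "pair u h = pair (mult_op W u) (test_l2 \<phi>)"
    unfolding pair_def[of "mult_op W u" "test_l2 \<phi>"]
    by (rule pair_cong) (use rep_mult_op[OF d] rep_test_l2[OF \<phi>] h in \<open>eventually_elim, simp\<close>)
  moreover have "b = - (c + a)" if "- a - b = c" for a b c :: complex
    unfolding that[symmetric] by simp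
  ultimately show "pair u (test_l2 (deriv \<phi>)) = - pair (g + mult_op W u) (test_l2 \<phi>)"
    unfolding pair.add_left pair.minus_right by metis
qed

section \<open>Consequences of the growth assumptions\<close>

lemma assumption_W_potential: "assumption_W W \<Longrightarrow> potential W"
  by (simp add: assumption_W_def potential_def)

text \<open>With \<open>D = W'(x)\<close>, \<open>w = W(x)\<close> and \<open>p = x\<^sup>\<nu>\<close>: the decay assumption makes \<open>p\<close> small compared with \<open>sqrt D\<close>; inserting this into the bound on \<open>D\<close>
  cancels one root of \<open>D\<close> and leaves \<open>sqrt D \<le> w / 2\<close>.\<close>

lemma derivative_quadratic_bound:
  fixes D w p C :: real
  assumes D: "D > 0" and w: "w > 0" and C: "C > 0" and b: "D \<le> C * w * p" and u: "p * D powr (-1/2) < 1 / (2 * C)"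
  shows "D \<le> w\<^sup>2 / 2"
proof -
  have "p < sqrt D / (2 * C)"
  proof -
    have "D powr (-(1/2)) = inverse (D powr (1/2))" by (rule powr_minus)
    also have "\<dots> = inverse (sqrt D)" using D by (subst powr_half_sqrt) auto
    finally have e: "D powr (-1/2) = inverse (sqrt D)" by simp
    have s: "sqrt D > 0" using D by simp
    have "p = (p * inverse (sqrt D)) * sqrt D" using s by simp
    also have "\<dots> < (1 / (2 * C)) * sqrt D" using u s unfolding e by (rule mult_strict_right_mono)
    finally show ?thesis by simp
  qed
  then have "C * w * p \<le> C * w * (sqrt D / (2 * C))"
    using C w by (intro mult_left_mono) auto
  also have "C * w * (sqrt D / (2 * C)) = (w / 2) * sqrt D" using C by simp
  finally have "sqrt D * sqrt D \<le> (w / 2) * sqrt D" using b D by simp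
  then have "sqrt D \<le> w / 2" using D by (subst (asm) mult_le_cancel_right) auto
  then have "(sqrt D)\<^sup>2 \<le> (w / 2)\<^sup>2" using D by (intro power_mono) auto
  then have "D \<le> w\<^sup>2 / 4" using D by (simp add: power_divide)
  moreover have "w\<^sup>2 \<ge> 0" by simp
  ultimately show ?thesis by linarith
qed

lemma assumption_W_tame:
  assumes W: "assumption_W W" shows "\<exists>r R. tame_potential W r R"
proof -
  from W obtain x0 \<nu> C where x0: "x0 > 0" and C2: "C2_on (- {-x0..x0}) W" and pos: "\<And>x. x > x0 \<Longrightarrow> deriv W x > 0"
    and C: "C > 0" and d: "\<And>x. x > x0 \<Longrightarrow> deriv W x \<le> C * W x * x powr \<nu>"
    and lim: "((\<lambda>x. \<bar>x\<bar> powr \<nu> * \<bar>deriv W x\<bar> powr (-1/2)) \<longlongrightarrow> 0) at_infinity"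
    and ev: "\<And>x. W (- x) = W x" and top: "filterlim W at_top at_top"
    unfolding assumption_W_def by blast
  have DW: "(W has_real_derivative deriv W x) (at x)" if "x0 < \<bar>x\<bar>" for x
  proof -
    have "x \<in> - {-x0..x0}" using that by auto
    then show ?thesis using C2 DERIV_deriv_iff_real_differentiable by (auto simp: C2_on_def)
  qed
  have "\<forall>\<^sub>F x in at_infinity. \<bar>x\<bar> powr \<nu> * \<bar>deriv W x\<bar> powr (-1/2) < 1 / (2 * C)"
    by (rule order_tendstoD(2)[OF lim]) (use C in simp)
  then obtain b where b: "\<And>x. b \<le> norm x \<Longrightarrow> \<bar>x\<bar> powr \<nu> * \<bar>deriv W x\<bar> powr (-1/2) < 1 / (2 * C)"
    by (auto simp: eventually_at_infinity)
  have "\<forall>\<^sub>F x in at_top. 1 \<le> W x" using top by (simp add: filterlim_at_top)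
  then obtain c where c: "\<And>x. c \<le> x \<Longrightarrow> 1 \<le> W x" by (auto simp: eventually_at_top_linorder)
  \<comment> \<open>Beyond \<open>b\<close> the decay assumption is effective, beyond \<open>c\<close> the potential is positive.\<close>
  define R where "R = max (x0 + 1) (max b c)"
  have R: "x0 < R" "b \<le> R" "c \<le> R" by (auto simp: R_def)
  have right: "deriv W x > 0" "deriv W x \<le> (W x)\<^sup>2 / 2" if x: "R \<le> x" for x
  proof -
    show p: "deriv W x > 0" using pos x R by auto
    show "deriv W x \<le> (W x)\<^sup>2 / 2"
    proof (rule derivative_quadratic_bound[OF p _ C])
      show "W x > 0" using c[of x] x R by simp
      show "deriv W x \<le> C * W x * x powr \<nu>" using d x R by simp
      show "x powr \<nu> * deriv W x powr (-1/2) < 1 / (2 * C)" using b[of x] x R x0 p by simp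
    qed
  qed
  have absW: "W \<bar>x\<bar> = W x" for x using ev[of x] by (simp add: abs_if)
  have "tame_potential W x0 R"
  proof
    show "potential W" by (rule assumption_W_potential[OF W])
    show "x0 < R" "0 \<le> x0" using R x0 by auto
    show "continuous_on {x. x0 < \<bar>x\<bar>} W"
      by (rule continuous_at_imp_continuous_on) (use DERIV_isCont[OF DW] in auto)
    show "0 \<le> W x" if "R \<le> \<bar>x\<bar>" for x
      using c[of "\<bar>x\<bar>"] that R(3) by (simp add: absW)
    show "\<exists>D. (W has_real_derivative D) (at x) \<and> \<bar>D\<bar> \<le> (W x)\<^sup>2 / 2" if x: "R \<le> \<bar>x\<bar>" for x
    proof (cases "0 \<le> x")
      case True
      then show ?thesis using x DW[of x] right[of x] R by (intro exI[of _ "deriv W x"]) auto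
    next
      case False
      have "((\<lambda>x. W (- x)) has_real_derivative deriv W (- x) * (- 1)) (at x)"
        by (rule DERIV_chain2[OF DW]) (use x R in \<open>auto intro!: derivative_eq_intros\<close>)
      then have "(W has_real_derivative - deriv W (- x)) (at x)" by (simp add: ev)
      then show ?thesis using x right[of "-x"] False ev[of x] by (intro exI[of _ "- deriv W (- x)"]) auto
    qed
  qed
  then show ?thesis by blast
qed

section \<open>The generator\<close>

lemma gen_limit_diff: "\<lbrakk>gen_limit S f g; gen_limit S f' g'; \<And>t. t > 0 \<Longrightarrow> S t (f - f') = S t f - S t f'\<rbrakk>
  \<Longrightarrow> gen_limit S (f - f') (g - g')"
proof -
  assume a: "gen_limit S f g" "gen_limit S f' g'" "\<And>t. t > 0 \<Longrightarrow> S t (f - f') = S t f - S t f'"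
  have "((\<lambda>t. (S t f - f) /\<^sub>R t - (S t f' - f') /\<^sub>R t) \<longlongrightarrow> g - g') (at_right 0)"
    using a(1,2) unfolding gen_limit_def by (rule tendsto_diff)
  then show ?thesis unfolding gen_limit_def
  proof (rule Lim_transform_eventually)
    show "\<forall>\<^sub>F t in at_right 0. (S t f - f) /\<^sub>R t - (S t f' - f') /\<^sub>R t = (S t (f - f') - (f - f')) /\<^sub>R t"
      using eventually_at_right_less[of 0]
      by eventually_elim (simp add: a(3) algebra_simps)
  qed
qed

lemma mult_dom_diff:
  assumes "u \<in> mult_dom W" "v \<in> mult_dom W"
  shows "u - v \<in> mult_dom W" "mult_op W (u - v) = mult_op W u - mult_op W v"
proof -
  have s: "sq_int (rep_l2 (mult_op W u - mult_op W v))" by (rule sq_int_rep)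
  have e: "AE x in lebesgue. rep_l2 (mult_op W u - mult_op W v) x = of_real (W x) * rep_l2 (u - v) x"
    using rep_minus[of "mult_op W u" "mult_op W v"] rep_minus[of u v] rep_mult_op[OF assms(1)] rep_mult_op[OF assms(2)]
    by eventually_elim (simp add: right_diff_distrib)
  show d: "u - v \<in> mult_dom W"
    unfolding mult_dom_def mem_Collect_eq by (rule sq_int_cong[OF s e])
  show "mult_op W (u - v) = mult_op W u - mult_op W v"
    by (rule l2_eqI) (use e rep_mult_op[OF d] in \<open>eventually_elim, simp\<close>)
qed

lemma mult_op_nonneg:
  assumes "potential W" "u \<in> mult_dom W" shows "0 \<le> u \<bullet> mult_op W u"
proof -
  have "AE x in lebesgue. 0 \<le> rep_l2 u x \<bullet> rep_l2 (mult_op W u) x"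
    using rep_mult_op[OF assms(2)] assms(1) unfolding potential_def
    by (auto elim!: eventually_elim2 simp flip: scaleR_conv_of_real)
  then show ?thesis unfolding inner_l2_rep by (rule integral_nonneg_AE)
qed

text \<open>For \<open>f\<close> in either domain put \<open>h = f + A f\<close>, respectively \<open>h = f - B f\<close>. The difference \<open>v = R h - f\<close> is then
  a solution of \<open>v + A v = 0\<close>, respectively \<open>v = B v\<close>, and dissipativity forces \<open>v = 0\<close>, that is, \<open>f = R h\<close>.\<close>

lemma airy_generates:
  assumes "tame_potential W r R"
  shows "generates (airy_dom W) (\<lambda>f. - airy W f) (evol W)"
proof -
  interpret tame_potential W r R by fact
  let ?S = "evol W" and ?R = "resolvent (\<lambda>x. W x + 1)"
  have resolv: "gen_limit ?S (?R h) (?R h - h)" "is_weak_deriv (?R h) (?R h - h + mult_op W (?R h))"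
    "?R h \<in> airy_dom W" for h
  proof -
    show l: "gen_limit ?S (?R h) (?R h - h)" by (rule gen_limit_resolvent[OF pot])
    show w: "is_weak_deriv (?R h) (?R h - h + mult_op W (?R h))"
      by (rule gen_limit_weak_deriv[OF pot l resolvent_in_mult_dom])
    show "?R h \<in> airy_dom W"
      using w resolvent_in_mult_dom by (auto simp: airy_dom_def W12_def)
  qed
  have dom: "gen_limit ?S f (- airy W f)" if f: "f \<in> airy_dom W" for f
  proof -
    obtain g where g: "is_weak_deriv f g" using f by (auto simp: airy_dom_def W12_def)
    have fm: "f \<in> mult_dom W" using f by (simp add: airy_dom_def)
    have air: "airy W f = - g + mult_op W f" by (simp add: airy_def weak_deriv_eq[OF g])
    define h where "h = f + airy W f"
    define v where "v = ?R h - f"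
    have vm: "v \<in> mult_dom W" "mult_op W v = mult_op W (?R h) - mult_op W f"
      unfolding v_def by (rule mult_dom_diff[OF resolvent_in_mult_dom fm])+
    have "is_weak_deriv v (?R h - h + mult_op W (?R h) - g)"
      unfolding v_def by (rule is_weak_deriv_diff[OF resolv(2) g])
    also have "?R h - h + mult_op W (?R h) - g = v + mult_op W v"
      unfolding vm(2) by (simp add: v_def h_def air)
    finally have "v \<bullet> (v + mult_op W v) \<le> 0" by (rule weak_deriv_dissipative)
    then have "v \<bullet> v \<le> 0" using mult_op_nonneg[OF pot vm(1)] by (simp add: inner_add_right)
    then have "v = 0" using inner_gt_zero_iff[of v] by (meson not_less)
    then have "?R h = f" by (simp add: v_def)
    then show ?thesis using resolv(1)[of h] by (simp add: h_def)
  qed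
  have "f \<in> airy_dom W" if f: "gen_limit ?S f g" for f g
  proof -
    define v where "v = ?R (f - g) - f"
    have "gen_limit ?S v (?R (f - g) - (f - g) - g)"
      unfolding v_def
    proof (rule gen_limit_diff[OF resolv(1) f])
      fix t :: real assume "t > 0"
      then show "evol W t (?R (f - g) - f) = evol W t (?R (f - g)) - evol W t f"
        by (intro evol_linear[OF pot]) simp
    qed
    then have "gen_limit ?S v v" by (simp add: v_def)
    then have "v \<bullet> v \<le> 0"
      by (rule gen_limit_dissipative) (simp add: norm_evol[OF pot])
    then have "v = 0" using inner_gt_zero_iff[of v] by (meson not_less)
    then show ?thesis using resolv(3)[of "f - g"] by (simp add: v_def)
  qed
  then have "generator_dom ?S = airy_dom W"
    using dom unfolding generator_dom_def gen_limit_def by blast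
  moreover have "generator ?S f = - airy W f" if "f \<in> airy_dom W" for f
    using dom[OF that] unfolding generator_def gen_limit_def by (intro tendsto_Lim) simp
  ultimately show ?thesis by (simp add: generates_def)
qed

section \<open>The operator norm\<close>

lemma set_integral_reflect:
  fixes f :: "real \<Rightarrow> real"
  shows "(LINT s:{c-b..c-a}|lebesgue. f s) = (LINT s:{a..b}|lebesgue. f (c - s))"
proof -
  have "(LINT s:{c-b..c-a}|lebesgue. f s) = (LINT s|lebesgue. indicator {c-b..c-a} (c + (-1) * s) *\<^sub>R f (c + (-1) * s))"
    unfolding set_lebesgue_integral_def by (subst lebesgue_integral_real_affine[of "-1" _ c]) simp_all
  also have "\<dots> = (LINT s:{a..b}|lebesgue. f (c - s))"
    unfolding set_lebesgue_integral_def by (intro Bochner_Integration.integral_cong) (auto simp: indicator_def)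
  finally show ?thesis .
qed

lemma prim_odd:
  assumes "potential W" "\<And>x. W (- x) = W x" shows "prim W (- x) = - prim W x"
proof -
  have "(LINT s:{-y..0}|lebesgue. W s) = (LINT s:{0..y}|lebesgue. W s)" for y
    using set_integral_reflect[of 0 y 0 W] assms(2) by simp
  note refl = this
  have zero: "(LINT s:{0..0}|lebesgue. W s) = 0" using prim_diff[OF assms(1), of 0 0] by simp
  consider "x < 0" | "x = 0" | "0 < x" by linarith
  then show ?thesis
  proof cases
    case 1 then show ?thesis using refl[of "-x"] by (simp add: prim_def)
  next
    case 2 then show ?thesis using zero by (simp add: prim_def)
  next
    case 3 then show ?thesis using refl[of x] by (simp add: prim_def)
  qed
qed

text \<open>By evenness the centre may be taken to be \<open>m \<ge> 0\<close>. Moving the window \<open>[- a, a]\<close> to the right by \<open>m\<close> gains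
  \<open>[a, a + m]\<close> and loses an interval which evenness identifies with \<open>[a - m, a]\<close>; reflection at \<open>a\<close>
  compares \<open>W (2 a - s)\<close> with \<open>W s\<close> for \<open>s \<ge> a\<close>. As \<open>\<bar>2 a - s\<bar> \<le> s\<close>, monotonicity decides unless
  \<open>2 a - s\<close> lies in the interval where \<open>W\<close> is merely bounded; there \<open>a\<close> has to be so large that \<open>W\<close> exceeds
  that bound beyond \<open>a\<close>.\<close>

lemma window_minimal_at_centre:
  assumes W: "assumption_W W"
  shows "\<exists>a0\<ge>0. \<forall>a\<ge>a0. \<forall>m. 2 * prim W a \<le> prim W (m + a) - prim W (m - a)"
proof -
  from W obtain x0 where x0: "x0 > 0" and C2: "C2_on (- {-x0..x0}) W" and pos: "\<And>x. x > x0 \<Longrightarrow> deriv W x > 0"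
    and ev: "\<And>x. W (- x) = W x" and top: "filterlim W at_top at_top"
    unfolding assumption_W_def by blast
  note pot = assumption_W_potential[OF W]
  have mono: "W x \<le> W y" if "x0 < x" "x \<le> y" for x y
  proof (rule DERIV_nonneg_imp_nondecreasing[OF that(2)])
    fix z assume z: "x \<le> z" "z \<le> y"
    then have "z \<in> - {-x0..x0}" using that by auto
    then have "(W has_real_derivative deriv W z) (at z)"
      using C2 DERIV_deriv_iff_real_differentiable by (auto simp: C2_on_def)
    then show "\<exists>D. (W has_real_derivative D) (at z) \<and> 0 \<le> D"
      using pos[of z] z that by (intro exI[of _ "deriv W z"]) auto
  qed
  obtain M where M: "AE x in lebesgue. x \<in> {-x0..x0} \<longrightarrow> \<bar>W x\<bar> \<le> M"
    using potential_bounded[OF pot, of "{-x0..x0}"] by auto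
  have "\<forall>\<^sub>F x in at_top. M \<le> W x" using top by (simp add: filterlim_at_top)
  then obtain c where c: "\<And>x. c \<le> x \<Longrightarrow> M \<le> W x" by (auto simp: eventually_at_top_linorder)
  have absW: "W \<bar>x\<bar> = W x" for x using ev[of x] by (simp add: abs_if)
  have pos_case: "2 * prim W a \<le> prim W (a + m) + prim W (a - m)" if a: "max 0 c \<le> a" and m: "0 \<le> m" for a m
  proof -
    have "prim W a - prim W (a - m) = (LINT s:{2*a-(a+m)..2*a-a}|lebesgue. W s)"
      using prim_diff[OF pot, of "a-m" a] m by (simp add: algebra_simps)
    also have "\<dots> = (LINT s:{a..a+m}|lebesgue. W (2*a - s))"
      by (rule set_integral_reflect)
    also have "\<dots> \<le> (LINT s:{a..a+m}|lebesgue. W s)"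
      unfolding set_lebesgue_integral_def
    proof (rule integral_mono_AE)
      show "integrable lebesgue (\<lambda>s. indicator {a..a+m} s *\<^sub>R W s)"
        using potential_set_integrable[OF pot, of a "a+m"] by (simp add: set_integrable_def)
      have "integrable lebesgue (\<lambda>s. indicator {a-m..a} (2*a + (-1) * s) *\<^sub>R W (2*a + (-1) * s))"
        by (rule lebesgue_integrable_real_affine)
          (use potential_set_integrable[OF pot, of "a-m" a] in \<open>auto simp: set_integrable_def\<close>)
      moreover have "(\<lambda>s. indicator {a-m..a} (2*a + (-1) * s) *\<^sub>R W (2*a + (-1) * s)) = (\<lambda>s. indicator {a..a+m} s *\<^sub>R W (2*a - s))"
        by (auto simp: indicator_def fun_eq_iff)
      ultimately show "integrable lebesgue (\<lambda>s. indicator {a..a+m} s *\<^sub>R W (2*a - s))" by simp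
      show "AE s in lebesgue. indicator {a..a+m} s *\<^sub>R W (2*a - s) \<le> indicator {a..a+m} s *\<^sub>R W s"
        using AE_translation[OF M, of "- 2 * a"]
      proof eventually_elim
        case (elim s)
        have "W (2*a - s) \<le> W s" if s: "a \<le> s"
        proof (cases "x0 < \<bar>2*a - s\<bar>")
          case True
          have "W \<bar>2*a - s\<bar> \<le> W s" by (rule mono[OF True]) (use s a in auto)
          then show ?thesis by (simp add: absW)
        next
          case False
          then have "\<bar>W (s + - 2 * a)\<bar> \<le> M" by (intro elim[rule_format]) auto
          also have "M \<le> W s" using c s a by simp
          finally show ?thesis using ev[of "2*a - s"] by (simp add: abs_le_iff algebra_simps)
        qed
        then show ?case by (simp add: indicator_def)
      qed
    qed
    also have "\<dots> = prim W (a + m) - prim W a" using prim_diff[OF pot, of a "a+m"] m by simp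
    finally show ?thesis by simp
  qed
  have "2 * prim W a \<le> prim W (m + a) - prim W (m - a)" if a: "max 0 c \<le> a" for a m
  proof -
    have odd: "prim W (m - a) = - prim W (a - m)" using prim_odd[OF pot ev, of "a - m"] by simp
    show ?thesis
      using pos_case[OF a, of m] pos_case[OF a, of "-m"] odd by (cases "0 \<le> m") (auto simp: add.commute)
  qed
  then show ?thesis by (intro exI[of _ "max 0 c"]) auto
qed

text \<open>Indicators of small intervals around \<open>y + t\<close> are moved to a neighbourhood of \<open>y\<close>, where the
  continuous weight is almost constant.\<close>

lemma onorm_evol_lower:
  assumes pot: "potential W" and t: "t \<ge> 0"
  shows "exp (prim W y - prim W (y + t)) \<le> onorm (evol W t)"
proof (rule ccontr)
  let ?e = "\<lambda>x. exp (prim W x - prim W (x + t))"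
  let ?n = "onorm (evol W t)"
  assume "\<not> ?e y \<le> ?n"
  then have less: "?n < ?e y" by simp
  note bl = bounded_linear_evol[OF pot t]
  \<comment> \<open>The weight still exceeds this intermediate value in a neighbourhood of \<open>y\<close>.\<close>
  define d where "d = (?n + ?e y) / 2"
  have d: "?n < d" "d < ?e y" "0 < d"
    using less onorm_pos_le[OF bl] by (auto simp: d_def add_nonneg_pos)
  have "continuous_on UNIV ?e"
    by (intro continuous_intros continuous_on_compose2[OF prim_continuous[OF pot]]) auto
  then have "isCont ?e y" by (simp add: continuous_on_eq_continuous_at)
  then have "\<forall>\<^sub>F x in at y. d < ?e x" using d(2) by (simp add: isCont_def order_tendstoD)
  then obtain \<delta> where \<delta>: "\<delta> > 0" "\<And>x. x \<noteq> y \<Longrightarrow> dist x y < \<delta> \<Longrightarrow> d < ?e x"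
    by (auto simp: eventually_at)
  have near: "d \<le> ?e x" if "\<bar>x - y\<bar> < \<delta>" for x
    using \<delta>(2)[of x] d(2) that by (cases "x = y") (auto simp: dist_real_def)
  define A where "A = {y + t - \<delta><..<y + t + \<delta>}"
  have A: "A \<in> lmeasurable" by (simp add: A_def)
  define f where "f = ind_l2 A"
  have f: "AE x in lebesgue. rep_l2 f x = indicator A x" unfolding f_def by (rule rep_ind_l2[OF A])
  have "(norm f)\<^sup>2 = (LINT x|lebesgue. indicator A x)"
    unfolding norm_l2_sq
  proof (rule integral_cong_AE)
    show "AE x in lebesgue. (cmod (rep_l2 f x))\<^sup>2 = indicator A x"
      using f by eventually_elim (simp add: indicator_def)
  qed (use A in \<open>auto simp: fmeasurable_def\<close>)
  also have "\<dots> = 2 * \<delta>" using \<delta>(1) by (simp add: A_def)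
  finally have "norm f \<noteq> 0" using \<delta>(1) by auto
  then have "norm f > 0" by simp
  have "norm (shift t f) \<le> (1 / d) * norm (evol W t f)"
  proof (rule norm_l2_mono)
    show "AE x in lebesgue. cmod (rep_l2 (shift t f) x) \<le> (1 / d) * cmod (rep_l2 (evol W t f) x)"
      using rep_evol_shift[OF pot t, of f] rep_shift[of t f] AE_translation[OF f, of t]
    proof eventually_elim
      case (elim x)
      show ?case
      proof (cases "x + t \<in> A")
        case True
        then have "d \<le> ?e x" by (intro near) (auto simp: A_def)
        then show ?thesis using elim d(3) True by (simp add: norm_mult field_simps)
      next
        case False
        then show ?thesis using elim by simp
      qed
    qed
  qed (use d in simp)
  then have "d * norm f \<le> norm (evol W t f)" using d(3) by (simp add: norm_shift field_simps)
  also have "\<dots> \<le> ?n * norm f" by (rule onorm[OF bl])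
  finally have "d \<le> ?n" using \<open>norm f > 0\<close> by simp
  with d(1) show False by simp
qed

lemma onorm_evol:
  assumes W: "assumption_W W"
  shows "\<exists>t0\<ge>0. \<forall>t\<ge>t0. onorm (evol W t) = exp (- 2 * (LINT s:{0..t/2}|lebesgue. W s))"
proof -
  note pot = assumption_W_potential[OF W]
  have ev: "\<And>x. W (- x) = W x" using W by (simp add: assumption_W_def)
  obtain a0 where a0: "a0 \<ge> 0" "\<And>a m. a \<ge> a0 \<Longrightarrow> 2 * prim W a \<le> prim W (m + a) - prim W (m - a)"
    using window_minimal_at_centre[OF W] by blast
  have "onorm (evol W t) = exp (- 2 * (LINT s:{0..t/2}|lebesgue. W s))" if t: "t \<ge> 2 * a0" for t
  proof -
    have t0: "t \<ge> 0" "t / 2 \<ge> a0" using t a0(1) by auto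
    have p: "(LINT s:{0..t/2}|lebesgue. W s) = prim W (t/2)" using t0(1) by (simp add: prim_def)
    show ?thesis unfolding p
    proof (rule antisym)
      show "onorm (evol W t) \<le> exp (- 2 * prim W (t/2))"
      proof (rule onorm_bound)
        fix f
        show "norm (evol W t f) \<le> exp (- 2 * prim W (t/2)) * norm f"
        proof (rule norm_evol_bound[OF pot t0(1)])
          fix x
          have "x + t/2 + t/2 = x + t" "x + t/2 - t/2 = x" by auto
          then show "exp (prim W x - prim W (x + t)) \<le> exp (- 2 * prim W (t/2))"
            using a0(2)[OF t0(2), of "x + t/2"] by (simp add: add.commute)
        qed
      qed simp
      have "- (t/2) + t = t/2" by simp
      then show "exp (- 2 * prim W (t/2)) \<le> onorm (evol W t)"
        using onorm_evol_lower[OF pot t0(1), of "- (t/2)"] prim_odd[OF pot ev, of "t/2"] by simp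
    qed
  qed
  then show ?thesis using a0(1) by (intro exI[of _ "2 * a0"]) auto
qed

theorem theorem5p1:
  fixes W :: "real \<Rightarrow> real"
  assumes "assumption_W W"
  shows "\<exists>S. C0_contraction_semigroup S \<and>
             generates (airy_dom W) (\<lambda>f. - airy W f) S \<and>
             (\<forall>t\<ge>0. \<forall>f. AE x in lebesgue.
                rep_l2 (S t f) x = of_real (exp (airy_g W t x)) * rep_l2 f (x + t)) \<and>
             (\<exists>t0\<ge>0. \<forall>t\<ge>t0. onorm (S t) = exp (- 2 * (LINT s:{0..t/2}|lebesgue. W s)))"
proof (rule exI[of _ "evol W"], intro conjI)
  note pot = assumption_W_potential[OF assms]
  show "C0_contraction_semigroup (evol W)" by (rule contraction_semigroup_evol[OF pot])
  show "generates (airy_dom W) (\<lambda>f. - airy W f) (evol W)"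
    using assumption_W_tame[OF assms] airy_generates by blast
  show "\<forall>t\<ge>0. \<forall>f. AE x in lebesgue.
      rep_l2 (evol W t f) x = of_real (exp (airy_g W t x)) * rep_l2 f (x + t)"
    using rep_evol[OF pot] by (simp add: airy_g_prim[OF pot])
  show "\<exists>t0\<ge>0. \<forall>t\<ge>t0. onorm (evol W t) = exp (- 2 * (LINT s:{0..t/2}|lebesgue. W s))"
    by (rule onorm_evol[OF assms])
qed

end
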